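(* Let $P$ be a finite poset whose incomparability graph $G = I(P)$ is claw-free. Then the Kromatic symmetric function $\overline{X}_G$ is Grothendieck-positive: writing $\overline{X}_G = \sum_{\lambda} c_\lambda \overline{s}_\lambda$ (sum over all integer partitions $\lambda$), every coefficient $c_\lambda$ is nonnegative. Moreover, for every partition $\lambda$, the coefficient $c_\lambda = [\overline{s}_\lambda]\overline{X}_G$ equals the number of Grothendieck $P$-tableaux of shape $\lambda$.
   Context: All graphs are finite and simple. For a poset $P$, its incomparability graph $I(P)$ has vertex set $P$, with an edge between $a \neq b$ iff $a \not\le_P b$ and $b \not\le_P a$. The claw $K_{1,3}$ is the graph on $\{1,2,3,4\}$ with edges $12,13,14$; $G$ is claw-free if no induced subgraph of $G$ is isomorphic to $K_{1,3}$ (equivalently, $P$ contains no subposet isomorphic to the disjoint union of a 3-element chain and a 1-element chain). $\mathbb{N}$ denotes the positive integers. The Kromatic symmetric function of a graph $G$ is the power series $\overline{X}_G = \sum_{\kappa} \prod_{v \in V(G)} \prod_{i \in \kappa(v)} x_i$, where $\kappa$ ranges over all maps assigning to each vertex $v$ a nonempty finite set $\kappa(v) \subseteq \mathbb{N}$ such that $\kappa(u) \cap \kappa(v) = \emptyset$ whenever $uv$ is an edge. It is a (non-homogeneous) symmetric power series. For a partition $\lambda$, Young diagrams are drawn in English notation (row $i$ from the top has $\lambda_i$ cells); for a cell $\mathsf{c}$, $\mathsf{c}^\rightarrow$ and $\mathsf{c}^\downarrow$ denote the cells immediately to the right of and below $\mathsf{c}$. A semistandard set-valued tableau of shape $\lambda$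 fills each cell with a nonempty finite subset of $\mathbb{N}$ so that $\max T(\mathsf{c}) \le \min T(\mathsf{c}^\rightarrow)$ and $\max T(\mathsf{c}) < \min T(\mathsf{c}^\downarrow)$ whenever these cells exist. The symmetric Grothendieck function is $\overline{s}_\lambda = \sum_T (-1)^{|T| - |\lambda|} \prod_{\mathsf{c}} \prod_{i \in T(\mathsf{c})} x_i$, summed over semistandard set-valued tableaux $T$ of shape $\lambda$, where $|T| = \sum_{\mathsf{c}} |T(\mathsf{c})|$. Its lowest-degree part is the Schur function $s_\lambda$, so every symmetric power series has a unique expansion as a (possibly infinite) formal linear combination of the $\overline{s}_\lambda$; $[\overline{s}_\lambda]f$ denotes the coefficient of $\overline{s}_\lambda$ in this expansion. Assume (replacing $P$ by an isomorphic copy) that $P \cap \mathbb{N} = \emptyset$. A Grothendieck $P$-tableau of shape $\lambda$ is a filling $T$ of the cells of the Young diagram of $\lambda$ with elements of $P \sqcup \mathbb{N}$ such that: (i) the cells filled with elements of $P$ form the Young diagram of some partition $\mu \subseteq \lambda$; (ii) every $p \in P$ appears in at least one cell; (iii) for each cell $\mathsf{c}$ with $T(\mathsf{c}) \in P$: $T(\mathsf{c}) <_P T(\mathsf{c}^\rightarrow)$ if $T(\mathsf{c}^\rightarrow) \in P$, and $T(\mathsf{c}) \not>_P T(\mathsf{c}^\downarrow)$ if $T(\mathsf{c}^\downarrow) \in P$; (iv) for each cell $\mathsf{c}$ with $T(\mathsf{c}) \in \mathbb{N}$: $T(\mathsf{c}) \le T(\mathsf{c}^\rightarrow)$ if $T(\mathsf{c}^\rightarrow)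 \in \mathbb{N}$, $T(\mathsf{c}) < T(\mathsf{c}^\downarrow)$ if $T(\mathsf{c}^\downarrow) \in \mathbb{N}$, and $T(\mathsf{c}) \le i-1$ if $\mathsf{c}$ lies in row $i$ (so row 1 contains no positive integers). *)

theory Defs
  imports
    "HOL-Library.Multiset"
    "HOL-Library.FuncSet"
    "Graph_Theory.Pair_Digraph"
    "Graph_Theory.Digraph_Component"
    "Graph_Theory.Digraph_Isomorphism"
begin

section \<open>Incomparability graphs and claws\<close>

text \<open>
  Simple graphs are symmetric loop-free digraphs, as everywhere in \<open>Graph_Theory\<close>.
  A poset is a carrier \<open>P\<close> together with its reflexive order relation \<open>r\<close>
  (\<open>partial_order_on P r\<close>), so the empty poset is allowed.
\<close>

definition incomparability_graph :: "'a set \<Rightarrow> 'a rel \<Rightarrow> 'a pair_pre_digraph" where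
  "incomparability_graph P r =
    \<lparr> pverts = P,
      parcs = {(a, b). a \<in> P \<and> b \<in> P \<and> a \<noteq> b \<and> (a, b) \<notin> r \<and> (b, a) \<notin> r} \<rparr>"

lemma pair_graph_incomparability_graph:
  assumes "finite P"
  shows "pair_graph (incomparability_graph P r)"
proof -
  have "finite (parcs (incomparability_graph P r))"
    by (rule finite_subset[of _ "P \<times> P"]) (auto simp: incomparability_graph_def assms)
  then show ?thesis
    by unfold_locales
       (auto simp: incomparability_graph_def assms symmetric_def sym_def)
qed

definition claw :: "nat pair_pre_digraph" where
  "claw = \<lparr> pverts = {1, 2, 3, 4},
            parcs = {(1, 2), (2, 1), (1, 3), (3, 1), (1, 4), (4, 1)} \<rparr>"

lemma pair_graph_claw: "pair_graph claw"
  by unfold_locales (auto simp: claw_def symmetric_def sym_def)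

definition claw_free :: "('a, 'b) pre_digraph \<Rightarrow> bool" where
  "claw_free G \<longleftrightarrow> \<not> (\<exists>H. induced_subgraph H G \<and> digraph_iso H (with_proj claw))"


section \<open>Power series in infinitely many variables\<close>

text \<open>
  A multiset \<open>m\<close> of positive integers stands for the monomial \<open>\<Prod>i\<in>#m. x\<^sub>i\<close>, and a formal
  power series in \<open>x\<^sub>1, x\<^sub>2, \<dots>\<close> is the function mapping a monomial to its coefficient.
  Multisets containing \<open>0\<close> have coefficient \<open>0\<close> in all series below.
\<close>

type_synonym power_series = "nat multiset \<Rightarrow> int"

text \<open>The series \<open>\<Sum>t\<in>S. w t * mon t\<close>; it makes sense when the fibres of \<open>mon\<close> are finite.\<close>

definition formal_sum :: "'t set \<Rightarrow> ('t \<Rightarrow> int) \<Rightarrow> ('t \<Rightarrow> nat multiset) \<Rightarrow> power_series" where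
  "formal_sum S w mon = (\<lambda>m. \<Sum>t \<in> {t \<in> S. mon t = m}. w t)"

definition label_sets :: "nat set set" where
  "label_sets = {A. finite A \<and> A \<noteq> {} \<and> 0 \<notin> A}"

text \<open>The monomial \<open>\<Prod>c\<in>D. \<Prod>i\<in>F c. x\<^sub>i\<close>.\<close>

definition label_monomial :: "'c set \<Rightarrow> ('c \<Rightarrow> nat set) \<Rightarrow> nat multiset" where
  "label_monomial D F = (\<Sum>c\<in>D. mset_set (F c))"

lemma finite_label_monomial_fibre:
  assumes "finite D"
  shows "finite {F \<in> D \<rightarrow>\<^sub>E label_sets. label_monomial D F = m}"
proof (rule finite_subset)
  show "{F \<in> D \<rightarrow>\<^sub>E label_sets. label_monomial D F = m} \<subseteq> D \<rightarrow>\<^sub>E Pow (set_mset m)"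
  proof
    fix F assume F: "F \<in> {F \<in> D \<rightarrow>\<^sub>E label_sets. label_monomial D F = m}"
    have "F c \<subseteq> set_mset m" if c: "c \<in> D" for c
    proof -
      have "finite (F c)" using F c by (auto simp: label_sets_def PiE_iff)
      moreover have "mset_set (F c) \<subseteq># m"
        using F c assms by (auto simp: label_monomial_def sum.remove)
      ultimately show ?thesis by (metis finite_set_mset_mset_set set_mset_mono)
    qed
    then show "F \<in> D \<rightarrow>\<^sub>E Pow (set_mset m)" using F by (auto simp: PiE_iff)
  qed
  show "finite (D \<rightarrow>\<^sub>E Pow (set_mset m))" using assms by (simp add: finite_PiE)
qed


section \<open>The Kromatic symmetric function\<close>

definition proper_set_colorings :: "('a, 'b) pre_digraph \<Rightarrow> ('a \<Rightarrow> nat set) set" where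
  "proper_set_colorings G =
    {\<kappa> \<in> verts G \<rightarrow>\<^sub>E label_sets. \<forall>u v. u \<rightarrow>\<^bsub>G\<^esub> v \<longrightarrow> \<kappa> u \<inter> \<kappa> v = {}}"

definition kromatic :: "('a, 'b) pre_digraph \<Rightarrow> power_series" where
  "kromatic G = formal_sum (proper_set_colorings G) (\<lambda>_. 1) (label_monomial (verts G))"

lemma finite_kromatic_fibre:
  assumes "finite (verts G)"
  shows "finite {\<kappa> \<in> proper_set_colorings G. label_monomial (verts G) \<kappa> = m}"
  by (rule finite_subset[OF _ finite_label_monomial_fibre[OF assms, of m]])
     (auto simp: proper_set_colorings_def)


section \<open>Partitions and symmetric Grothendieck functions\<close>

definition is_partition :: "nat list \<Rightarrow> bool" where
  "is_partition l \<longleftrightarrow> sorted_wrt (\<ge>) l \<and> 0 \<notin> set l"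

text \<open>
  English notation; a cell is a pair (row, column), both counted from \<open>0\<close>, so the cell to the
  right of \<open>(i, j)\<close> is \<open>(i, Suc j)\<close> and the cell below it is \<open>(Suc i, j)\<close>.
\<close>

definition young_diagram :: "nat list \<Rightarrow> (nat \<times> nat) set" where
  "young_diagram l = {(i, j). i < length l \<and> j < l ! i}"

lemma finite_young_diagram: "finite (young_diagram l)"
proof -
  have "young_diagram l = (SIGMA i:{..<length l}. {..<l ! i})"
    by (auto simp: young_diagram_def)
  then show ?thesis by simp
qed

definition set_valued_tableaux :: "nat list \<Rightarrow> (nat \<times> nat \<Rightarrow> nat set) set" where
  "set_valued_tableaux l =
    {T \<in> young_diagram l \<rightarrow>\<^sub>E label_sets.
      (\<forall>i j. (i, j) \<in> young_diagram l \<longrightarrow> (i, Suc j) \<in> young_diagram l \<longrightarrow>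
         Max (T (i, j)) \<le> Min (T (i, Suc j))) \<and>
      (\<forall>i j. (i, j) \<in> young_diagram l \<longrightarrow> (Suc i, j) \<in> young_diagram l \<longrightarrow>
         Max (T (i, j)) < Min (T (Suc i, j)))}"

text \<open>Since all label sets are nonempty, the subtraction in the exponent does not truncate.\<close>

definition grothendieck :: "nat list \<Rightarrow> power_series" where
  "grothendieck l =
    formal_sum (set_valued_tableaux l)
      (\<lambda>T. (-1) ^ ((\<Sum>c\<in>young_diagram l. card (T c)) - sum_list l))
      (label_monomial (young_diagram l))"

lemma finite_grothendieck_fibre:
  "finite {T \<in> set_valued_tableaux l. label_monomial (young_diagram l) T = m}"
  by (rule finite_subset[OF _ finite_label_monomial_fibre[OF finite_young_diagram, of l m]])
     (auto simp: set_valued_tableaux_def)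

text \<open>
  \<open>f = \<Sum>l. c l * grothendieck l\<close> over all partitions \<open>l\<close>, as a possibly infinite formal linear
  combination: every monomial receives only finitely many nonzero contributions.
\<close>

definition grothendieck_expansion :: "power_series \<Rightarrow> (nat list \<Rightarrow> int) \<Rightarrow> bool" where
  "grothendieck_expansion f c \<longleftrightarrow>
    (\<forall>l. \<not> is_partition l \<longrightarrow> c l = 0) \<and>
    (\<forall>m. finite {l. c l * grothendieck l m \<noteq> 0} \<and>
         f m = (\<Sum>l \<in> {l. c l * grothendieck l m \<noteq> 0}. c l * grothendieck l m))"

definition grothendieck_coeff :: "nat list \<Rightarrow> power_series \<Rightarrow> int" where
  "grothendieck_coeff l f = (THE c. grothendieck_expansion f c) l"


section \<open>Grothendieck \<open>P\<close>-tableaux\<close>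

abbreviation (input) strictly_below :: "'a rel \<Rightarrow> 'a \<Rightarrow> 'a \<Rightarrow> bool" where
  "strictly_below r p q \<equiv> (p, q) \<in> r \<and> p \<noteq> q"

text \<open>
  The disjoint union of \<open>P\<close> and the positive integers is the sum \<open>P <+> {0<..}\<close>.
  The bound \<open>n \<le> i\<close> for an integer \<open>n\<close> in row \<open>i\<close> counts rows from \<open>0\<close>; it is the bound
  \<open>n \<le> i - 1\<close> if rows are counted from \<open>1\<close>.
\<close>

definition grothendieck_P_tableaux ::
    "'a set \<Rightarrow> 'a rel \<Rightarrow> nat list \<Rightarrow> (nat \<times> nat \<Rightarrow> 'a + nat) set" where
  "grothendieck_P_tableaux P r l = (let D = young_diagram l in
    {T \<in> D \<rightarrow>\<^sub>E (P <+> {0<..}).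
      (\<exists>k. is_partition k \<and> young_diagram k \<subseteq> D \<and> {c \<in> D. T c \<in> Inl ` P} = young_diagram k) \<and>
      (\<forall>p\<in>P. \<exists>c\<in>D. T c = Inl p) \<and>
      (\<forall>i j p. (i, j) \<in> D \<longrightarrow> T (i, j) = Inl p \<longrightarrow>
        (\<forall>q. (i, Suc j) \<in> D \<longrightarrow> T (i, Suc j) = Inl q \<longrightarrow> strictly_below r p q) \<and>
        (\<forall>q. (Suc i, j) \<in> D \<longrightarrow> T (Suc i, j) = Inl q \<longrightarrow> \<not> strictly_below r q p)) \<and>
      (\<forall>i j n. (i, j) \<in> D \<longrightarrow> T (i, j) = Inr n \<longrightarrow>
        (\<forall>n'. (i, Suc j) \<in> D \<longrightarrow> T (i, Suc j) = Inr n' \<longrightarrow> n \<le> n') \<and>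
        (\<forall>n'. (Suc i, j) \<in> D \<longrightarrow> T (Suc i, j) = Inr n' \<longrightarrow> n < n') \<and>
        n \<le> i)})"

lemma finite_grothendieck_P_tableaux:
  assumes "finite P"
  shows "finite (grothendieck_P_tableaux P r l)"
proof (rule finite_subset)
  show "grothendieck_P_tableaux P r l \<subseteq> young_diagram l \<rightarrow>\<^sub>E (P <+> {..length l})"
  proof
    fix T assume T: "T \<in> grothendieck_P_tableaux P r l"
    have "T (i, j) \<in> P <+> {..length l}" if c: "(i, j) \<in> young_diagram l" for i j
    proof -
      have "T (i, j) \<in> P <+> {0<..}"
        using T c by (simp add: grothendieck_P_tableaux_def Let_def PiE_iff)
      moreover have "n \<le> i" if "T (i, j) = Inr n" for n
        using T c that unfolding grothendieck_P_tableaux_def Let_def by blast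
      moreover have "i < length l" using c by (simp add: young_diagram_def)
      ultimately show ?thesis by (cases "T (i, j)") force+
    qed
    then show "T \<in> young_diagram l \<rightarrow>\<^sub>E (P <+> {..length l})"
      using T by (simp add: grothendieck_P_tableaux_def Let_def PiE_iff split_paired_all)
  qed
  show "finite (young_diagram l \<rightarrow>\<^sub>E (P <+> {..length l}))"
    using assms by (simp add: finite_PiE finite_young_diagram finite_Plus)
qed

end

theory Submission
  imports
    Defs
    "Jordan_Normal_Form.Determinant"
    "HOL-Library.Poly_Mapping"
    "HOL-Library.Multiset_Order"
begin

text \<open>
  In \<open>n\<close> variables, multiplying the symmetric Grothendieck function of shape \<open>\<mu>\<close> by the
  Vandermonde determinant \<open>V\<close> gives the determinant of
  \<open>x\<^sub>i\<^bsup>\<mu>\<^sub>j + n - 1 - j\<^esup> (1 - x\<^sub>i)\<^sup>j\<close> (indices start at \<open>0\<close>): both sides satisfy the same branching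
  rule when the last variable is split off. Consequently the coefficient of \<open>x\<^bsup>\<lambda> + \<delta>\<^esup>\<close> in
  \<open>V f \<Prod>\<^sub>i (1 - x\<^sub>i)\<^bsup>-i\<^esup>\<close> is a linear functional of \<open>f\<close> dual to these functions, and these
  functionals jointly detect whether the alternating polynomial \<open>V f\<close> vanishes.

  A set colouring is a covering of \<open>P\<close> by chains, one for each colour, so the functional at
  \<open>\<lambda>\<close> turns the Kromatic function into a signed count of arrays whose rows are chains
  followed by weakly increasing integers. Gasharov's tail swapping, applied to these extended
  rows, cancels everything except the Grothendieck \<open>P\<close>-tableaux of shape \<open>\<lambda>\<close>.
\<close>

section \<open>Determinants of Grothendieck type\<close>

text \<open>The factors \<open>1 / (1 - x\<^sub>i)\<^sup>i\<close> serve two ends. Column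
  \<open>j\<close> of the determinant carries \<open>(1 - x)\<^sup>j\<close>, so in the term of a
  permutation \<open>p\<close> the two combine to \<open>1 - x\<close> with exponent
  \<open>j - p j\<close>: the identity leaves a bare monomial, and for every other \<open>p\<close>
  the degrees are incompatible. On the other side, the coefficient of \<open>x\<^sup>z\<close> in
  \<open>1 / (1 - x)\<^sup>i\<close> counts the weakly increasing words of length \<open>z\<close>
  over \<open>{1..i}\<close>. Appended to a chain, such a word becomes the integer part of row
  \<open>i\<close> of a P-tableau (rows from 0), whence the bound on the integers there. The
  obstacle is that the expansion is infinite. Series are therefore compared one monomial at a time,
  in as many variables as that monomial needs; then only shapes with at most \<open>n\<close> rows
  count, and since the first row of a P-tableau is a chain, finitely many remain. Inverses of
  \<open>1 - x\<^sub>i\<close> are never formed: the functional is defined on exponent vectors of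
  alternants, and a finite convolution shows that it depends on the polynomial alone.\<close>

lemma det_separated_sums:
  fixes a :: "nat \<Rightarrow> 'r::comm_ring_1"
  assumes "\<And>j. j < n \<Longrightarrow> finite (K j)"
  shows "det (mat n n (\<lambda>(i, j). a i * (\<Sum>v\<in>K j. c j v * g j v i))) =
    (\<Prod>i<n. a i) *
    (\<Sum>\<nu>\<in>PiE {..<n} K. (\<Prod>j<n. c j (\<nu> j)) * det (mat n n (\<lambda>(i, j). g j (\<nu> j) i)))"
proof -
  let ?P = "{p. p permutes {0..<n}}"
  have p_lt: "p j < n" if "p \<in> ?P" "j < n" for p j
    using that permutes_in_image[of p "{0..<n}" j] by auto
  have prod_eq: "(\<Prod>j<n. a (p j) * (\<Sum>v\<in>K j. c j v * g j v (p j))) =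
      (\<Prod>i<n. a i) * (\<Sum>\<nu>\<in>PiE {..<n} K. (\<Prod>j<n. c j (\<nu> j)) * (\<Prod>j<n. g j (\<nu> j) (p j)))"
    if p: "p \<in> ?P" for p
  proof -
    have "(\<Prod>j<n. a (p j)) = (\<Prod>i<n. a i)"
      using prod.permute[of p "{..<n}" a] p by (simp add: atLeast0LessThan comp_def)
    moreover have "(\<Prod>j<n. \<Sum>v\<in>K j. c j v * g j v (p j)) =
        (\<Sum>\<nu>\<in>PiE {..<n} K. \<Prod>j<n. c j (\<nu> j) * g j (\<nu> j) (p j))"
      using assms by (subst prod_sum_PiE) auto
    ultimately show ?thesis by (simp add: prod.distrib)
  qed
  have "det (mat n n (\<lambda>(i, j). a i * (\<Sum>v\<in>K j. c j v * g j v i))) =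
      (\<Sum>p\<in>?P. signof p * (\<Prod>j<n. a (p j) * (\<Sum>v\<in>K j. c j v * g j v (p j))))"
    by (subst det_col[where n = n]) (auto simp: p_lt intro!: sum.cong prod.cong)
  also have "\<dots> = (\<Sum>p\<in>?P. \<Sum>\<nu>\<in>PiE {..<n} K. (\<Prod>i<n. a i) * (\<Prod>j<n. c j (\<nu> j)) *
      (signof p * (\<Prod>j<n. g j (\<nu> j) (p j))))"
    by (intro sum.cong refl, subst prod_eq) (simp_all add: sum_distrib_left mult_ac)
  also have "\<dots> = (\<Prod>i<n. a i) * (\<Sum>\<nu>\<in>PiE {..<n} K. (\<Prod>j<n. c j (\<nu> j)) *
      (\<Sum>p\<in>?P. signof p * (\<Prod>j<n. g j (\<nu> j) (p j))))"
    by (subst sum.swap) (simp add: sum_distrib_left mult_ac)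
  also have "\<dots> = (\<Prod>i<n. a i) *
    (\<Sum>\<nu>\<in>PiE {..<n} K. (\<Prod>j<n. c j (\<nu> j)) * det (mat n n (\<lambda>(i, j). g j (\<nu> j) i)))"
    by (subst det_col[where n = n]) (auto simp: p_lt intro!: sum.cong prod.cong)
  finally show ?thesis .
qed

text \<open>Keeping \<open>\<beta>\<close> as a parameter lets one recursion cover the Grothendieck
  case \<open>\<beta> = 1\<close> and, at \<open>\<beta> = 0\<close>, the Schur bialternant, whose
  value at the empty shape is the Vandermonde determinant.\<close>

definition groth_det :: "'r::comm_ring_1 \<Rightarrow> nat \<Rightarrow> (nat \<Rightarrow> nat) \<Rightarrow> (nat \<Rightarrow> 'r) \<Rightarrow> 'r" where
  "groth_det \<beta> n \<mu> y = det (mat n n (\<lambda>(i, j). y i ^ (\<mu> j + (n - Suc j)) * (1 - \<beta> * y i) ^ j))"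

text \<open>Contribution of the last variable in the branching rule. The powers of \<open>t\<close>
  count the cells of \<mu> outside \<nu>. A factor \<open>1 - \<beta> * t\<close> comes from each
  row of \<nu> whose last cell has no cell of \<mu> below it and may therefore carry the new entry
  as well.\<close>

definition strip_weight :: "'r::comm_ring_1 \<Rightarrow> nat \<Rightarrow> (nat \<Rightarrow> nat) \<Rightarrow> 'r \<Rightarrow> (nat \<Rightarrow> nat) \<Rightarrow> 'r" where
  "strip_weight \<beta> n \<mu> t \<nu> =
    t ^ \<mu> n * (\<Prod>i<n. t ^ (\<mu> i - \<nu> i) * (if \<mu> (Suc i) < \<nu> i then 1 - \<beta> * t else 1))"

abbreviation interlacing :: "nat \<Rightarrow> (nat \<Rightarrow> nat) \<Rightarrow> (nat \<Rightarrow> nat) set" where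
  "interlacing n \<mu> \<equiv> \<Pi>\<^sub>E i\<in>{..<n}. {\<mu> (Suc i)..\<mu> i}"

text \<open>Apart from \<beta> this is the geometric sum. The \<beta>-part is
  \<open>- \<beta> x t (x^d - t^d)\<close>; its quotient by \<open>x - t\<close> consists of exactly
  the terms with \<open>k > 0\<close>, each multiplied by \<open>- \<beta> t\<close>, hence the case
  distinction.\<close>

lemma telescoping_quotient:
  fixes x t :: "'r::comm_ring_1"
  shows "x ^ Suc d * (1 - \<beta> * t) - t ^ Suc d * (1 - \<beta> * x) =
    (x - t) * (\<Sum>k\<le>d. x ^ k * (t ^ (d - k) * (if 0 < k then 1 - \<beta> * t else 1)))"
proof (induction d)
  case 0
  then show ?case by (simp add: algebra_simps)
next
  case (Suc d)
  let ?w = "\<lambda>k. if 0 < k then 1 - \<beta> * t else (1::'r)"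
  have "(\<Sum>k\<le>Suc d. x ^ k * (t ^ (Suc d - k) * ?w k)) =
      t * (\<Sum>k\<le>d. x ^ k * (t ^ (d - k) * ?w k)) + x ^ Suc d * (1 - \<beta> * t)"
    by (simp add: sum_distrib_left Suc_diff_le mult_ac)
  then have "(x - t) * (\<Sum>k\<le>Suc d. x ^ k * (t ^ (Suc d - k) * ?w k)) =
      t * (x ^ Suc d * (1 - \<beta> * t) - t ^ Suc d * (1 - \<beta> * x)) + (x - t) * x ^ Suc d * (1 - \<beta> * t)"
    by (simp only: Suc.IH) (simp add: algebra_simps Suc.IH)
  then show ?case by (simp add: algebra_simps)
qed

lemma telescoping_quotient_interval:
  fixes x t :: "'r::comm_ring_1"
  assumes "m \<le> l"
  shows "x ^ Suc l * (1 - \<beta> * t) - t ^ Suc (l - m) * x ^ m * (1 - \<beta> * x) =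
    (x - t) * (\<Sum>v\<in>{m..l}. x ^ v * (t ^ (l - v) * (if m < v then 1 - \<beta> * t else 1)))"
proof -
  have "(\<Sum>v\<in>{m..l}. x ^ v * (t ^ (l - v) * (if m < v then 1 - \<beta> * t else 1))) =
      (\<Sum>k\<le>l - m. x ^ (k + m) * (t ^ (l - m - k) * (if 0 < k then 1 - \<beta> * t else 1)))"
    using assms
    by (intro sum.reindex_bij_witness[where j = "\<lambda>v. v - m" and i = "\<lambda>k. k + m"]) auto
  also have "\<dots> = x ^ m * (\<Sum>k\<le>l - m. x ^ k * (t ^ (l - m - k) * (if 0 < k then 1 - \<beta> * t else 1)))"
    by (simp add: sum_distrib_left power_add mult_ac)
  finally have "(x - t) * (\<Sum>v\<in>{m..l}. x ^ v * (t ^ (l - v) * (if m < v then 1 - \<beta> * t else 1))) =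
      x ^ m * (x ^ Suc (l - m) * (1 - \<beta> * t) - t ^ Suc (l - m) * (1 - \<beta> * x))"
    by (simp only: telescoping_quotient mult.left_commute)
  moreover have "m + Suc (l - m) = Suc l"
    using assms by simp
  then have "x ^ m * x ^ Suc (l - m) = x ^ Suc l"
    by (metis power_add)
  then have "x ^ m * (x ^ Suc (l - m) * (1 - \<beta> * t) - t ^ Suc (l - m) * (1 - \<beta> * x)) =
      x ^ Suc l * (1 - \<beta> * t) - t ^ Suc (l - m) * x ^ m * (1 - \<beta> * x)"
    by (simp only: right_diff_distrib flip: mult.assoc) (simp only: mult.commute)
  ultimately show ?thesis by simp
qed

text \<open>
  Subtracting suitable multiples of the neighbouring columns clears the last row of the
  determinant apart from its last entry; the entries of the remaining minor are divisible by
  \<open>y i - y n\<close>, and the quotients are geometric sums indexed by interlacing shapes.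
\<close>

lemma groth_det_rec:
  fixes y :: "nat \<Rightarrow> 'r::idom"
  assumes dec: "\<And>i. i < n \<Longrightarrow> \<mu> (Suc i) \<le> \<mu> i" and nz: "1 - \<beta> * y n \<noteq> 0"
  shows "groth_det \<beta> (Suc n) \<mu> y = (\<Prod>i<n. y i - y n) *
    (\<Sum>\<nu>\<in>interlacing n \<mu>. strip_weight \<beta> n \<mu> (y n) \<nu> * groth_det \<beta> n \<nu> y)"
proof -
  define t where "t = y n"
  define f where "f i j = y i ^ (\<mu> j + (n - j)) * (1 - \<beta> * y i) ^ j" for i j
  define A where "A = mat (Suc n) (Suc n) (\<lambda>(i, j). f i j)"
  \<comment> \<open>\<open>B\<close> is lower bidiagonal. The exponent makes column
    \<open>j < n\<close> of \<open>A * B\<close> vanish in the last row, where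
    \<open>y n = t\<close>: both terms are then
    \<open>t^(\<mu> j + n - j) (1 - \<beta> t)^(j + 1)\<close>. Column \<open>n\<close> stays as it
    is.\<close>
  define b where "b k j = (if k = j then (if j < n then 1 - \<beta> * t else 1)
      else if k = Suc j then - (t ^ Suc (\<mu> j - \<mu> (Suc j))) else 0)" for k j
  define B where "B = mat (Suc n) (Suc n) (\<lambda>(k, j). b k j)"
  define g where "g j v i = y i ^ (v + (n - Suc j)) * (1 - \<beta> * y i) ^ j" for j v i
  define c where "c j v = t ^ (\<mu> j - v) * (if \<mu> (Suc j) < v then 1 - \<beta> * t else 1)" for j v
  have A_carr: "A \<in> carrier_mat (Suc n) (Suc n)" and B_carr: "B \<in> carrier_mat (Suc n) (Suc n)"
    by (auto simp: A_def B_def)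
  have det_B: "det B = (1 - \<beta> * t) ^ n"
  proof -
    have "det B = prod_list (diag_mat B)"
      by (rule det_lower_triangular[OF _ B_carr]) (auto simp: B_def b_def)
    also have "\<dots> = (\<Prod>i<Suc n. b i i)"
      by (simp add: prod_list_diag_prod B_def atLeast0LessThan)
    also have "\<dots> = (1 - \<beta> * t) ^ n" by (simp add: b_def)
    finally show ?thesis .
  qed
  have AB: "(A * B) $$ (i, j) = (\<Sum>k<Suc n. f i k * b k j)" if "i < Suc n" "j < Suc n" for i j
    using that by (simp add: A_def B_def scalar_prod_def atLeast0LessThan)
  have AB_last: "(A * B) $$ (i, n) = f i n" if "i < Suc n" for i
    using that by (subst AB) (auto simp: b_def)
  have AB_entry: "(A * B) $$ (i, j) = (y i - t) * (\<Sum>v\<in>{\<mu> (Suc j)..\<mu> j}. c j v * g j v i)"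
    if i: "i < Suc n" and j: "j < n" for i j
  proof -
    have "(A * B) $$ (i, j) = (\<Sum>k<Suc n. (if k = j then f i j * (1 - \<beta> * t) else 0) +
        (if k = Suc j then - f i (Suc j) * t ^ Suc (\<mu> j - \<mu> (Suc j)) else 0))"
      using j by (subst AB[OF i]) (auto intro!: sum.cong simp: b_def)
    also have "\<dots> = f i j * (1 - \<beta> * t) - f i (Suc j) * t ^ Suc (\<mu> j - \<mu> (Suc j))"
      using j by (simp add: sum.distrib sum.delta del: sum.lessThan_Suc)
    also have "\<dots> = y i ^ (n - Suc j) * (1 - \<beta> * y i) ^ j * (y i ^ Suc (\<mu> j) * (1 - \<beta> * t) -
        t ^ Suc (\<mu> j - \<mu> (Suc j)) * y i ^ \<mu> (Suc j) * (1 - \<beta> * y i))"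
    proof -
      obtain m where "n - Suc j = m" "n - j = Suc m"
        using j by (metis Suc_diff_Suc)
      then show ?thesis by (simp add: f_def power_add algebra_simps)
    qed
    also have "\<dots> = y i ^ (n - Suc j) * (1 - \<beta> * y i) ^ j * ((y i - t) * (\<Sum>v\<in>{\<mu> (Suc j)..\<mu> j}.
        y i ^ v * (t ^ (\<mu> j - v) * (if \<mu> (Suc j) < v then 1 - \<beta> * t else 1))))"
      using dec[OF j] by (simp only: telescoping_quotient_interval)
    also have "\<dots> = (y i - t) * (\<Sum>v\<in>{\<mu> (Suc j)..\<mu> j}. c j v * g j v i)"
      by (simp add: c_def g_def sum_distrib_left power_add mult_ac)
    finally show ?thesis .
  qed
  have AB_carr: "A * B \<in> carrier_mat (Suc n) (Suc n)"
    using A_carr B_carr by simp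
  have "mat_delete (A * B) n n =
      mat n n (\<lambda>(i, j). (y i - t) * (\<Sum>v\<in>{\<mu> (Suc j)..\<mu> j}. c j v * g j v i))"
    (is "_ = ?M")
  proof (rule eq_matI)
    fix i j assume "i < dim_row ?M" "j < dim_col ?M"
    then show "mat_delete (A * B) n n $$ (i, j) = ?M $$ (i, j)"
      using AB_entry[of i j] AB_carr by (simp add: mat_delete_def A_def B_def)
  qed (use AB_carr in \<open>auto simp: mat_delete_def\<close>)
  then have minor: "det (mat_delete (A * B) n n) =
    (\<Prod>i<n. y i - t) * (\<Sum>\<nu>\<in>interlacing n \<mu>. (\<Prod>j<n. c j (\<nu> j)) * groth_det \<beta> n \<nu> y)"
    by (simp add: det_separated_sums groth_det_def g_def)
  have "det (A * B) = (\<Sum>j<Suc n. (A * B) $$ (n, j) * cofactor (A * B) n j)"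
    by (rule laplace_expansion_row[OF AB_carr]) simp
  also have "\<dots> = (A * B) $$ (n, n) * cofactor (A * B) n n"
    by (simp add: AB_entry flip: t_def)
  also have "\<dots> = t ^ \<mu> n * (1 - \<beta> * t) ^ n * det (mat_delete (A * B) n n)"
    by (simp add: AB_last cofactor_def f_def t_def)
  finally have "det A * (1 - \<beta> * t) ^ n =
      (t ^ \<mu> n * det (mat_delete (A * B) n n)) * (1 - \<beta> * t) ^ n"
    using det_mult[OF A_carr B_carr] by (simp add: det_B)
  \<comment> \<open>The power of \<open>1 - \<beta> * t\<close> in \<open>det B\<close> equals the
    one in the corner entry, so the two cancel in the integral domain.\<close>
  then have "det A = t ^ \<mu> n * det (mat_delete (A * B) n n)"
    using nz by (simp add: t_def)
  moreover have "det A = groth_det \<beta> (Suc n) \<mu> y"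
    by (simp add: A_def groth_det_def f_def)
  ultimately show ?thesis
    unfolding minor strip_weight_def c_def t_def by (simp add: sum_distrib_left mult_ac)
qed

definition vandermonde :: "nat \<Rightarrow> (nat \<Rightarrow> 'r::comm_ring_1) \<Rightarrow> 'r" where
  "vandermonde n y = (\<Prod>k<n. \<Prod>i<k. y i - y k)"

text \<open>At \<open>\<beta> = 0\<close> and the zero shape the recursion has a single interlacing
  shape, of weight 1, so each step only adds the differences with the last variable.\<close>

lemma vandermonde_eq_det:
  fixes y :: "nat \<Rightarrow> 'r::idom"
  shows "vandermonde n y = det (mat n n (\<lambda>(i, j). y i ^ (n - Suc j)))"
proof -
  have "vandermonde n y = groth_det 0 n (\<lambda>_. 0) y"
  proof (induction n)
    case 0
    then show ?case by (simp add: vandermonde_def groth_det_def)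
  next
    case (Suc n)
    have "groth_det 0 n \<nu> y = groth_det 0 n (\<lambda>_. 0) y" if "\<nu> \<in> interlacing n (\<lambda>_. 0)" for \<nu>
      using that unfolding groth_det_def
      by (intro arg_cong[where f = det] cong_mat) (auto simp: PiE_iff)
    moreover have "card (interlacing n (\<lambda>_. 0)) = 1"
      by (simp add: card_PiE)
    ultimately show ?case
      using Suc.IH by (simp add: groth_det_rec strip_weight_def vandermonde_def mult.commute)
  qed
  then show ?thesis by (simp add: groth_det_def)
qed

section \<open>Set-valued tableaux and their branching rule\<close>

definition diagram :: "(nat \<Rightarrow> nat) \<Rightarrow> (nat \<times> nat) set" where
  "diagram \<mu> = {(i, j). j < \<mu> i}"

text \<open>Partitions with at most \<open>n\<close> parts, padded with zeros: row indices need no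
  range checks, and the type stays the same when \<open>n\<close> drops.\<close>

definition shapes :: "nat \<Rightarrow> (nat \<Rightarrow> nat) set" where
  "shapes n = {\<mu>. (\<forall>i. \<mu> (Suc i) \<le> \<mu> i) \<and> \<mu> n = 0}"

lemma shapes_antimono: "\<mu> \<in> shapes n \<Longrightarrow> i \<le> j \<Longrightarrow> \<mu> j \<le> \<mu> i"
  by (rule lift_Suc_antimono_le) (auto simp: shapes_def)

lemma shapes_eq_0: "\<mu> \<in> shapes n \<Longrightarrow> n \<le> i \<Longrightarrow> \<mu> i = 0"
  using shapes_antimono[of \<mu> n n i] by (simp add: shapes_def)

lemma finite_diagram: "\<mu> \<in> shapes n \<Longrightarrow> finite (diagram \<mu>)"
proof (rule finite_subset)
  assume \<mu>: "\<mu> \<in> shapes n"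
  have "i < n" if "j < \<mu> i" for i j
    using shapes_eq_0[OF \<mu>, of i] that by (cases "i < n") auto
  then show "diagram \<mu> \<subseteq> (SIGMA i:{..<n}. {..<\<mu> i})"
    by (auto simp: diagram_def)
qed auto

definition svt :: "nat \<Rightarrow> (nat \<Rightarrow> nat) \<Rightarrow> (nat \<times> nat \<Rightarrow> nat set) set" where
  "svt n \<mu> = {T \<in> diagram \<mu> \<rightarrow>\<^sub>E Pow {1..n} - {{}}.
    (\<forall>i j. (i, Suc j) \<in> diagram \<mu> \<longrightarrow> (\<forall>a\<in>T (i, j). \<forall>b\<in>T (i, Suc j). a \<le> b)) \<and>
    (\<forall>i j. (Suc i, j) \<in> diagram \<mu> \<longrightarrow> (\<forall>a\<in>T (i, j). \<forall>b\<in>T (Suc i, j). a < b))}"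

text \<open>For nonempty \<open>S\<close> this is \<open>(-1)^(card S - 1)\<close> times the
  monomial of \<open>S\<close>; it distributes the sign of a set-valued tableau over its
  cells.\<close>

definition cell_weight :: "(nat \<Rightarrow> 'r::comm_ring_1) \<Rightarrow> nat set \<Rightarrow> 'r" where
  "cell_weight x S = - (\<Prod>i\<in>S. - x i)"

definition groth_poly :: "nat \<Rightarrow> (nat \<Rightarrow> nat) \<Rightarrow> (nat \<Rightarrow> 'r::comm_ring_1) \<Rightarrow> 'r" where
  "groth_poly n \<mu> x = (\<Sum>T\<in>svt n \<mu>. \<Prod>c\<in>diagram \<mu>. cell_weight x (T c))"

lemma finite_svt: "\<mu> \<in> shapes k \<Longrightarrow> finite (svt n \<mu>)"
  by (rule finite_subset[of _ "diagram \<mu> \<rightarrow>\<^sub>E Pow {1..n}"])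
     (auto simp: svt_def finite_PiE finite_diagram)

lemma svt_entry:
  assumes "T \<in> svt n \<mu>" "(i, j) \<in> diagram \<mu>"
  shows "T (i, j) \<subseteq> {1..n}" "T (i, j) \<noteq> {}"
  using assms by (auto simp: svt_def PiE_iff)

lemma svt_row:
  "T \<in> svt n \<mu> \<Longrightarrow> (i, Suc j) \<in> diagram \<mu> \<Longrightarrow> a \<in> T (i, j) \<Longrightarrow> b \<in> T (i, Suc j) \<Longrightarrow> a \<le> b"
  by (auto simp: svt_def)

lemma svt_col:
  "T \<in> svt n \<mu> \<Longrightarrow> (Suc i, j) \<in> diagram \<mu> \<Longrightarrow> a \<in> T (i, j) \<Longrightarrow> b \<in> T (Suc i, j) \<Longrightarrow> a < b"
  by (auto simp: svt_def)

lemma svt_row_less: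
  assumes T: "T \<in> svt n \<mu>" and \<mu>: "\<mu> \<in> shapes k"
  shows "(i, j) \<in> diagram \<mu> \<Longrightarrow> a \<in> T (i, j) \<Longrightarrow> i < a"
proof (induction i arbitrary: a)
  case 0
  then show ?case using svt_entry[OF T, of 0 j] by auto
next
  case (Suc i)
  then have "(i, j) \<in> diagram \<mu>"
    using shapes_antimono[OF \<mu>, of i "Suc i"] by (simp add: diagram_def)
  then obtain b where b: "b \<in> T (i, j)" using svt_entry(2)[OF T] by blast
  then have "i < b" using Suc.IH \<open>(i, j) \<in> diagram \<mu>\<close> by blast
  moreover have "b < a" using svt_col[OF T Suc.prems(1) b Suc.prems(2)] .
  ultimately show ?case by simp
qed

text \<open>
  A set-valued tableau with entries up to \<open>Suc n\<close> is determined by the shape \<open>\<nu>\<close> of the cells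
  with a label other than \<open>{Suc n}\<close>, the set \<open>S\<close> of rows of \<open>\<nu>\<close> whose last cell contains
  \<open>Suc n\<close>, and the tableau of shape \<open>\<nu>\<close> left after deleting all entries \<open>Suc n\<close>.
\<close>

definition insert_top :: "nat \<Rightarrow> (nat \<Rightarrow> nat) \<Rightarrow> (nat \<Rightarrow> nat) \<times> nat set \<times> (nat \<times> nat \<Rightarrow> nat set)
    \<Rightarrow> (nat \<times> nat \<Rightarrow> nat set)" where
  "insert_top n \<mu> = (\<lambda>(\<nu>, S, T). \<lambda>(i, j)\<in>diagram \<mu>.
    if j < \<nu> i then (if i \<in> S \<and> Suc j = \<nu> i then insert (Suc n) (T (i, j)) else T (i, j))
    else {Suc n})"

text \<open>Column \<mu> \<open>i\<close> satisfies the implication vacuously, so the least column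
  exists and lies in the row or just past its end.\<close>

definition top_shape :: "nat \<Rightarrow> (nat \<Rightarrow> nat) \<Rightarrow> (nat \<times> nat \<Rightarrow> nat set) \<Rightarrow> nat \<Rightarrow> nat" where
  "top_shape n \<mu> T i = (LEAST j. j < \<mu> i \<longrightarrow> T (i, j) = {Suc n})"

definition remove_top :: "nat \<Rightarrow> (nat \<Rightarrow> nat) \<Rightarrow> (nat \<times> nat \<Rightarrow> nat set)
    \<Rightarrow> (nat \<Rightarrow> nat) \<times> nat set \<times> (nat \<times> nat \<Rightarrow> nat set)" where
  "remove_top n \<mu> T = (let \<nu> = top_shape n \<mu> T in
    (\<nu>, {i. 0 < \<nu> i \<and> Suc n \<in> T (i, \<nu> i - 1)}, \<lambda>c\<in>diagram \<nu>. T c - {Suc n}))"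

text \<open>The shapes of \<open>interlacing\<close>, but zero instead of \<open>undefined\<close>
  from row \<open>n\<close> on, so that they belong to \<open>shapes n\<close>.\<close>

definition subshapes :: "nat \<Rightarrow> (nat \<Rightarrow> nat) \<Rightarrow> (nat \<Rightarrow> nat) set" where
  "subshapes n \<mu> = {\<nu>. (\<forall>i<n. \<mu> (Suc i) \<le> \<nu> i \<and> \<nu> i \<le> \<mu> i) \<and> (\<forall>i\<ge>n. \<nu> i = 0)}"

lemma subshapes_shapes:
  assumes "\<nu> \<in> subshapes n \<mu>"
  shows "\<nu> \<in> shapes n"
proof -
  have "\<nu> (Suc i) \<le> \<nu> i" for i
  proof (cases "Suc i < n")
    case True
    then have "\<nu> (Suc i) \<le> \<mu> (Suc i)" "\<mu> (Suc i) \<le> \<nu> i"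
      using assms by (auto simp: subshapes_def)
    then show ?thesis by simp
  qed (use assms in \<open>simp add: subshapes_def\<close>)
  then show ?thesis using assms by (simp add: subshapes_def shapes_def)
qed

lemma subshapes_le: "\<nu> \<in> subshapes n \<mu> \<Longrightarrow> \<nu> i \<le> \<mu> i"
  by (cases "i < n") (auto simp: subshapes_def)

lemma subshapes_ge: "\<nu> \<in> subshapes n \<mu> \<Longrightarrow> \<mu> \<in> shapes (Suc n) \<Longrightarrow> \<mu> (Suc i) \<le> \<nu> i"
  using shapes_eq_0[of \<mu> "Suc n" "Suc i"] by (cases "i < n") (auto simp: subshapes_def)

text \<open>Rows of \<nu> whose last cell has no cell of \<mu> below it. Columns increase strictly,
  so only such a cell can contain the largest entry.\<close>

definition marks :: "nat \<Rightarrow> (nat \<Rightarrow> nat) \<Rightarrow> (nat \<Rightarrow> nat) \<Rightarrow> nat set" where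
  "marks n \<mu> \<nu> = {i\<in>{..<n}. \<mu> (Suc i) < \<nu> i}"

context
  fixes n :: nat and \<mu> :: "nat \<Rightarrow> nat"
  assumes \<mu>: "\<mu> \<in> shapes (Suc n)"
begin

text \<open>Entries increase weakly along a row and \<open>Suc n\<close> is the largest one, so the
  cells labelled \<open>{Suc n}\<close> form a final segment of the row.\<close>

lemma top_shape_iff:
  assumes T: "T \<in> svt (Suc n) \<mu>"
  shows "top_shape n \<mu> T i \<le> \<mu> i"
    and "j < \<mu> i \<Longrightarrow> T (i, j) = {Suc n} \<longleftrightarrow> top_shape n \<mu> T i \<le> j"
proof -
  let ?Q = "\<lambda>j. j < \<mu> i \<longrightarrow> T (i, j) = {Suc n}"
  show "top_shape n \<mu> T i \<le> \<mu> i" unfolding top_shape_def by (rule Least_le) simp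
  have Q: "?Q (top_shape n \<mu> T i)" unfolding top_shape_def by (rule LeastI[of ?Q "\<mu> i"]) simp
  have step: "?Q (Suc j)" if "?Q j" for j
  proof
    assume j: "Suc j < \<mu> i"
    then have d: "(i, Suc j) \<in> diagram \<mu>" by (simp add: diagram_def)
    have "Suc n \<in> T (i, j)" using that j by simp
    then have "b = Suc n" if "b \<in> T (i, Suc j)" for b
      using svt_row[OF T d _ that] svt_entry(1)[OF T d] that by fastforce
    then show "T (i, Suc j) = {Suc n}" using svt_entry(2)[OF T d] by auto
  qed
  have "?Q j" if "top_shape n \<mu> T i \<le> j" for j
    using that by (induction rule: dec_induct) (use Q step in auto)
  moreover have "\<not> ?Q j" if "j < top_shape n \<mu> T i" for j
    using that unfolding top_shape_def by (rule not_less_Least)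
  ultimately show "j < \<mu> i \<Longrightarrow> T (i, j) = {Suc n} \<longleftrightarrow> top_shape n \<mu> T i \<le> j"
    by (meson not_le)
qed

lemma top_notin:
  assumes T: "T \<in> svt (Suc n) \<mu>" and "(Suc i, j) \<in> diagram \<mu>"
  shows "Suc n \<notin> T (i, j)"
proof
  assume "Suc n \<in> T (i, j)"
  moreover obtain b where b: "b \<in> T (Suc i, j)" using svt_entry(2)[OF assms] by blast
  ultimately have "Suc n < b" using svt_col[OF assms] by blast
  then show False using svt_entry(1)[OF assms] b by auto
qed

text \<open>A cell labelled \<open>{Suc n}\<close> has no cell below it, which bounds the shape from
  below. Entries in row \<open>n\<close> and beyond exceed \<open>n\<close>, so these rows consist
  of such cells only.\<close>

lemma top_shape_subshapes:
  assumes T: "T \<in> svt (Suc n) \<mu>"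
  shows "top_shape n \<mu> T \<in> subshapes n \<mu>"
proof -
  have "\<mu> (Suc i) \<le> top_shape n \<mu> T i" for i
  proof (rule ccontr)
    assume "\<not> ?thesis"
    then have less: "top_shape n \<mu> T i < \<mu> (Suc i)" by simp
    then have "T (i, top_shape n \<mu> T i) = {Suc n}"
      using top_shape_iff(2)[OF T, of "top_shape n \<mu> T i" i] shapes_antimono[OF \<mu>, of i "Suc i"] by simp
    then show False using top_notin[OF T, of i "top_shape n \<mu> T i"] less by (simp add: diagram_def)
  qed
  moreover have "top_shape n \<mu> T i = 0" if "n \<le> i" for i
  proof (cases "0 < \<mu> i")
    case True
    then have "(i, 0) \<in> diagram \<mu>" by (simp add: diagram_def)
    then have "T (i, 0) \<noteq> {}" "\<And>a. a \<in> T (i, 0) \<Longrightarrow> a = Suc n"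
      using svt_entry[OF T, of i 0] svt_row_less[OF T \<mu>, of i 0] that by (blast, fastforce)
    then have "T (i, 0) = {Suc n}" by auto
    then show ?thesis using top_shape_iff(2)[OF T True] by simp
  next
    case False
    then show ?thesis using top_shape_iff(1)[OF T, of i] by simp
  qed
  ultimately show ?thesis using top_shape_iff(1)[OF T] by (simp add: subshapes_def)
qed

text \<open>Otherwise the cell to the right would be labelled \<open>{Suc n}\<close>, or a cell
  below would need a larger entry.\<close>

lemma top_mem:
  assumes T: "T \<in> svt (Suc n) \<mu>" and "j < top_shape n \<mu> T i" "Suc n \<in> T (i, j)"
  shows "Suc j = top_shape n \<mu> T i" "\<mu> (Suc i) \<le> j"
proof -
  have j: "j < \<mu> i" using assms(2) top_shape_iff(1)[OF T, of i] by simp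
  show "\<mu> (Suc i) \<le> j"
    using top_notin[OF T, of i j] assms(3) by (force simp: diagram_def)
  show "Suc j = top_shape n \<mu> T i"
  proof (rule ccontr)
    assume "\<not> ?thesis"
    then have less: "Suc j < top_shape n \<mu> T i" using assms(2) by simp
    then have less': "Suc j < \<mu> i" using top_shape_iff(1)[OF T, of i] by simp
    then have d: "(i, Suc j) \<in> diagram \<mu>" by (simp add: diagram_def)
    have "b = Suc n" if "b \<in> T (i, Suc j)" for b
      using svt_row[OF T d assms(3) that] svt_entry(1)[OF T d] that by fastforce
    then have "T (i, Suc j) = {Suc n}" using svt_entry(2)[OF T d] by auto
    then show False using top_shape_iff(2)[OF T less'] less by simp
  qed
qed

lemma remove_top_mem:
  assumes T: "T \<in> svt (Suc n) \<mu>"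
  shows "remove_top n \<mu> T \<in> (SIGMA \<nu>:subshapes n \<mu>. Pow (marks n \<mu> \<nu>) \<times> svt n \<nu>)"
proof -
  let ?\<nu> = "top_shape n \<mu> T"
  note sub = top_shape_subshapes[OF T]
  have in_\<mu>: "c \<in> diagram \<mu>" if "c \<in> diagram ?\<nu>" for c
    using that top_shape_iff(1)[OF T, of "fst c"] by (auto simp: diagram_def)
  have nonempty: "T (i, j) - {Suc n} \<noteq> {}" if "(i, j) \<in> diagram ?\<nu>" for i j
    using top_shape_iff(2)[OF T, of j i] svt_entry(2)[OF T in_\<mu>[OF that]] that in_\<mu>[OF that]
    by (auto simp: diagram_def)
  have subset: "T (i, j) - {Suc n} \<subseteq> {1..n}" if "(i, j) \<in> diagram ?\<nu>" for i j
    using svt_entry(1)[OF T in_\<mu>[OF that]] by force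
  have left: "(i, j) \<in> diagram ?\<nu>" if "(i, Suc j) \<in> diagram ?\<nu>" for i j
    using that by (simp add: diagram_def)
  have up: "(i, j) \<in> diagram ?\<nu>" if "(Suc i, j) \<in> diagram ?\<nu>" for i j
    using that shapes_antimono[OF subshapes_shapes[OF sub], of i "Suc i"] by (simp add: diagram_def)
  have "(\<lambda>c\<in>diagram ?\<nu>. T c - {Suc n}) \<in> svt n ?\<nu>"
    unfolding svt_def
  proof (intro CollectI conjI allI impI ballI)
    show "(\<lambda>c\<in>diagram ?\<nu>. T c - {Suc n}) \<in> diagram ?\<nu> \<rightarrow>\<^sub>E Pow {1..n} - {{}}"
    proof (intro restrict_PiE_iff[THEN iffD2] ballI)
      fix c assume "c \<in> diagram ?\<nu>"
      then show "T c - {Suc n} \<in> Pow {1..n} - {{}}"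
        using nonempty[of "fst c" "snd c"] subset[of "fst c" "snd c"] by simp
    qed
  next
    fix i j a b assume *: "(i, Suc j) \<in> diagram ?\<nu>" "a \<in> (\<lambda>c\<in>diagram ?\<nu>. T c - {Suc n}) (i, j)"
      "b \<in> (\<lambda>c\<in>diagram ?\<nu>. T c - {Suc n}) (i, Suc j)"
    show "a \<le> b" using * left[OF *(1)] by (intro svt_row[OF T in_\<mu>[OF *(1)]]) simp_all
  next
    fix i j a b assume *: "(Suc i, j) \<in> diagram ?\<nu>" "a \<in> (\<lambda>c\<in>diagram ?\<nu>. T c - {Suc n}) (i, j)"
      "b \<in> (\<lambda>c\<in>diagram ?\<nu>. T c - {Suc n}) (Suc i, j)"
    show "a < b" using * up[OF *(1)] by (intro svt_col[OF T in_\<mu>[OF *(1)]]) simp_all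
  qed
  moreover have "{i. 0 < ?\<nu> i \<and> Suc n \<in> T (i, ?\<nu> i - 1)} \<subseteq> marks n \<mu> ?\<nu>"
  proof clarify
    fix i assume "0 < ?\<nu> i" "Suc n \<in> T (i, ?\<nu> i - 1)"
    moreover have "i < n" using \<open>0 < ?\<nu> i\<close> sub by (cases "i < n") (auto simp: subshapes_def)
    ultimately show "i \<in> marks n \<mu> ?\<nu>"
      using top_mem(2)[OF T, of "?\<nu> i - 1" i] by (simp add: marks_def)
  qed
  ultimately show ?thesis using sub by (simp add: remove_top_def Let_def)
qed

lemma insert_remove_top:
  assumes T: "T \<in> svt (Suc n) \<mu>"
  shows "insert_top n \<mu> (remove_top n \<mu> T) = T"
proof
  fix c :: "nat \<times> nat"
  obtain i j where c: "c = (i, j)" by fastforce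
  show "insert_top n \<mu> (remove_top n \<mu> T) c = T c"
  proof (cases "c \<in> diagram \<mu>")
    case False
    moreover have "T c = undefined" using T False by (auto simp: svt_def intro: PiE_arb)
    ultimately show ?thesis by (simp add: insert_top_def remove_top_def Let_def)
  next
    case True
    then have j: "j < \<mu> i" by (simp add: c diagram_def)
    let ?\<nu> = "top_shape n \<mu> T"
    have eq: "insert_top n \<mu> (remove_top n \<mu> T) c = (if j < ?\<nu> i then
        (if Suc n \<in> T (i, ?\<nu> i - 1) \<and> Suc j = ?\<nu> i then insert (Suc n) (T (i, j) - {Suc n})
          else T (i, j) - {Suc n}) else {Suc n})"
      using True by (auto simp: insert_top_def remove_top_def Let_def c diagram_def)
    show ?thesis
    proof (cases "j < ?\<nu> i")
      case True
      show ?thesis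
      proof (cases "Suc n \<in> T (i, j)")
        case mem: True
        then have "j = ?\<nu> i - 1" "Suc j = ?\<nu> i" using top_mem(1)[OF T True mem] by simp_all
        then show ?thesis using mem True unfolding eq by (simp add: c insert_absorb)
      next
        case False
        then have "\<not> (Suc n \<in> T (i, ?\<nu> i - 1) \<and> Suc j = ?\<nu> i)" by (metis diff_Suc_1)
        then show ?thesis using False True unfolding eq by (auto simp: c)
      qed
    next
      case False
      then show ?thesis using top_shape_iff(2)[OF T j] unfolding eq by (simp add: c)
    qed
  qed
qed

lemma insert_top_mem:
  assumes \<nu>: "\<nu> \<in> subshapes n \<mu>" and S: "S \<subseteq> marks n \<mu> \<nu>" and T: "T \<in> svt n \<nu>"
  shows "insert_top n \<mu> (\<nu>, S, T) \<in> svt (Suc n) \<mu>"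
proof -
  define U where "U = insert_top n \<mu> (\<nu>, S, T)"
  have U: "U (i, j) = (if j < \<nu> i then (if i \<in> S \<and> Suc j = \<nu> i then insert (Suc n) (T (i, j)) else T (i, j))
    else {Suc n})" if "j < \<mu> i" for i j
    using that by (simp add: U_def insert_top_def diagram_def)
  have T_le: "T (i, j) \<subseteq> {1..n}" "T (i, j) \<noteq> {}" if "j < \<nu> i" for i j
    using svt_entry[OF T, of i j] that by (simp_all add: diagram_def)
  have U_bounds: "1 \<le> a \<and> a \<le> Suc n" if "j < \<mu> i" "a \<in> U (i, j)" for i j a
  proof (cases "j < \<nu> i")
    case True
    then have "a = Suc n \<or> a \<in> T (i, j)" using that by (auto simp: U split: if_splits)
    then show ?thesis using T_le(1)[OF True] by auto
  qed (use that in \<open>simp add: U\<close>)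
  have "U \<in> diagram \<mu> \<rightarrow>\<^sub>E Pow {1..Suc n} - {{}}"
  proof (rule PiE_I)
    fix c assume "c \<in> diagram \<mu>"
    then obtain i j where c: "c = (i, j)" "j < \<mu> i" by (auto simp: diagram_def)
    show "U c \<in> Pow {1..Suc n} - {{}}"
      using U_bounds[OF c(2)] T_le(2)[of j i] by (auto simp: c U)
  qed (simp add: U_def insert_top_def)
  moreover have "a \<le> b" if "(i, Suc j) \<in> diagram \<mu>" "a \<in> U (i, j)" "b \<in> U (i, Suc j)" for i j a b
  proof (cases "Suc j < \<nu> i")
    case True
    have less: "Suc j < \<mu> i" "j < \<mu> i" using that(1) by (auto simp: diagram_def)
    then have "a \<in> T (i, j)" using that(2) True by (simp add: U)
    moreover have "b = Suc n \<or> b \<in> T (i, Suc j)" using that(3) True less by (auto simp: U split: if_splits)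
    ultimately show ?thesis
      using svt_row[OF T, of i j a b] T_le[of j i] True by (auto simp: diagram_def)
  next
    case False
    then have "b = Suc n" using that by (simp add: U diagram_def)
    then show ?thesis using U_bounds[of j i a] that by (simp add: diagram_def)
  qed
  moreover have "a < b" if "(Suc i, j) \<in> diagram \<mu>" "a \<in> U (i, j)" "b \<in> U (Suc i, j)" for i j a b
  proof -
    have less: "j < \<mu> (Suc i)" "j < \<mu> i" "j < \<nu> i"
      using that(1) shapes_antimono[OF \<mu>, of i "Suc i"] subshapes_ge[OF \<nu> \<mu>, of i]
      by (auto simp: diagram_def)
    have "\<not> (i \<in> S \<and> Suc j = \<nu> i)"
      using less S by (auto simp: marks_def)
    then have a: "a \<in> T (i, j)" using that(2) less by (auto simp: U)
    then have "a \<le> n" using T_le(1)[OF less(3)] by auto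
    have "b = Suc n \<or> j < \<nu> (Suc i) \<and> b \<in> T (Suc i, j)"
      using that(3) less by (auto simp: U split: if_splits)
    then show ?thesis
      using \<open>a \<le> n\<close> svt_col[OF T, of i j a b] a by (auto simp: diagram_def)
  qed
  ultimately show ?thesis
    unfolding U_def[symmetric] svt_def by (intro CollectI conjI allI impI ballI) assumption+
qed

lemma remove_insert_top:
  assumes \<nu>: "\<nu> \<in> subshapes n \<mu>" and S: "S \<subseteq> marks n \<mu> \<nu>" and T: "T \<in> svt n \<nu>"
  shows "remove_top n \<mu> (insert_top n \<mu> (\<nu>, S, T)) = (\<nu>, S, T)"
proof -
  define U where "U = insert_top n \<mu> (\<nu>, S, T)"
  have U: "U (i, j) = (if j < \<nu> i then (if i \<in> S \<and> Suc j = \<nu> i then insert (Suc n) (T (i, j)) else T (i, j))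
    else {Suc n})" if "j < \<mu> i" for i j
    using that by (simp add: U_def insert_top_def diagram_def)
  have T_le: "T (i, j) \<subseteq> {1..n}" "T (i, j) \<noteq> {}" if "j < \<nu> i" for i j
    using svt_entry[OF T, of i j] that by (simp_all add: diagram_def)
  have Usvt: "U \<in> svt (Suc n) \<mu>" unfolding U_def by (rule insert_top_mem[OF assms])
  have "U (i, j) = {Suc n} \<longleftrightarrow> \<nu> i \<le> j" if "j < \<mu> i" for i j
  proof (cases "j < \<nu> i")
    case True
    then obtain a where "a \<in> T (i, j)" "a \<le> n" using T_le[of j i] by fastforce
    moreover from this have "a \<in> U (i, j)" using True that by (simp add: U)
    ultimately have "U (i, j) \<noteq> {Suc n}" by (metis not_less_eq_eq order_refl singletonD)
    then show ?thesis using True by simp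
  next
    case False
    then have "U (i, j) = {Suc n}" by (simp add: U[OF that])
    then show ?thesis using False by simp
  qed
  then have iff: "top_shape n \<mu> U i \<le> j \<longleftrightarrow> \<nu> i \<le> j" if "j < \<mu> i" for i j
    using top_shape_iff(2)[OF Usvt that] that by blast
  have top: "top_shape n \<mu> U i = \<nu> i" for i
    using iff[of "\<nu> i" i] iff[of "top_shape n \<mu> U i" i] top_shape_iff(1)[OF Usvt, of i] subshapes_le[OF \<nu>, of i]
    by linarith
  have "{i. 0 < \<nu> i \<and> Suc n \<in> U (i, \<nu> i - 1)} = S"
  proof -
    have "Suc n \<in> U (i, \<nu> i - 1) \<longleftrightarrow> i \<in> S" if "0 < \<nu> i" for i
    proof -
      have "\<nu> i - 1 < \<mu> i" using that subshapes_le[OF \<nu>, of i] by linarith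
      moreover have "Suc n \<notin> T (i, \<nu> i - 1)" using T_le(1)[of "\<nu> i - 1" i] that by auto
      ultimately show ?thesis using that by (simp add: U)
    qed
    moreover have "0 < \<nu> i" if "i \<in> S" for i using that S by (auto simp: marks_def)
    ultimately show ?thesis by blast
  qed
  moreover have "(\<lambda>c\<in>diagram \<nu>. U c - {Suc n}) = T"
  proof
    fix c :: "nat \<times> nat"
    obtain i j where c: "c = (i, j)" by fastforce
    show "(\<lambda>c\<in>diagram \<nu>. U c - {Suc n}) c = T c"
    proof (cases "j < \<nu> i")
      case True
      then show ?thesis
        using U[of j i] T_le(1)[OF True] subshapes_le[OF \<nu>, of i] by (auto simp: c diagram_def)
    next
      case False
      then show ?thesis using T by (auto simp: c diagram_def svt_def PiE_iff extensional_def)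
    qed
  qed
  moreover have "top_shape n \<mu> U = \<nu>" using top by blast
  ultimately show ?thesis by (simp add: remove_top_def Let_def flip: U_def)
qed

text \<open>With \<open>t = x (Suc n)\<close>, a cell \<open>{Suc n}\<close> has weight
  \<open>t\<close>, and adding \<open>Suc n\<close> to a label multiplies its weight by
  \<open>- t\<close>.\<close>

lemma insert_top_weight:
  fixes x :: "nat \<Rightarrow> 'r::comm_ring_1"
  assumes \<nu>: "\<nu> \<in> subshapes n \<mu>" and S: "S \<subseteq> marks n \<mu> \<nu>" and T: "T \<in> svt n \<nu>"
  shows "(\<Prod>c\<in>diagram \<mu>. cell_weight x (insert_top n \<mu> (\<nu>, S, T) c)) =
    x (Suc n) ^ \<mu> n * (\<Prod>i<n. x (Suc n) ^ (\<mu> i - \<nu> i)) *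
    (\<Prod>i\<in>S. - x (Suc n)) * (\<Prod>c\<in>diagram \<nu>. cell_weight x (T c))"
proof -
  define t where "t = x (Suc n)"
  define U where "U = insert_top n \<mu> (\<nu>, S, T)"
  define C where "C = (\<lambda>i. (i, \<nu> i - 1)) ` S"
  have U: "U (i, j) = (if j < \<nu> i then (if i \<in> S \<and> Suc j = \<nu> i then insert (Suc n) (T (i, j)) else T (i, j))
    else {Suc n})" if "j < \<mu> i" for i j
    using that by (simp add: U_def insert_top_def diagram_def)
  have S_pos: "0 < \<nu> i" "i < n" if "i \<in> S" for i using that S by (auto simp: marks_def)
  have fin: "finite (diagram \<mu>)" "finite (diagram \<nu>)" "finite S"
    using finite_diagram[OF \<mu>] finite_diagram[OF subshapes_shapes[OF \<nu>]] S
    by (auto simp: marks_def intro: finite_subset)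
  have sub: "diagram \<nu> \<subseteq> diagram \<mu>"
    using subshapes_le[OF \<nu>] by (auto simp: diagram_def intro: less_le_trans)
  have CI: "(i, j) \<in> C \<longleftrightarrow> i \<in> S \<and> Suc j = \<nu> i" for i j
    using S_pos by (auto simp: C_def)
  have C_sub: "C \<subseteq> diagram \<nu>" using CI by (auto simp: diagram_def)
  have diff: "diagram \<mu> - diagram \<nu> = (SIGMA i:{..<Suc n}. {\<nu> i..<\<mu> i})"
    using shapes_eq_0[OF \<mu>] by (force simp: diagram_def not_less not_le)
  have "(\<Prod>c\<in>diagram \<mu> - diagram \<nu>. cell_weight x (U c)) = (\<Prod>c\<in>diagram \<mu> - diagram \<nu>. t)"
    by (intro prod.cong refl) (auto simp: diagram_def U cell_weight_def t_def)
  also have "\<dots> = (\<Prod>i<Suc n. t ^ (\<mu> i - \<nu> i))"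
    unfolding diff prod_constant by (subst card_SigmaI) (simp_all add: power_sum del: sum.lessThan_Suc prod.lessThan_Suc)
  also have "\<dots> = t ^ \<mu> n * (\<Prod>i<n. t ^ (\<mu> i - \<nu> i))"
    using \<nu> by (simp add: subshapes_def mult.commute)
  finally have outer: "(\<Prod>c\<in>diagram \<mu> - diagram \<nu>. cell_weight x (U c)) = t ^ \<mu> n * (\<Prod>i<n. t ^ (\<mu> i - \<nu> i))" .
  have cell: "cell_weight x (U c) = (if c \<in> C then - t else 1) * cell_weight x (T c)"
    if c: "c \<in> diagram \<nu>" for c
  proof -
    obtain i j where ij: "c = (i, j)" "j < \<nu> i" using c by (auto simp: diagram_def)
    then have "T (i, j) \<subseteq> {1..n}" using svt_entry(1)[OF T, of i j] c by simp
    then have "finite (T (i, j))" "Suc n \<notin> T (i, j)" by (auto intro: finite_subset)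
    then show ?thesis
      using ij subshapes_le[OF \<nu>, of i] by (simp add: U CI cell_weight_def t_def)
  qed
  have "(\<Prod>c\<in>diagram \<nu>. cell_weight x (U c)) =
      (\<Prod>c\<in>diagram \<nu>. if c \<in> C then - t else 1) * (\<Prod>c\<in>diagram \<nu>. cell_weight x (T c))"
    by (simp add: cell prod.distrib cong: prod.cong)
  also have "(\<Prod>c\<in>diagram \<nu>. if c \<in> C then - t else 1) = (\<Prod>c\<in>C. - t)"
    using fin C_sub by (simp add: prod.If_cases Int_absorb1)
  also have "\<dots> = (\<Prod>i\<in>S. - t)"
    unfolding C_def by (subst prod.reindex) (auto simp: inj_on_def)
  finally have inner: "(\<Prod>c\<in>diagram \<nu>. cell_weight x (U c)) =
      (\<Prod>i\<in>S. - t) * (\<Prod>c\<in>diagram \<nu>. cell_weight x (T c))" .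
  show ?thesis
    using prod.subset_diff[OF sub fin(1), of "\<lambda>c. cell_weight x (U c)"] outer inner
    by (simp add: U_def t_def mult_ac)
qed

end

lemma prod_one_minus:
  fixes f :: "'b \<Rightarrow> 'r::comm_ring_1"
  assumes "finite A"
  shows "(\<Prod>i\<in>A. 1 - f i) = (\<Sum>S\<in>Pow A. \<Prod>i\<in>S. - f i)"
  using assms
proof induction
  case (insert a A)
  have "(\<Sum>S\<in>Pow (insert a A). \<Prod>i\<in>S. - f i) =
      (\<Sum>S\<in>Pow A. \<Prod>i\<in>S. - f i) + (\<Sum>S\<in>insert a ` Pow A. \<Prod>i\<in>S. - f i)"
    using insert by (simp add: Pow_insert) (subst sum.union_disjoint, auto)
  also have "(\<Sum>S\<in>insert a ` Pow A. \<Prod>i\<in>S. - f i) = (\<Sum>S\<in>Pow A. \<Prod>i\<in>insert a S. - f i)"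
    using insert.hyps by (subst sum.reindex) (auto simp: inj_on_def)
  also have "\<dots> = (\<Sum>S\<in>Pow A. - f a * (\<Prod>i\<in>S. - f i))"
    using insert.hyps by (intro sum.cong refl prod.insert) (auto intro: finite_subset)
  also have "\<dots> = - f a * (\<Sum>S\<in>Pow A. \<Prod>i\<in>S. - f i)" by (rule sum_distrib_left[symmetric])
  finally show ?case using insert by (simp add: left_diff_distrib)
qed simp

lemma finite_subshapes: "finite (subshapes n \<mu>)"
proof (rule finite_subset)
  show "subshapes n \<mu> \<subseteq> (\<lambda>\<nu> i. if i < n then \<nu> i else 0) ` (\<Pi>\<^sub>E i\<in>{..<n}. {..\<mu> i})"
  proof
    fix \<nu> assume "\<nu> \<in> subshapes n \<mu>"
    then show "\<nu> \<in> (\<lambda>\<nu> i. if i < n then \<nu> i else 0) ` (\<Pi>\<^sub>E i\<in>{..<n}. {..\<mu> i})"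
      by (intro image_eqI[of _ _ "restrict \<nu> {..<n}"]) (auto simp: subshapes_def)
  qed
qed (simp add: finite_PiE)

text \<open>Summing the signed choices \<open>S\<close> of marked rows gives one factor
  \<open>1 - x (Suc n)\<close> per row in \<open>marks n \<mu> \<nu>\<close>, which is
  \<open>strip_weight\<close> at \<open>\<beta> = 1\<close>.\<close>

lemma groth_poly_rec:
  fixes x :: "nat \<Rightarrow> 'r::comm_ring_1"
  assumes \<mu>: "\<mu> \<in> shapes (Suc n)"
  shows "groth_poly (Suc n) \<mu> x =
    (\<Sum>\<nu>\<in>subshapes n \<mu>. strip_weight 1 n \<mu> (x (Suc n)) \<nu> * groth_poly n \<nu> x)"
proof -
  let ?t = "x (Suc n)"
  let ?w = "\<lambda>\<nu> S T. ?t ^ \<mu> n * (\<Prod>i<n. ?t ^ (\<mu> i - \<nu> i)) *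
      (\<Prod>i\<in>S. - ?t) * (\<Prod>c\<in>diagram \<nu>. cell_weight x (T c))"
  have fin: "finite (marks n \<mu> \<nu>)" for \<nu> by (simp add: marks_def)
  have "groth_poly (Suc n) \<mu> x = (\<Sum>(\<nu>, S, T)\<in>(SIGMA \<nu>:subshapes n \<mu>. Pow (marks n \<mu> \<nu>) \<times> svt n \<nu>). ?w \<nu> S T)"
    unfolding groth_poly_def
    by (rule sum.reindex_bij_witness[symmetric, where i = "remove_top n \<mu>" and j = "insert_top n \<mu>"])
       (use remove_top_mem[OF \<mu>] in \<open>auto simp: insert_remove_top[OF \<mu>] remove_insert_top[OF \<mu>] insert_top_mem[OF \<mu>]
          insert_top_weight[OF \<mu>]\<close>)
  also have "\<dots> = (\<Sum>\<nu>\<in>subshapes n \<mu>. \<Sum>S\<in>Pow (marks n \<mu> \<nu>). \<Sum>T\<in>svt n \<nu>. ?w \<nu> S T)"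
    using finite_subshapes fin finite_svt[OF subshapes_shapes]
    by (subst sum.Sigma[symmetric]) (auto simp: sum.cartesian_product)
  also have "\<dots> = (\<Sum>\<nu>\<in>subshapes n \<mu>. strip_weight 1 n \<mu> ?t \<nu> * groth_poly n \<nu> x)"
  proof (intro sum.cong refl)
    fix \<nu> assume "\<nu> \<in> subshapes n \<mu>"
    have "(\<Prod>i<n. if \<mu> (Suc i) < \<nu> i then 1 - 1 * ?t else 1) = (\<Prod>i\<in>marks n \<mu> \<nu>. 1 - ?t)"
      unfolding marks_def by (subst prod.inter_filter) (simp_all cong: if_cong)
    also have "\<dots> = (\<Sum>S\<in>Pow (marks n \<mu> \<nu>). \<Prod>i\<in>S. - ?t)"
      by (rule prod_one_minus[OF fin])
    finally show "(\<Sum>S\<in>Pow (marks n \<mu> \<nu>). \<Sum>T\<in>svt n \<nu>. ?w \<nu> S T) =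
        strip_weight 1 n \<mu> ?t \<nu> * groth_poly n \<nu> x"
      by (simp only: strip_weight_def groth_poly_def prod.distrib)
         (simp only: sum_distrib_left sum_distrib_right mult_ac)
  qed
  finally show ?thesis .
qed

text \<open>The product of differences in \<open>groth_det_rec\<close> is what
  \<open>vandermonde\<close> gains with the last variable, so the recursions for tableaux and for
  the determinant match after multiplication.\<close>

theorem vandermonde_groth_poly:
  fixes x :: "nat \<Rightarrow> 'r::idom"
  assumes nz: "\<And>i. 1 - x (Suc i) \<noteq> 0"
  shows "\<mu> \<in> shapes n \<Longrightarrow>
    vandermonde n (\<lambda>i. x (Suc i)) * groth_poly n \<mu> x = groth_det 1 n \<mu> (\<lambda>i. x (Suc i))"
proof (induction n arbitrary: \<mu>)
  case 0
  then have "diagram \<mu> = {}" using shapes_eq_0[of \<mu> 0] by (auto simp: diagram_def)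
  then show ?case by (simp add: groth_poly_def svt_def groth_det_def vandermonde_def)
next
  case (Suc n)
  let ?y = "\<lambda>i. x (Suc i)"
  have dec: "\<mu> (Suc i) \<le> \<mu> i" for i using Suc.prems by (simp add: shapes_def)
  have "(\<Sum>\<nu>\<in>subshapes n \<mu>. strip_weight 1 n \<mu> (x (Suc n)) \<nu> * groth_det 1 n \<nu> ?y) =
      (\<Sum>\<nu>\<in>interlacing n \<mu>. strip_weight 1 n \<mu> (x (Suc n)) \<nu> * groth_det 1 n \<nu> ?y)"
  proof (rule sum.reindex_bij_witness[where j = "\<lambda>\<nu>. restrict \<nu> {..<n}" and i = "\<lambda>\<nu> i. if i < n then \<nu> i else 0"])
    fix \<nu> assume "\<nu> \<in> subshapes n \<mu>"
    show "strip_weight 1 n \<mu> (x (Suc n)) (restrict \<nu> {..<n}) * groth_det 1 n (restrict \<nu> {..<n}) ?y =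
        strip_weight 1 n \<mu> (x (Suc n)) \<nu> * groth_det 1 n \<nu> ?y"
      unfolding strip_weight_def groth_det_def
      by (intro arg_cong2[of _ _ _ _ "(*)"] arg_cong[of _ _ det] cong_mat refl prod.cong) auto
  qed (auto simp: subshapes_def PiE_iff extensional_def)
  moreover have "(\<Sum>\<nu>\<in>subshapes n \<mu>. vandermonde n ?y * (strip_weight 1 n \<mu> (x (Suc n)) \<nu> * groth_poly n \<nu> x)) =
      (\<Sum>\<nu>\<in>subshapes n \<mu>. strip_weight 1 n \<mu> (x (Suc n)) \<nu> * groth_det 1 n \<nu> ?y)"
    by (intro sum.cong refl) (simp add: mult.left_commute flip: Suc.IH[OF subshapes_shapes])
  ultimately have "vandermonde n ?y * groth_poly (Suc n) \<mu> x =
      (\<Sum>\<nu>\<in>interlacing n \<mu>. strip_weight 1 n \<mu> (x (Suc n)) \<nu> * groth_det 1 n \<nu> ?y)"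
    unfolding groth_poly_rec[OF Suc.prems] sum_distrib_left by simp
  moreover have "groth_det 1 (Suc n) \<mu> ?y = (\<Prod>i<n. ?y i - ?y n) *
      (\<Sum>\<nu>\<in>interlacing n \<mu>. strip_weight 1 n \<mu> (x (Suc n)) \<nu> * groth_det 1 n \<nu> ?y)"
    using dec nz by (intro groth_det_rec) auto
  ultimately show ?case by (simp add: vandermonde_def mult_ac)
qed

section \<open>The dual functionals\<close>

text \<open>Their number is the coefficient of \<open>x^z\<close> in \<open>1 / (1 - x)^f\<close>;
  as lists, they become the integers at the end of a row of an array. The length is given as an
  \<open>int\<close> so that a negative exponent yields no tail.\<close>

definition tails :: "nat \<Rightarrow> int \<Rightarrow> nat list set" where
  "tails f z = {xs. sorted xs \<and> set xs \<subseteq> {1..f} \<and> int (length xs) = z}"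

definition num_tails :: "nat \<Rightarrow> int \<Rightarrow> int" where
  "num_tails f z = int (card (tails f z))"

lemma finite_tails: "finite (tails f z)"
  by (rule finite_subset[OF _ finite_lists_length_le[of "{1..f}" "nat z"]]) (auto simp: tails_def)

lemma num_tails_neg: "z < 0 \<Longrightarrow> num_tails f z = 0"
  by (auto simp: num_tails_def tails_def)

lemma num_tails_0_right: "num_tails f 0 = 1"
proof -
  have "tails f 0 = {[]}" by (auto simp: tails_def)
  then show ?thesis by (simp add: num_tails_def)
qed

lemma num_tails_0_left: "num_tails 0 z = (if z = 0 then 1 else 0)"
proof -
  have "tails 0 z = (if z = 0 then {[]} else {})" by (auto simp: tails_def)
  then show ?thesis by (simp add: num_tails_def)
qed

text \<open>If \<open>Suc f\<close> occurs, it is the last entry. In terms of series: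
  \<open>1 / (1 - x)^f = (1 - x) / (1 - x)^(f + 1)\<close>.\<close>

lemma num_tails_Suc: "num_tails (Suc f) z = num_tails f z + num_tails (Suc f) (z - 1)"
proof -
  have sub: "xs \<in> tails f z \<union> (\<lambda>ys. ys @ [Suc f]) ` tails (Suc f) (z - 1)" if xs: "xs \<in> tails (Suc f) z" for xs
  proof (cases "Suc f \<in> set xs")
    case True
    then obtain ys y where ys: "xs = ys @ [y]" by (cases xs rule: rev_cases) auto
    have "y \<le> Suc f" "Suc f \<le> y" using xs True by (auto simp: ys tails_def sorted_append)
    then have "y = Suc f" by simp
    then show ?thesis using xs by (auto simp: ys tails_def sorted_append)
  next
    case False
    have "x \<le> f" if "x \<in> set xs" for x
    proof -
      have "x \<le> Suc f" "x \<noteq> Suc f" using xs that False by (auto simp: tails_def)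
      then show ?thesis by simp
    qed
    then show ?thesis using xs by (auto simp: tails_def)
  qed
  have "tails f z \<subseteq> tails (Suc f) z"
    unfolding tails_def by fastforce
  moreover have "(\<lambda>ys. ys @ [Suc f]) ` tails (Suc f) (z - 1) \<subseteq> tails (Suc f) z"
    by (force simp: tails_def sorted_append)
  ultimately have "tails (Suc f) z = tails f z \<union> (\<lambda>ys. ys @ [Suc f]) ` tails (Suc f) (z - 1)"
    using sub by blast
  moreover have "tails f z \<inter> (\<lambda>ys. ys @ [Suc f]) ` tails (Suc f) (z - 1) = {}"
  proof -
    have "Suc f \<notin> set xs" if "xs \<in> tails f z" for xs
      using that by (auto simp: tails_def)
    then show ?thesis by fastforce
  qed
  ultimately have "card (tails (Suc f) z) = card (tails f z) + card ((\<lambda>ys. ys @ [Suc f]) ` tails (Suc f) (z - 1))"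
    by (simp add: card_Un_disjoint finite_tails)
  moreover have "card ((\<lambda>ys. ys @ [Suc f]) ` tails (Suc f) (z - 1)) = card (tails (Suc f) (z - 1))"
    by (rule card_image) (auto simp: inj_on_def)
  ultimately show ?thesis by (simp add: num_tails_def)
qed

text \<open>The coefficient of \<open>x\<^sup>z\<close> in \<open>(1 - x)\<^sup>j / (1 - x)\<^sup>f\<close>.\<close>

definition quot_coeff :: "nat \<Rightarrow> nat \<Rightarrow> int \<Rightarrow> int" where
  "quot_coeff j f z = (\<Sum>v\<le>j. (-1) ^ v * int (j choose v) * num_tails f (z - int v))"

lemma quot_coeff_Suc: "quot_coeff (Suc j) f z = quot_coeff j f z - quot_coeff j f (z - 1)"
proof -
  let ?h = "\<lambda>v. num_tails f (z - int v)"
  have "quot_coeff (Suc j) f z = ?h 0 + (\<Sum>v\<le>j. (-1) ^ Suc v * int (Suc j choose Suc v) * ?h (Suc v))"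
    unfolding quot_coeff_def by (subst sum.atMost_Suc_shift) simp
  also have "(\<Sum>v\<le>j. (-1) ^ Suc v * int (Suc j choose Suc v) * ?h (Suc v)) =
      (\<Sum>v\<le>j. (-1) ^ Suc v * int (j choose Suc v) * ?h (Suc v)) - (\<Sum>v\<le>j. (-1) ^ v * int (j choose v) * ?h (Suc v))"
    unfolding sum_subtractf[symmetric] by (intro sum.cong refl) (simp add: algebra_simps)
  also have "(\<Sum>v\<le>j. (-1) ^ v * int (j choose v) * ?h (Suc v)) = quot_coeff j f (z - 1)"
    by (simp add: quot_coeff_def algebra_simps)
  also have "?h 0 + ((\<Sum>v\<le>j. (-1) ^ Suc v * int (j choose Suc v) * ?h (Suc v)) - quot_coeff j f (z - 1)) =
      (\<Sum>v\<le>Suc j. (-1) ^ v * int (j choose v) * ?h v) - quot_coeff j f (z - 1)"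
    by (subst sum.atMost_Suc_shift) simp
  also have "(\<Sum>v\<le>Suc j. (-1) ^ v * int (j choose v) * ?h v) = quot_coeff j f z"
    by (simp add: quot_coeff_def)
  finally show ?thesis .
qed

lemma quot_coeff_Suc_Suc: "quot_coeff (Suc j) (Suc f) z = quot_coeff j f z"
proof -
  have "num_tails (Suc f) (z - int v) - num_tails (Suc f) (z - 1 - int v) = num_tails f (z - int v)" for v
    using num_tails_Suc[of f "z - int v"] by (simp add: algebra_simps)
  then show ?thesis
    unfolding quot_coeff_Suc by (simp add: quot_coeff_def flip: sum_subtractf right_diff_distrib)
qed

lemma quot_coeff_add: "quot_coeff (j + d) (f + d) z = quot_coeff j f z"
  by (induction d) (simp_all add: quot_coeff_Suc_Suc)

lemma quot_coeff_same: "quot_coeff j j z = (if z = 0 then 1 else 0)"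
  using quot_coeff_add[of 0 j 0 z] by (simp add: quot_coeff_def num_tails_0_left)

lemma quot_coeff_neg: "z < 0 \<Longrightarrow> quot_coeff j f z = 0"
  by (simp add: quot_coeff_def num_tails_neg)

text \<open>For \<open>f \<le> j\<close> the quotient is the polynomial
  \<open>(1 - x)^(j - f)\<close>, of degree \<open>j - f\<close>.\<close>

lemma quot_coeff_above:
  assumes "f \<le> j" "int (j - f) < z"
  shows "quot_coeff j f z = 0"
  using quot_coeff_add[of "j - f" f 0 z] assms by (simp add: quot_coeff_def num_tails_0_left)

definition shifted :: "nat \<Rightarrow> (nat \<Rightarrow> nat) \<Rightarrow> nat \<Rightarrow> nat" where
  "shifted n \<mu> i = \<mu> i + (n - Suc i)"

text \<open>
  The coefficient of \<open>x\<^bsup>\<mu> + \<delta>\<^esup>\<close> in the alternant with exponents \<open>e\<close> multiplied by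
  \<open>\<Prod>\<^sub>i (1 - x\<^sub>i)\<^bsup>-i\<^esup>\<close>, where \<open>\<delta> = (n - 1, \<dots>, 0)\<close>.
\<close>

definition dual :: "nat \<Rightarrow> (nat \<Rightarrow> nat) \<Rightarrow> (nat \<Rightarrow> nat) \<Rightarrow> int" where
  "dual n \<mu> e = (\<Sum>p | p permutes {0..<n}. sign p *
    (\<Prod>j<n. num_tails (p j) (int (shifted n \<mu> (p j)) - int (e j))))"

text \<open>The coefficient that arises when the power \<open>k j\<close> is picked out of
  \<open>(1 - x)^j\<close> in every column \<open>j\<close>.\<close>

definition binomial_weight :: "nat \<Rightarrow> (nat \<Rightarrow> nat) \<Rightarrow> int" where
  "binomial_weight n k = (\<Prod>j<n. (-1) ^ k j * int (j choose k j))"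

text \<open>Let \<open>i\<close> be the least point moved by \<open>p\<close>, and
  \<open>p j = i\<close>; then \<open>i < p i\<close> and \<open>i < j\<close>. If
  \<open>\<mu> i \<le> \<nu> j\<close>, the factor at \<open>i\<close> asks for a negative exponent;
  otherwise the factor at \<open>j\<close> asks for an exponent above the degree of
  \<open>(1 - x)^(j - i)\<close>.\<close>

lemma quot_coeff_prod_zero:
  assumes \<mu>: "\<mu> \<in> shapes n" and \<nu>: "\<nu> \<in> shapes n" and p: "p permutes {0..<n}" and "p \<noteq> id"
  shows "(\<Prod>j<n. quot_coeff j (p j) (int (shifted n \<mu> (p j)) - int (shifted n \<nu> j))) = 0"
proof -
  define i where "i = (LEAST i. p i \<noteq> i)"
  have ex: "\<exists>i. p i \<noteq> i" using \<open>p \<noteq> id\<close> by auto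
  have pi: "p i \<noteq> i" unfolding i_def using ex by (rule LeastI_ex)
  have fix_less: "p k = k" if "k < i" for k using that unfolding i_def using not_less_Least by blast
  have in_n: "p k < n \<longleftrightarrow> k < n" for k using permutes_in_image[OF p, of k] by simp
  have "i < n" using pi permutes_not_in[OF p, of i] by (cases "i < n") auto
  have inj: "p k = p l \<Longrightarrow> k = l" for k l using permutes_inj[OF p] by (auto dest: injD)
  have pi_gr: "i < p i"
  proof (rule ccontr)
    assume "\<not> i < p i"
    then have "p i < i" using pi by simp
    then have "p (p i) = p i" by (rule fix_less)
    then show False using inj pi by blast
  qed
  obtain j where j: "p j = i" using permutes_surj[OF p] by (metis surjD)
  have "i < j" using fix_less[of j] j pi by (metis linorder_neqE_nat)
  have "j < n" using in_n[of j] j \<open>i < n\<close> by simp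
  have "p i < n" using in_n \<open>i < n\<close> by simp
  have mono: "\<mu> (p i) \<le> \<mu> i" "\<nu> j \<le> \<nu> i"
    using shapes_antimono[OF \<mu>, of i "p i"] shapes_antimono[OF \<nu>, of i j] pi_gr \<open>i < j\<close> by auto
  show ?thesis
  proof (cases "\<mu> i \<le> \<nu> j")
    case True
    then have "int (shifted n \<mu> (p i)) - int (shifted n \<nu> i) < 0"
      using mono pi_gr \<open>p i < n\<close> by (simp add: shifted_def)
    then have "quot_coeff i (p i) (int (shifted n \<mu> (p i)) - int (shifted n \<nu> i)) = 0"
      by (rule quot_coeff_neg)
    then show ?thesis using \<open>i < n\<close> by (auto intro!: prod_zero)
  next
    case False
    then have "quot_coeff j (p j) (int (shifted n \<mu> (p j)) - int (shifted n \<nu> j)) = 0"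
      using \<open>i < j\<close> \<open>j < n\<close> by (intro quot_coeff_above) (simp_all add: j shifted_def)
    then show ?thesis using \<open>j < n\<close> by (auto intro!: prod_zero)
  qed
qed

text \<open>The left side is the functional at \<mu> applied to \<open>groth_det 1 n \<nu>\<close>.
  The sum over \<open>k\<close> factors into one \<open>quot_coeff\<close> per column; only the
  identity permutation survives, and it tests \<open>\<mu> j = \<nu> j\<close> in each
  column.\<close>

lemma dual_groth_det:
  assumes \<mu>: "\<mu> \<in> shapes n" and \<nu>: "\<nu> \<in> shapes n"
  shows "(\<Sum>k\<in>(\<Pi>\<^sub>E j\<in>{..<n}. {..j}). binomial_weight n k * dual n \<mu> (\<lambda>j. shifted n \<nu> j + k j)) =
    (if \<mu> = \<nu> then 1 else 0)"
proof -
  let ?K = "\<Pi>\<^sub>E j\<in>{..<n}. {..j}"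
  let ?P = "{p. p permutes {0..<n}}"
  let ?z = "\<lambda>p j. int (shifted n \<mu> (p j)) - int (shifted n \<nu> j)"
  have "(\<Sum>k\<in>?K. binomial_weight n k * dual n \<mu> (\<lambda>j. shifted n \<nu> j + k j)) =
      (\<Sum>k\<in>?K. \<Sum>p\<in>?P. sign p *
        (\<Prod>j<n. (-1) ^ k j * int (j choose k j) * num_tails (p j) (?z p j - int (k j))))"
    by (simp add: dual_def binomial_weight_def sum_distrib_left prod.distrib algebra_simps)
  also have "\<dots> = (\<Sum>p\<in>?P. sign p *
      (\<Sum>k\<in>?K. \<Prod>j<n. (-1) ^ k j * int (j choose k j) * num_tails (p j) (?z p j - int (k j))))"
    by (subst sum.swap) (simp add: sum_distrib_left)
  also have "\<dots> = (\<Sum>p\<in>?P. sign p * (\<Prod>j<n. quot_coeff j (p j) (?z p j)))"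
    unfolding quot_coeff_def by (subst prod_sum_PiE) simp_all
  also have "\<dots> = (\<Sum>p\<in>?P. if p = id then \<Prod>j<n. quot_coeff j j (?z id j) else 0)"
    by (intro sum.cong refl) (auto simp: quot_coeff_prod_zero[OF \<mu> \<nu>])
  also have "\<dots> = (\<Prod>j<n. quot_coeff j j (?z id j))"
    by (subst sum.delta) (auto simp: finite_permutations permutes_id)
  also have "\<dots> = (if \<forall>j<n. \<mu> j = \<nu> j then 1 else 0)"
    by (auto simp: quot_coeff_same shifted_def intro!: prod.neutral)
  also have "(\<forall>j<n. \<mu> j = \<nu> j) \<longleftrightarrow> \<mu> = \<nu>"
    using shapes_eq_0[OF \<mu>] shapes_eq_0[OF \<nu>] by (metis ext not_less)
  finally show ?thesis .
qed

section \<open>Alternants as polynomials, and the functionals on alternating polynomials\<close>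

type_synonym mpoly = "nat multiset \<Rightarrow>\<^sub>0 int"

definition Var :: "nat \<Rightarrow> mpoly" where
  "Var i = Poly_Mapping.single {#i#} 1"

abbreviation coeff :: "mpoly \<Rightarrow> nat multiset \<Rightarrow> int" where
  "coeff \<equiv> Poly_Mapping.lookup"

definition monomial :: "nat \<Rightarrow> (nat \<Rightarrow> nat) \<Rightarrow> nat multiset" where
  "monomial n \<beta> = (\<Sum>i<n. replicate_mset (\<beta> i) (Suc i))"

definition alternant :: "nat \<Rightarrow> (nat \<Rightarrow> nat) \<Rightarrow> mpoly" where
  "alternant n e = det (mat n n (\<lambda>(i, j). Var (Suc i) ^ e j))"

lemma Var_power: "Var i ^ k = Poly_Mapping.single (replicate_mset k i) 1"
  by (induction k) (simp_all add: Var_def mult_single flip: single_one)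

lemma prod_single: "(\<Prod>t\<in>S. Poly_Mapping.single (f t) (w t)) =
    (Poly_Mapping.single (\<Sum>t\<in>S. f t) (\<Prod>t\<in>S. w t) :: mpoly)"
  by (induction S rule: infinite_finite_induct) (simp_all add: mult_single)

lemma coeff_of_int_mult: "coeff (of_int k * f) m = k * coeff f m"
proof -
  have "coeff (of_nat k * f) m = int k * coeff f m" for k
    by (induction k) (simp_all add: lookup_add algebra_simps)
  then show ?thesis
    by (cases k rule: int_cases2) simp_all
qed

lemma alternant_expand:
  "alternant n e = (\<Sum>p | p permutes {0..<n}. of_int (sign p) *
    Poly_Mapping.single (\<Sum>j<n. replicate_mset (e j) (Suc (p j))) 1)"
proof -
  have "p j < n" if "p permutes {0..<n}" "j < n" for p j
    using permutes_in_image[OF that(1), of j] that(2) by simp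
  then show ?thesis
    unfolding alternant_def
    by (subst det_col[where n = n]) (auto simp: Var_power prod_single intro!: sum.cong prod.cong)
qed

lemma count_monomial: "i < n \<Longrightarrow> count (monomial n \<beta>) (Suc i) = \<beta> i"
  by (simp add: monomial_def count_sum)

lemma monomial_eq_iff: "monomial n \<beta> = monomial n \<gamma> \<longleftrightarrow> (\<forall>i<n. \<beta> i = \<gamma> i)"
proof
  show "monomial n \<beta> = monomial n \<gamma> \<Longrightarrow> \<forall>i<n. \<beta> i = \<gamma> i"
    by (metis count_monomial)
qed (simp add: monomial_def)

lemma monomial_permute:
  assumes p: "p permutes {0..<n}"
  shows "(\<Sum>j<n. replicate_mset (e j) (Suc (p j))) = monomial n (e \<circ> inv_into UNIV p)"
proof -
  have p': "p permutes {..<n}" using p by (simp add: atLeast0LessThan)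
  show ?thesis
    unfolding monomial_def using sum.permute[OF p', of "\<lambda>i. replicate_mset (e (inv_into UNIV p i)) (Suc i)"]
    by (simp add: permutes_inverses[OF p'] comp_def)
qed

lemma coeff_alternant:
  "coeff (alternant n e) (monomial n \<beta>) =
    (\<Sum>p | p permutes {0..<n}. sign p * (if \<forall>j<n. \<beta> (p j) = e j then 1 else 0))"
proof -
  have "(\<forall>i<n. e (inv_into UNIV p i) = \<beta> i) \<longleftrightarrow> (\<forall>j<n. \<beta> (p j) = e j)" if p: "p permutes {0..<n}" for p
    using permutes_in_image[OF p] permutes_in_image[OF permutes_inv[OF p]] permutes_inverses[OF p]
    by (metis atLeast0LessThan lessThan_iff)
  then have iff: "monomial n (e \<circ> inv_into UNIV p) = monomial n \<beta> \<longleftrightarrow> (\<forall>j<n. \<beta> (p j) = e j)"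
    if "p permutes {0..<n}" for p
    using that by (simp only: monomial_eq_iff comp_apply)
  show ?thesis
    unfolding alternant_expand lookup_sum coeff_of_int_mult lookup_single
    by (intro sum.cong refl) (simp only: mem_Collect_eq monomial_permute iff when_def)
qed

lemma coeff_alternant_outside:
  assumes "\<And>\<beta>. m \<noteq> monomial n \<beta>"
  shows "coeff (alternant n e) m = 0"
  using assms by (auto simp: alternant_expand lookup_sum coeff_of_int_mult lookup_single monomial_permute
      when_def intro!: sum.neutral)

lemma coeff_alternant_permute:
  assumes \<sigma>: "\<sigma> permutes {0..<n}"
  shows "coeff (alternant n e) (monomial n (\<beta> \<circ> \<sigma>)) = sign \<sigma> * coeff (alternant n e) (monomial n \<beta>)"
proof -
  have perm: "permutation q" if "q permutes {0..<n}" for q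
    using that by (auto simp: permutation_permutes)
  have "coeff (alternant n e) (monomial n \<beta>) =
      (\<Sum>p | p permutes {0..<n}. sign (\<sigma> \<circ> p) * (if \<forall>j<n. \<beta> ((\<sigma> \<circ> p) j) = e j then 1 else 0))"
    unfolding coeff_alternant
    by (rule setum_permutations_compose_left[OF \<sigma>])
  also have "\<dots> = (\<Sum>p | p permutes {0..<n}. sign \<sigma> * (sign p * (if \<forall>j<n. (\<beta> \<circ> \<sigma>) (p j) = e j then 1 else 0)))"
    using perm[OF \<sigma>] by (intro sum.cong refl) (simp add: sign_compose perm mult.assoc)
  also have "\<dots> = sign \<sigma> * coeff (alternant n e) (monomial n (\<beta> \<circ> \<sigma>))"
    by (simp add: coeff_alternant sum_distrib_left)
  finally show ?thesis by (simp flip: mult.assoc add: sign_idempotent)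
qed

context
  fixes n :: nat and S :: "'t set" and w :: "'t \<Rightarrow> int" and e :: "'t \<Rightarrow> nat \<Rightarrow> nat" and A :: mpoly
  assumes A: "A = (\<Sum>t\<in>S. of_int (w t) * alternant n (e t))"
begin

text \<open>The right side reads the coefficient of \<open>x^(\<mu> + \<delta>)\<close> off
  \<open>A\<close> times all series \<open>1 / (1 - x\<^sub>i)\<^sup>i\<close>. So the value depends
  on the polynomial \<open>A\<close> only, not on how it is written as a combination of alternants,
  and involves only exponents up to \<open>\<mu> + \<delta>\<close>.\<close>

lemma sum_dual_eq:
  "(\<Sum>t\<in>S. w t * dual n \<mu> (e t)) = (\<Sum>\<beta>\<in>(\<Pi>\<^sub>E i\<in>{..<n}. {..shifted n \<mu> i}).
    coeff A (monomial n \<beta>) * (\<Prod>i<n. num_tails i (int (shifted n \<mu> i) - int (\<beta> i))))"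
proof -
  let ?B = "\<Pi>\<^sub>E i\<in>{..<n}. {..shifted n \<mu> i}"
  let ?P = "{p. p permutes {0..<n}}"
  let ?h = "\<lambda>\<beta>. \<Prod>i<n. num_tails i (int (shifted n \<mu> i) - int (\<beta> i))"
  have fin: "finite ?B" by (simp add: finite_PiE)
  have inner: "(\<Sum>\<beta>\<in>?B. (if \<forall>j<n. \<beta> (p j) = u j then 1 else 0) * ?h \<beta>) =
      (\<Prod>j<n. num_tails (p j) (int (shifted n \<mu> (p j)) - int (u j)))" if p: "p \<in> ?P" for p u
  proof -
    have p': "p permutes {..<n}" using p by (simp add: atLeast0LessThan)
    have p_lt: "p j < n \<longleftrightarrow> j < n" for j using permutes_in_image[OF p'] by simp
    define \<gamma> where "\<gamma> = (\<lambda>i\<in>{..<n}. u (inv_into UNIV p i))"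
    have \<gamma>: "\<gamma> (p j) = u j" if "j < n" for j
      using that p_lt permutes_inverses[OF p'] by (simp add: \<gamma>_def)
    have iff: "(\<forall>j<n. \<beta> (p j) = u j) \<longleftrightarrow> \<beta> = \<gamma>" if \<beta>: "\<beta> \<in> ?B" for \<beta>
    proof
      assume *: "\<forall>j<n. \<beta> (p j) = u j"
      show "\<beta> = \<gamma>"
      proof
        fix i
        show "\<beta> i = \<gamma> i"
        proof (cases "i < n")
          case True
          then have "inv_into UNIV p i < n" using permutes_in_image[OF permutes_inv[OF p'], of i] by simp
          then show ?thesis using * True permutes_inverses[OF p'] by (metis \<gamma>)
        qed (use \<beta> in \<open>simp add: \<gamma>_def PiE_iff extensional_def\<close>)
      qed
    qed (use \<gamma> in simp)
    have prod_eq: "?h \<gamma> = (\<Prod>j<n. num_tails (p j) (int (shifted n \<mu> (p j)) - int (u j)))"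
      using prod.permute[OF p', of "\<lambda>i. num_tails i (int (shifted n \<mu> i) - int (\<gamma> i))"]
      by (simp add: \<gamma> comp_def)
    have "(\<Sum>\<beta>\<in>?B. (if \<forall>j<n. \<beta> (p j) = u j then 1 else 0) * ?h \<beta>) = (\<Sum>\<beta>\<in>?B. if \<beta> = \<gamma> then ?h \<gamma> else 0)"
      by (intro sum.cong refl) (simp add: iff)
    also have "\<dots> = (if \<gamma> \<in> ?B then ?h \<gamma> else 0)"
      using fin by (subst sum.delta) simp_all
    \<comment> \<open>Outside the box some exponent of \<gamma> exceeds its bound, so a factor
      \<open>num_tails\<close> with negative argument makes \<open>?h \<gamma>\<close> zero
      anyway.\<close>
    also have "\<dots> = ?h \<gamma>"
    proof (cases "\<gamma> \<in> ?B")
      case False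
      then obtain i where "i < n" "shifted n \<mu> i < \<gamma> i"
        by (auto simp: PiE_iff \<gamma>_def)
      then have "?h \<gamma> = 0" by (auto intro!: prod_zero num_tails_neg)
      then show ?thesis by simp
    qed simp
    finally show ?thesis by (simp only: prod_eq)
  qed
  have "(\<Sum>\<beta>\<in>?B. coeff A (monomial n \<beta>) * ?h \<beta>) =
      (\<Sum>\<beta>\<in>?B. \<Sum>t\<in>S. \<Sum>p\<in>?P. w t * sign p * ((if \<forall>j<n. \<beta> (p j) = e t j then 1 else 0) * ?h \<beta>))"
    by (simp add: A lookup_sum coeff_of_int_mult coeff_alternant sum_distrib_left sum_distrib_right mult_ac)
  also have "\<dots> = (\<Sum>t\<in>S. \<Sum>\<beta>\<in>?B. \<Sum>p\<in>?P. w t * sign p * ((if \<forall>j<n. \<beta> (p j) = e t j then 1 else 0) * ?h \<beta>))"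
    by (rule sum.swap)
  also have "\<dots> = (\<Sum>t\<in>S. \<Sum>p\<in>?P. \<Sum>\<beta>\<in>?B. w t * sign p * ((if \<forall>j<n. \<beta> (p j) = e t j then 1 else 0) * ?h \<beta>))"
    by (rule sum.cong[OF refl], rule sum.swap)
  also have "\<dots> = (\<Sum>t\<in>S. \<Sum>p\<in>?P. w t * sign p * (\<Prod>j<n. num_tails (p j) (int (shifted n \<mu> (p j)) - int (e t j))))"
    by (intro sum.cong refl) (simp only: inner flip: sum_distrib_left)
  also have "\<dots> = (\<Sum>t\<in>S. w t * dual n \<mu> (e t))"
    by (simp add: dual_def sum_distrib_left mult.assoc)
  finally show ?thesis by simp
qed

lemma coeff_permute:
  "\<sigma> permutes {0..<n} \<Longrightarrow> coeff A (monomial n (\<beta> \<circ> \<sigma>)) = sign \<sigma> * coeff A (monomial n \<beta>)"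
  by (simp add: A lookup_sum coeff_of_int_mult coeff_alternant_permute sum_distrib_left mult.left_commute)

lemma sum_dual_eq_0:
  assumes "\<And>\<beta>. (\<Sum>i<n. \<beta> i) \<le> (\<Sum>i<n. shifted n \<mu> i) \<Longrightarrow> coeff A (monomial n \<beta>) = 0"
  shows "(\<Sum>t\<in>S. w t * dual n \<mu> (e t)) = 0"
  unfolding sum_dual_eq
proof (intro sum.neutral ballI)
  fix \<beta> assume "\<beta> \<in> (\<Pi>\<^sub>E i\<in>{..<n}. {..shifted n \<mu> i})"
  then have "(\<Sum>i<n. \<beta> i) \<le> (\<Sum>i<n. shifted n \<mu> i)" by (intro sum_mono) auto
  then show "coeff A (monomial n \<beta>) * (\<Prod>i<n. num_tails i (int (shifted n \<mu> i) - int (\<beta> i))) = 0"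
    by (simp add: assms)
qed

text \<open>If \<open>A\<close> is nonzero, some monomial of lowest degree in \<open>A\<close> has
  exponents \<open>\<mu> + \<delta>\<close> for a shape \<mu>. The functional at \<mu> returns its
  coefficient, because all other monomials in its range have smaller degree and do not occur in
  \<open>A\<close>.\<close>

lemma alternating_eq_0:
  assumes dual0: "\<And>\<mu>. \<mu> \<in> shapes n \<Longrightarrow> (\<Sum>t\<in>S. w t * dual n \<mu> (e t)) = 0"
  shows "A = 0"
proof -
  let ?a = "\<lambda>\<beta>. coeff A (monomial n \<beta>)"
  let ?d = "\<lambda>\<beta>. \<Sum>i<n. (\<beta> i :: nat)"
  have "?a \<beta> = 0" for \<beta>
  proof (rule ccontr)
    assume "?a \<beta> \<noteq> 0"
    then obtain \<beta>1 where \<beta>1: "?a \<beta>1 \<noteq> 0" "\<And>\<gamma>. ?a \<gamma> \<noteq> 0 \<Longrightarrow> ?d \<beta>1 \<le> ?d \<gamma>"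
      using ex_has_least_nat[of "\<lambda>\<beta>. ?a \<beta> \<noteq> 0" \<beta> ?d] by blast
    let ?Q = "\<lambda>\<beta>. ?a \<beta> \<noteq> 0 \<and> ?d \<beta> = ?d \<beta>1"
    \<comment> \<open>Minimising \<open>\<Sum>i<n. i * \<beta> i\<close> sorts the exponents:
      exchanging an ascent would lower the sum and only change the sign of the coefficient, while
      equal neighbours contradict antisymmetry.\<close>
    obtain \<gamma> where \<gamma>: "?a \<gamma> \<noteq> 0" "?d \<gamma> = ?d \<beta>1"
      and least: "\<And>\<gamma>'. ?Q \<gamma>' \<Longrightarrow> (\<Sum>i<n. i * \<gamma> i) \<le> (\<Sum>i<n. i * \<gamma>' i)"
      using ex_has_least_nat[of ?Q \<beta>1 "\<lambda>\<beta>. \<Sum>i<n. i * \<beta> i"] \<beta>1(1) by blast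
    have desc: "\<gamma> (Suc i) < \<gamma> i" if i: "Suc i < n" for i
    proof (rule ccontr)
      assume "\<not> \<gamma> (Suc i) < \<gamma> i"
      let ?\<tau> = "transpose i (Suc i)"
      have \<tau>: "?\<tau> permutes {0..<n}" using i by (intro permutes_swap_id) auto
      then have \<tau>': "?\<tau> permutes {..<n}" by (simp add: atLeast0LessThan)
      have swap: "?a (\<gamma> \<circ> ?\<tau>) = - ?a \<gamma>"
        using coeff_permute[OF \<tau>, of \<gamma>] by (simp add: sign_swap_id)
      show False
      proof (cases "\<gamma> i = \<gamma> (Suc i)")
        case True
        then have "\<gamma> \<circ> ?\<tau> = \<gamma>" by (auto simp: fun_eq_iff transpose_def)
        then show False using swap \<gamma>(1) by simp
      next
        case False
        then have less: "\<gamma> i < \<gamma> (Suc i)" using \<open>\<not> \<gamma> (Suc i) < \<gamma> i\<close> by simp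
        have "?d (\<gamma> \<circ> ?\<tau>) = ?d \<gamma>" using sum.permute[OF \<tau>', of \<gamma>] by (simp add: comp_def)
        then have "(\<Sum>k<n. k * \<gamma> k) \<le> (\<Sum>k<n. k * (\<gamma> \<circ> ?\<tau>) k)"
          using least[of "\<gamma> \<circ> ?\<tau>"] swap \<gamma> by simp
        moreover have split: "{..<n} = insert i (insert (Suc i) ({..<n} - {i, Suc i}))" using i by auto
        have "(\<Sum>k<n. k * g k) = i * g i + (Suc i * g (Suc i) + (\<Sum>k\<in>{..<n} - {i, Suc i}. k * g k))" for g :: "nat \<Rightarrow> nat"
          by (subst split) simp
        moreover have "(\<Sum>k\<in>{..<n} - {i, Suc i}. k * (\<gamma> \<circ> ?\<tau>) k) = (\<Sum>k\<in>{..<n} - {i, Suc i}. k * \<gamma> k)"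
          by (intro sum.cong refl) (auto simp: transpose_def)
        ultimately show False using less by simp
      qed
    qed
    have lower: "n - Suc i \<le> \<gamma> i" if "i < n" for i
      using that
    proof (induction "n - Suc i" arbitrary: i)
      case (Suc d)
      then have "n - Suc (Suc i) \<le> \<gamma> (Suc i)" by (intro Suc.hyps(1)) auto
      moreover have "\<gamma> (Suc i) < \<gamma> i" using Suc.hyps(2) by (intro desc) auto
      ultimately show ?case by simp
    qed simp
    define \<mu> where "\<mu> i = (if i < n then \<gamma> i - (n - Suc i) else 0)" for i
    have sh: "shifted n \<mu> i = \<gamma> i" if "i < n" for i
      using lower[OF that] that by (simp add: shifted_def \<mu>_def)
    have \<mu>: "\<mu> \<in> shapes n"
    proof -
      have "\<mu> (Suc i) \<le> \<mu> i" for i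
        using desc[of i] by (cases "Suc i < n") (auto simp: \<mu>_def)
      then show ?thesis by (simp add: shapes_def \<mu>_def)
    qed
    let ?B = "\<Pi>\<^sub>E i\<in>{..<n}. {..shifted n \<mu> i}"
    let ?g = "restrict \<gamma> {..<n}"
    have g: "?g \<in> ?B" using sh by auto
    have "(\<Sum>\<beta>\<in>?B. ?a \<beta> * (\<Prod>i<n. num_tails i (int (shifted n \<mu> i) - int (\<beta> i)))) =
        (\<Sum>\<beta>\<in>?B. if \<beta> = ?g then ?a \<gamma> else 0)"
    proof (intro sum.cong refl)
      fix \<beta> assume \<beta>: "\<beta> \<in> ?B"
      show "?a \<beta> * (\<Prod>i<n. num_tails i (int (shifted n \<mu> i) - int (\<beta> i))) = (if \<beta> = ?g then ?a \<gamma> else 0)"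
      proof (cases "\<beta> = ?g")
        case True
        moreover have "monomial n ?g = monomial n \<gamma>" by (simp add: monomial_eq_iff)
        moreover have "(\<Prod>i<n. num_tails i (int (shifted n \<mu> i) - int (?g i))) = 1"
          by (intro prod.neutral) (simp add: sh num_tails_0_right)
        ultimately show ?thesis by simp
      next
        case False
        have le: "\<beta> i \<le> \<gamma> i" if "i < n" for i using \<beta> sh[OF that] that by (metis PiE_mem atMost_iff lessThan_iff)
        have "\<exists>i<n. \<beta> i \<noteq> \<gamma> i"
        proof (rule ccontr)
          assume "\<not> ?thesis"
          then have "\<beta> = ?g" using \<beta> by (auto simp: PiE_iff extensional_def fun_eq_iff)
          then show False using False by simp
        qed
        then have "?d \<beta> < ?d \<gamma>" using le by (intro sum_strict_mono_ex1) (auto intro: le_neq_implies_less)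
        then have "?a \<beta> = 0" using \<beta>1(2)[of \<beta>] \<gamma>(2) by (cases "?a \<beta> = 0") auto
        then show ?thesis using False by simp
      qed
    qed
    also have "\<dots> = ?a \<gamma>" using g by (simp add: finite_PiE)
    finally have "?a \<gamma> = 0" using sum_dual_eq[of \<mu>] dual0[OF \<mu>] by simp
    then show False using \<gamma>(1) by simp
  qed
  moreover have "coeff A m = 0" if "\<And>\<beta>. m \<noteq> monomial n \<beta>" for m
    using that by (simp add: A lookup_sum coeff_of_int_mult coeff_alternant_outside)
  ultimately show ?thesis by (intro poly_mapping_eqI) (metis lookup_zero)
qed

end

text \<open>The binomial theorem in each column puts the determinant into the span of the
  alternants, where the functionals are defined.\<close>

lemma groth_det_alternants:
  "groth_det 1 n \<nu> (\<lambda>i. Var (Suc i)) = (\<Sum>k\<in>(\<Pi>\<^sub>E j\<in>{..<n}. {..j}).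
    of_int (binomial_weight n k) * alternant n (\<lambda>j. shifted n \<nu> j + k j))"
proof -
  have entry: "y ^ (\<nu> j + (n - Suc j)) * (1 - 1 * y) ^ j =
      1 * (\<Sum>v\<in>{..j}. of_int ((-1) ^ v * int (j choose v)) * y ^ (shifted n \<nu> j + v))" for y :: mpoly and j
  proof -
    have "(- y + 1) ^ j = (\<Sum>v\<le>j. of_nat (j choose v) * (- y) ^ v)"
      unfolding binomial_ring by simp
    then have "(1 - 1 * y) ^ j = (\<Sum>v\<le>j. of_nat (j choose v) * (- y) ^ v)" by simp
    moreover have "(- y) ^ v = (-1) ^ v * y ^ v" for v by (rule power_minus)
    ultimately show ?thesis
      by (simp add: shifted_def sum_distrib_left power_add mult_ac)
  qed
  show ?thesis
    unfolding groth_det_def entry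
    by (subst det_separated_sums[where a = "\<lambda>_. 1"]) (simp_all add: alternant_def binomial_weight_def)
qed

section \<open>Tail swapping\<close>

text \<open>
  Gasharov's tail swapping, for the relation \<open>R\<close> between neighbours in a row. An array is faulty
  where an entry \<open>y\<close> sits below a missing entry or below some \<open>x\<close> with \<open>R y x\<close>. The assumption
  \<open>bridge\<close> is what is left of (3+1)-freeness. Row \<open>j\<close> of an array for the permutation \<open>p\<close>
  has length \<open>\<mu> (p j) - p j + j\<close> and entries from \<open>F (p j)\<close>, so that both are inherited by the
  tails that are swapped.
\<close>

locale tail_swapping =
  fixes R :: "'e \<Rightarrow> 'e \<Rightarrow> bool" and E :: "'e set" and F :: "nat \<Rightarrow> 'e set"
    and n :: nat and \<mu> :: "nat \<Rightarrow> nat" and Q :: "'e set \<Rightarrow> bool"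
  assumes R_trans: "R x y \<Longrightarrow> R y z \<Longrightarrow> R x z"
    and bridge: "\<lbrakk>x \<in> E; y1 \<in> E; y2 \<in> E; y3 \<in> E; R y1 y2; R y2 y3; \<not> R y1 x\<rbrakk> \<Longrightarrow> R x y3"
    and F_subset: "F f \<subseteq> E"
    and F_finite: "finite (F f)"
    and F_mono: "f \<le> g \<Longrightarrow> F f \<subseteq> F g"
    and F_down: "\<lbrakk>x \<in> F f; y \<in> E; R y x\<rbrakk> \<Longrightarrow> y \<in> F f"
    and F_keep: "\<lbrakk>y \<in> F f; x \<in> E; \<not> R y x\<rbrakk> \<Longrightarrow> x \<in> F f"
    and \<mu>_antimono: "i \<le> j \<Longrightarrow> \<mu> j \<le> \<mu> i"
begin

text \<open>The length \<open>\<mu> f - f + j\<close> is written additively to avoid truncation: if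
  it is negative, no row qualifies. For \<open>f = p j < n\<close> it is
  \<open>shifted n \<mu> (p j)\<close> minus \<open>n - Suc j\<close>, the argument of
  \<open>num_tails\<close> in \<open>dual\<close> before the size of a chain is subtracted.\<close>

definition valid_row :: "nat \<Rightarrow> nat \<Rightarrow> 'e list \<Rightarrow> bool" where
  "valid_row j f a \<longleftrightarrow> sorted_wrt R a \<and> set a \<subseteq> F f \<and> length a + f = \<mu> f + j"

definition arrays :: "(nat \<Rightarrow> nat) \<Rightarrow> (nat \<Rightarrow> 'e list) set" where
  "arrays p = {A. (\<forall>j<n. valid_row j (p j) (A j)) \<and> (\<forall>j\<ge>n. A j = []) \<and> Q (\<Union>j<n. set (A j))}"

definition flaw :: "(nat \<Rightarrow> 'e list) \<Rightarrow> nat \<Rightarrow> nat \<Rightarrow> bool" where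
  "flaw A c r \<longleftrightarrow> Suc r < n \<and> c < length (A (Suc r)) \<and>
    (c < length (A r) \<longrightarrow> R (A (Suc r) ! c) (A r ! c))"

definition configs :: "((nat \<Rightarrow> nat) \<times> (nat \<Rightarrow> 'e list)) set" where
  "configs = (SIGMA p:{p. p permutes {..<n}}. arrays p)"

text \<open>At a first flaw, cutting row \<open>r\<close> before column \<open>c\<close> and row
  \<open>Suc r\<close> after it gives the new lengths \<open>length (A (Suc r)) - 1\<close> and
  \<open>length (A r) + 1\<close>, which is what exchanging the values of \<open>p\<close> demands
  in \<open>valid_row\<close>.\<close>

definition swap :: "nat \<Rightarrow> nat \<Rightarrow> (nat \<Rightarrow> nat) \<times> (nat \<Rightarrow> 'e list) \<Rightarrow> (nat \<Rightarrow> nat) \<times> (nat \<Rightarrow> 'e list)" where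
  "swap c r = (\<lambda>(p, A). (p \<circ> transpose r (Suc r),
    A(r := take c (A r) @ drop (Suc c) (A (Suc r)),
      Suc r := take (Suc c) (A (Suc r)) @ drop c (A r))))"

definition first_col :: "(nat \<Rightarrow> 'e list) \<Rightarrow> nat" where
  "first_col A = (LEAST c. \<exists>r. flaw A c r)"

text \<open>The lowest faulty row is taken because a swap at \<open>c\<close>, \<open>r\<close>
  preserves the flaws in earlier columns and, in column \<open>c\<close>, those in rows below
  \<open>r\<close>, but may change whether row \<open>r - 1\<close> is faulty there. So the same
  place is found again after the swap.\<close>

definition last_row :: "(nat \<Rightarrow> 'e list) \<Rightarrow> nat" where
  "last_row A = Max {r. flaw A (first_col A) r}"

definition swap_first :: "(nat \<Rightarrow> nat) \<times> (nat \<Rightarrow> 'e list) \<Rightarrow> (nat \<Rightarrow> nat) \<times> (nat \<Rightarrow> 'e list)" where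
  "swap_first pA = swap (first_col (snd pA)) (last_row (snd pA)) pA"

lemma finite_flaw_rows: "finite {r. flaw A c r}"
  by (rule finite_subset[of _ "{..<n}"]) (auto simp: flaw_def)

lemma first_flaw:
  assumes "\<exists>c r. flaw A c r"
  shows "flaw A (first_col A) (last_row A)"
    and "c < first_col A \<Longrightarrow> \<not> flaw A c r"
    and "last_row A < r \<Longrightarrow> \<not> flaw A (first_col A) r"
proof -
  have "\<exists>r. flaw A (first_col A) r"
    unfolding first_col_def using assms by (rule LeastI_ex)
  then have "last_row A \<in> {r. flaw A (first_col A) r}"
    unfolding last_row_def using finite_flaw_rows by (intro Max_in) auto
  then show "flaw A (first_col A) (last_row A)" by simp
  show "c < first_col A \<Longrightarrow> \<not> flaw A c r"
    unfolding first_col_def using not_less_Least by blast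
  show "last_row A < r \<Longrightarrow> \<not> flaw A (first_col A) r"
    unfolding last_row_def using finite_flaw_rows
    by (metis (mono_tags, lifting) Max_ge leD mem_Collect_eq)
qed

lemma first_flawI:
  assumes "flaw A c r" "\<And>c' r'. c' < c \<Longrightarrow> \<not> flaw A c' r'" "\<And>r'. r < r' \<Longrightarrow> \<not> flaw A c r'"
  shows "first_col A = c" "last_row A = r"
proof -
  show col: "first_col A = c"
    unfolding first_col_def
    by (rule Least_equality) (use assms in \<open>auto simp: not_less[symmetric]\<close>)
  show "last_row A = r"
    unfolding last_row_def col
    by (rule Max_eqI[OF finite_flaw_rows]) (use assms in \<open>auto simp: not_less[symmetric]\<close>)
qed

context
  fixes p :: "nat \<Rightarrow> nat" and A :: "nat \<Rightarrow> 'e list" and c r :: nat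
  assumes p: "p permutes {..<n}" and A: "A \<in> arrays p" and flaw: "flaw A c r"
    and first: "\<And>c' r'. c' < c \<Longrightarrow> \<not> flaw A c' r'"
begin

definition "upper_row = A r"
definition "lower_row = A (Suc r)"
definition "swapped = snd (swap c r (p, A))"

lemma row_facts: "Suc r < n" "sorted_wrt R upper_row" "sorted_wrt R lower_row" "set upper_row \<subseteq> F (p r)" "set lower_row \<subseteq> F (p (Suc r))"
    "length upper_row + p r = \<mu> (p r) + r" "length lower_row + p (Suc r) = \<mu> (p (Suc r)) + Suc r" "c < length lower_row"
  using A flaw by (auto simp: arrays_def valid_row_def flaw_def upper_row_def lower_row_def)

lemma no_earlier_flaw:
  assumes "c' < c"
  shows "c' < length upper_row" "\<not> R (lower_row ! c') (upper_row ! c')"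
  using first[OF assms, of r] row_facts assms by (auto simp: flaw_def upper_row_def lower_row_def)

lemma flaw_col_le: "c \<le> length upper_row"
  using no_earlier_flaw(1)[of "c - 1"] by (cases c) auto

lemma flaw_entry: "c < length upper_row \<Longrightarrow> R (lower_row ! c) (upper_row ! c)"
  using flaw by (simp add: flaw_def upper_row_def lower_row_def)

lemma entries_E: "x \<in> set upper_row \<Longrightarrow> x \<in> E" "x \<in> set lower_row \<Longrightarrow> x \<in> E"
  using row_facts F_subset by blast+

lemma sorted_nth: "sorted_wrt R xs \<Longrightarrow> i < j \<Longrightarrow> j < length xs \<Longrightarrow> R (xs ! i) (xs ! j)"
  by (simp add: sorted_wrt_nth_less)

text \<open>The one use of \<open>bridge\<close>. By minimality of \<open>c\<close>,
  \<open>lower_row ! (c - 1)\<close> is not related to the entry above it. That entry is compared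
  with the chain from \<open>lower_row ! (c - 1)\<close> through \<open>lower_row ! c\<close> to any
  later entry, and must precede the last.\<close>

lemma upper_sorted: "sorted_wrt R (take c upper_row @ drop (Suc c) lower_row)"
proof -
  have "R x y" if xy: "x \<in> set (take c upper_row)" "y \<in> set (drop (Suc c) lower_row)" for x y
  proof -
    obtain i where i: "x = upper_row ! i" "i < c" "i < length upper_row"
      using xy(1) by (auto simp: in_set_conv_nth)
    obtain k where k: "y = lower_row ! k" "c < k" "k < length lower_row"
      using xy(2) by (auto simp: in_set_conv_nth)
    define d where "d = c - 1"
    have d: "d < c" "c = Suc d" "i \<le> d" using i by (auto simp: d_def)
    have "upper_row ! d \<in> E" using no_earlier_flaw(1)[OF d(1)] entries_E(1) by simp
    then have "R (upper_row ! d) y"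
    proof (rule bridge)
      show "R (lower_row ! d) (lower_row ! c)" "R (lower_row ! c) y" using d k row_facts by (auto intro!: sorted_nth)
      show "\<not> R (lower_row ! d) (upper_row ! d)" using no_earlier_flaw(2)[OF d(1)] .
    qed (use d k row_facts in \<open>auto intro!: entries_E(2)\<close>)
    then show ?thesis
      using sorted_nth[OF row_facts(2), of i d] no_earlier_flaw(1)[OF d(1)] d(3) i(1) R_trans
      by (cases "i = d") auto
  qed
  then show ?thesis
    using row_facts by (simp add: sorted_wrt_append sorted_wrt_take sorted_wrt_drop)
qed

text \<open>The pieces are joined at the flaw itself, where \<open>lower_row ! c\<close> precedes
  \<open>upper_row ! c\<close>.\<close>

lemma lower_sorted: "sorted_wrt R (take (Suc c) lower_row @ drop c upper_row)"
proof -
  have "R x y" if xy: "x \<in> set (take (Suc c) lower_row)" "y \<in> set (drop c upper_row)" for x y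
  proof -
    obtain i where i: "x = lower_row ! i" "i \<le> c" using xy(1) by (auto simp: in_set_conv_nth)
    obtain k where k: "y = upper_row ! k" "c \<le> k" "k < length upper_row"
      using xy(2) by (auto simp: in_set_conv_nth)
    have "x = lower_row ! c \<or> R x (lower_row ! c)" using i row_facts sorted_nth[OF row_facts(3), of i c] by (cases "i = c") auto
    moreover have "upper_row ! c = y \<or> R (upper_row ! c) y" using k sorted_nth[OF row_facts(2), of c k] by (cases "k = c") auto
    moreover have "R (lower_row ! c) (upper_row ! c)" using flaw_entry k by simp
    ultimately show ?thesis using R_trans by blast
  qed
  then show ?thesis
    using row_facts by (simp add: sorted_wrt_append sorted_wrt_take sorted_wrt_drop)
qed

text \<open>An entry kept from the upper row has no flaw against the entry beneath it, so
  \<open>F_keep\<close> transfers the bound of the lower row to it.\<close>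

lemma upper_F: "set (take c upper_row @ drop (Suc c) lower_row) \<subseteq> F (p (Suc r))"
proof -
  have "x \<in> F (p (Suc r))" if x: "x \<in> set (take c upper_row)" for x
  proof -
    obtain i where i: "x = upper_row ! i" "i < c" "i < length upper_row"
      using x by (auto simp: in_set_conv_nth)
    have "lower_row ! i \<in> F (p (Suc r))" using row_facts i by (auto dest: nth_mem)
    then show ?thesis using no_earlier_flaw(2)[OF i(2)] i entries_E by (auto intro: F_keep)
  qed
  then show ?thesis using row_facts by (auto dest: in_set_dropD)
qed

lemma lower_F: "set (take (Suc c) lower_row @ drop c upper_row) \<subseteq> F (p r)"
proof -
  have "set (take (Suc c) lower_row) \<subseteq> F (p r)"
  proof (cases "c < length upper_row")
    case True
    have "upper_row ! c \<in> F (p r)" using row_facts True by (auto dest: nth_mem)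
    then have c: "lower_row ! c \<in> F (p r)" using flaw_entry[OF True] row_facts entries_E by (auto intro: F_down)
    show ?thesis
    proof
      fix x assume "x \<in> set (take (Suc c) lower_row)"
      then obtain i where i: "x = lower_row ! i" "i \<le> c" by (auto simp: in_set_conv_nth)
      then show "x \<in> F (p r)"
        using c sorted_nth[OF row_facts(3), of i c] row_facts(8) entries_E(2)[of "lower_row ! i"]
        by (cases "i = c") (auto intro: F_down)
    qed
  next
    case False
    \<comment> \<open>The upper row ends at the flaw and is the shorter one. If
      \<open>p r < p (Suc r)\<close>, then \<open>\<mu>_antimono\<close> would make it at least as
      long as the lower one; hence \<open>p (Suc r) \<le> p r\<close>, and \<open>F_mono\<close>
      applies.\<close>
    then have "length upper_row < length lower_row" using flaw_col_le row_facts(8) by simp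
    moreover have "p r < p (Suc r) \<Longrightarrow> \<mu> (p (Suc r)) \<le> \<mu> (p r)" by (simp add: \<mu>_antimono)
    ultimately have "p (Suc r) \<le> p r" using row_facts(6,7) by linarith
    then show ?thesis using F_mono row_facts(5) by (meson set_take_subset subset_trans)
  qed
  then show ?thesis using row_facts by (auto dest: in_set_dropD)
qed

lemma swapped_eq: "swapped = A(r := take c upper_row @ drop (Suc c) lower_row, Suc r := take (Suc c) lower_row @ drop c upper_row)"
  by (simp add: swapped_def swap_def upper_row_def lower_row_def)

lemma swap_arrays: "swapped \<in> arrays (p \<circ> transpose r (Suc r))"
proof -
  have "valid_row j ((p \<circ> transpose r (Suc r)) j) (swapped j)" if "j < n" for j
  proof -
    consider "j = r" | "j = Suc r" | "j \<noteq> r" "j \<noteq> Suc r" by blast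
    then show ?thesis
    proof cases
      case 1
      then show ?thesis
        using upper_sorted upper_F row_facts flaw_col_le by (simp add: valid_row_def swapped_eq)
    next
      case 2
      then show ?thesis
        using lower_sorted lower_F row_facts flaw_col_le by (simp add: valid_row_def swapped_eq)
    next
      case 3
      then show ?thesis using A that by (simp add: swapped_eq arrays_def)
    qed
  qed
  moreover have "(\<Union>j<n. set (swapped j)) = (\<Union>j<n. set (A j))"
  proof -
    have split: "{..<n} = {..<n} - {r, Suc r} \<union> {r, Suc r}" using row_facts(1) by auto
    have union: "(\<Union>j<n. set (B j)) = (\<Union>j\<in>{..<n} - {r, Suc r}. set (B j)) \<union> (set (B r) \<union> set (B (Suc r)))"
      for B :: "nat \<Rightarrow> 'e list" by (subst split) (simp only: UN_Un, simp)
    have "set (take k xs) \<union> set (drop k xs) = set xs" for k and xs :: "'e list"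
      by (metis append_take_drop_id set_append)
    then have "set (swapped r) \<union> set (swapped (Suc r)) = set (A r) \<union> set (A (Suc r))"
      by (auto simp: swapped_eq upper_row_def lower_row_def)
    then show ?thesis unfolding union by (simp add: swapped_eq)
  qed
  ultimately show ?thesis using A row_facts(1) by (auto simp: arrays_def swapped_eq)
qed

lemma swap_flaw_before: "c' < c \<Longrightarrow> flaw swapped c' r' \<longleftrightarrow> flaw A c' r'"
  using flaw_col_le row_facts(1,8) no_earlier_flaw(1)[of c']
  by (auto simp: flaw_def swapped_eq nth_append upper_row_def lower_row_def)

text \<open>After the swap \<open>lower_row ! c\<close> lies below its former right neighbour, or
  below nothing.\<close>

lemma swap_flaw_at: "flaw swapped c r"
proof -
  have "R (lower_row ! c) (lower_row ! Suc c)" if "Suc c < length lower_row" using that row_facts by (intro sorted_nth) auto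
  then show ?thesis
    using flaw_col_le row_facts(1,8) by (auto simp: flaw_def swapped_eq nth_append)
qed

lemma swap_flaw_after: "r < r' \<Longrightarrow> flaw swapped c r' \<longleftrightarrow> flaw A c r'"
  using flaw_col_le row_facts(1,8) by (auto simp: flaw_def swapped_eq nth_append lower_row_def)

lemmas swap_step = swap_arrays[unfolded swapped_def] swap_flaw_at[unfolded swapped_def]
  swap_flaw_before[unfolded swapped_def] swap_flaw_after[unfolded swapped_def]

lemma swap_swap: "swap c r (swap c r (p, A)) = (p, A)"
proof -
  have "swapped = snd (swap c r (p, A))" by (simp add: swapped_def)
  moreover have "snd (swap c r (p \<circ> transpose r (Suc r), swapped)) = A"
    using flaw_col_le row_facts(8) by (auto simp: swap_def swapped_eq fun_eq_iff upper_row_def[symmetric] lower_row_def[symmetric] take_Suc_conv_app_nth)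
      (auto simp: upper_row_def lower_row_def id_take_nth_drop[symmetric])
  ultimately show ?thesis
    by (auto simp: swap_def comp_assoc)
qed

end

lemma swap_first_step:
  assumes "(p, A) \<in> configs" "\<exists>c r. flaw A c r"
  defines "B \<equiv> swap_first (p, A)"
  shows "B \<in> configs" "\<exists>c r. flaw (snd B) c r" "swap_first B = (p, A)" "sign (fst B) = - sign p"
proof -
  have p: "p permutes {..<n}" and A: "A \<in> arrays p" using assms(1) by (auto simp: configs_def)
  note first = first_flaw[OF assms(2)]
  define c r where "c = first_col A" and "r = last_row A"
  have fl: "flaw A c r" and cols: "\<And>c' r'. c' < c \<Longrightarrow> \<not> flaw A c' r'" and rs: "\<And>r'. r < r' \<Longrightarrow> \<not> flaw A c r'"
    using first by (auto simp: c_def r_def)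
  note ctx = p A fl cols
  have r: "r < n" "Suc r < n" using fl by (auto simp: flaw_def)
  have B: "B = swap c r (p, A)" by (simp add: B_def swap_first_def c_def r_def)
  have fst_B: "fst B = p \<circ> transpose r (Suc r)" by (simp add: B swap_def)
  have t: "transpose r (Suc r) permutes {..<n}" using r by (intro permutes_swap_id) auto
  show "B \<in> configs"
    using swap_step(1)[OF ctx] permutes_compose[OF t p] fst_B by (cases B) (simp add: configs_def B)
  show "\<exists>c r. flaw (snd B) c r" using swap_step(2)[OF ctx] by (auto simp: B)
  have "first_col (snd B) = c" "last_row (snd B) = r"
    using first_flawI[of "snd B" c r] swap_step(2-)[OF ctx] cols rs
    by (auto simp: B)
  then show "swap_first B = (p, A)" using swap_swap[OF ctx] by (simp add: swap_first_def B)
  have "permutation p" using p by (auto simp: permutation_permutes)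
  then show "sign (fst B) = - sign p"
    by (simp add: fst_B sign_compose permutation_swap_id sign_swap_id)
qed

text \<open>Without flaws the row lengths decrease weakly. At a descent of \<open>p\<close>, the
  summand \<open>j\<close> of the length together with \<open>\<mu>_antimono\<close> would make the
  next row longer; so \<open>p\<close> increases.\<close>

lemma flawless_id:
  assumes "(p, A) \<in> configs" "\<not> (\<exists>c r. flaw A c r)"
  shows "p = id"
proof -
  have p: "p permutes {..<n}" and A: "A \<in> arrays p" using assms(1) by (auto simp: configs_def)
  have step: "p r < p (Suc r)" if r: "Suc r < n" for r
  proof -
    have "\<not> flaw A (length (A r)) r" using assms(2) by blast
    then have "length (A (Suc r)) \<le> length (A r)" using r by (simp add: flaw_def)
    moreover have "length (A r) + p r = \<mu> (p r) + r" "length (A (Suc r)) + p (Suc r) = \<mu> (p (Suc r)) + Suc r"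
      using A r by (auto simp: arrays_def valid_row_def)
    moreover have "p (Suc r) \<le> p r \<Longrightarrow> \<mu> (p r) \<le> \<mu> (p (Suc r))" by (simp add: \<mu>_antimono)
    ultimately show ?thesis by linarith
  qed
  have "r \<le> p r" if "r < n" for r
    using that
  proof (induction r)
    case (Suc r)
    then show ?case using step[of r] by simp
  qed simp
  then show ?thesis using permutes_natset_ge[OF p] by simp
qed

lemma finite_arrays: "finite (arrays p)"
proof (rule finite_subset)
  let ?L = "\<lambda>j. {xs. set xs \<subseteq> F (p j) \<and> length xs \<le> \<mu> (p j) + j}"
  show "arrays p \<subseteq> {A. \<forall>j. (j \<in> {..<n} \<longrightarrow> A j \<in> (\<Union>j<n. ?L j)) \<and> (j \<notin> {..<n} \<longrightarrow> A j = [])}"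
  proof clarify
    fix A j assume A: "A \<in> arrays p"
    show "(j \<in> {..<n} \<longrightarrow> A j \<in> (\<Union>j<n. ?L j)) \<and> (j \<notin> {..<n} \<longrightarrow> A j = [])"
    proof (cases "j < n")
      case True
      then have "A j \<in> ?L j" using A by (auto simp: arrays_def valid_row_def)
      then show ?thesis using True by blast
    qed (use A in \<open>simp add: arrays_def\<close>)
  qed
  show "finite {A. \<forall>j. (j \<in> {..<n} \<longrightarrow> A j \<in> (\<Union>j<n. ?L j)) \<and> (j \<notin> {..<n} \<longrightarrow> A j = [])}"
    by (intro finite_set_of_finite_funs) (auto intro: finite_lists_length_le F_finite)
qed

theorem signed_count_arrays:
  "(\<Sum>p | p permutes {..<n}. sign p * int (card (arrays p))) = int (card {A \<in> arrays id. \<forall>c r. \<not> flaw A c r})"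
proof -
  let ?bad = "{B \<in> configs. \<exists>c r. flaw (snd B) c r}" and ?good = "{B \<in> configs. \<forall>c r. \<not> flaw (snd B) c r}"
  let ?s = "\<lambda>B. sign (fst B)"
  have fin: "finite configs"
    unfolding configs_def by (intro finite_SigmaI finite_permutations finite_arrays) simp
  have step: "swap_first B \<in> ?bad" "swap_first (swap_first B) = B" "- ?s (swap_first B) = ?s B"
    if "B \<in> ?bad" for B
    using swap_first_step[of "fst B" "snd B"] that by auto
  have "sum ?s ?bad = (\<Sum>B\<in>?bad. - ?s B)"
    by (rule sum.reindex_bij_witness[where i = swap_first and j = swap_first]; rule step)
  then have bad: "sum ?s ?bad = 0" by (simp add: sum_negf)
  have "(\<Sum>p | p permutes {..<n}. sign p * int (card (arrays p))) =
      (\<Sum>p | p permutes {..<n}. \<Sum>A\<in>arrays p. sign p)"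
    by (simp add: mult.commute)
  also have "\<dots> = sum ?s configs"
    unfolding configs_def using finite_arrays finite_permutations[of "{..<n}"]
    by (subst sum.Sigma) (auto simp: case_prod_beta)
  also have "configs = ?bad \<union> ?good" by blast
  also have "sum ?s \<dots> = sum ?s ?bad + sum ?s ?good"
    using fin by (intro sum.union_disjoint) auto
  also have "\<dots> = sum ?s ?good" using bad by simp
  also have "?good = Pair id ` {A \<in> arrays id. \<forall>c r. \<not> flaw A c r}"
  proof -
    have "p = id" if "(p, A) \<in> configs" "\<forall>c r. \<not> flaw A c r" for p A
      using flawless_id[of p A] that by blast
    then have "?good \<subseteq> Pair id ` {A \<in> arrays id. \<forall>c r. \<not> flaw A c r}"
      by (force simp: configs_def)
    moreover have "Pair id ` {A \<in> arrays id. \<forall>c r. \<not> flaw A c r} \<subseteq> ?good"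
      by (auto simp: configs_def permutes_id)
    ultimately show ?thesis by blast
  qed
  also have "sum ?s \<dots> = int (card {A \<in> arrays id. \<forall>c r. \<not> flaw A c r})"
    by (subst sum.reindex) (auto simp: inj_on_def)
  finally show ?thesis .
qed

end

section \<open>Chain covers and Grothendieck \<open>P\<close>-tableaux\<close>

definition part_fun :: "nat list \<Rightarrow> nat \<Rightarrow> nat" where
  "part_fun l i = (if i < length l then l ! i else 0)"

lemma young_diagram_eq: "young_diagram l = diagram (part_fun l)"
  by (auto simp: young_diagram_def diagram_def part_fun_def split: if_splits)

lemma part_fun_shapes: "is_partition l \<Longrightarrow> length l \<le> n \<Longrightarrow> part_fun l \<in> shapes n"
  by (auto simp: shapes_def part_fun_def is_partition_def sorted_wrt_iff_nth_less)

lemma part_fun_eq_0_iff: "is_partition l \<Longrightarrow> part_fun l i = 0 \<longleftrightarrow> length l \<le> i"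
  by (force simp: part_fun_def is_partition_def in_set_conv_nth)

lemma part_fun_inj:
  assumes "is_partition l" "is_partition k" "part_fun l = part_fun k"
  shows "l = k"
proof (rule nth_equalityI)
  have "length l \<le> i \<longleftrightarrow> length k \<le> i" for i
    using part_fun_eq_0_iff[OF assms(1), of i] part_fun_eq_0_iff[OF assms(2), of i] assms(3) by simp
  then show len: "length l = length k" by (meson le_antisym le_refl)
  show "l ! i = k ! i" if "i < length l" for i
    using fun_cong[OF assms(3), of i] that len by (simp add: part_fun_def)
qed

lemma shapes_partition:
  assumes \<mu>: "\<mu> \<in> shapes n"
  obtains l where "is_partition l" "length l \<le> n" "part_fun l = \<mu>"
proof
  define N where "N = (LEAST i. \<mu> i = 0)"
  have N0: "\<mu> N = 0" unfolding N_def using shapes_eq_0[OF \<mu>] by (intro LeastI[of "\<lambda>i. \<mu> i = 0" n]) simp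
  have N_less: "\<mu> i \<noteq> 0" if "i < N" for i using that unfolding N_def by (rule not_less_Least)
  have N_ge: "\<mu> i = 0" if "N \<le> i" for i using shapes_antimono[OF \<mu> that] N0 by simp
  let ?l = "map \<mu> [0..<N]"
  show "is_partition ?l"
    using N_less shapes_antimono[OF \<mu>] by (force simp: is_partition_def sorted_wrt_iff_nth_less)
  show "length ?l \<le> n" unfolding N_def using shapes_eq_0[OF \<mu>] by (simp add: Least_le)
  show "part_fun ?l = \<mu>" using N_ge by (auto simp: part_fun_def fun_eq_iff)
qed

text \<open>One relation encodes rows and columns of a P-tableau: it holds from a cell to its right
  neighbour and fails from a cell to the one above it. As it always holds from \<open>Inl\<close> to
  \<open>Inr\<close> and never from \<open>Inr\<close> to \<open>Inl\<close>, the poset cells form a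
  Young diagram.\<close>

fun row_rel :: "'a rel \<Rightarrow> 'a + nat \<Rightarrow> 'a + nat \<Rightarrow> bool" where
  "row_rel r (Inl p) (Inl q) = strictly_below r p q"
| "row_rel r (Inl p) (Inr k) = True"
| "row_rel r (Inr m) (Inl q) = False"
| "row_rel r (Inr m) (Inr k) = (m \<le> k)"

definition chains :: "'a set \<Rightarrow> 'a rel \<Rightarrow> 'a set set" where
  "chains P r = {C. C \<subseteq> P \<and> (\<forall>a\<in>C. \<forall>b\<in>C. (a, b) \<in> r \<or> (b, a) \<in> r)}"

text \<open>\<open>C i\<close> stands for the set of vertices that use colour \<open>Suc i\<close>.
  The chains may be empty and may overlap, since a vertex carries a set of colours.\<close>

definition chain_covers :: "'a set \<Rightarrow> 'a rel \<Rightarrow> nat \<Rightarrow> (nat \<Rightarrow> 'a set) set" where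
  "chain_covers P r n = {C \<in> {..<n} \<rightarrow>\<^sub>E chains P r. (\<Union>i<n. C i) = P}"

lemma finite_chain_covers: "finite P \<Longrightarrow> finite (chain_covers P r n)"
  by (rule finite_subset[of _ "{..<n} \<rightarrow>\<^sub>E Pow P"])
     (auto simp: chain_covers_def chains_def finite_PiE)

lemma sorted_wrt_unique:
  assumes "\<And>x. \<not> R x x" "\<And>x y z. R x y \<Longrightarrow> R y z \<Longrightarrow> R x z"
  shows "sorted_wrt R xs \<Longrightarrow> sorted_wrt R ys \<Longrightarrow> set xs = set ys \<Longrightarrow> xs = ys"
proof (induction xs arbitrary: ys)
  case (Cons x xs)
  then obtain y ys' where ys: "ys = y # ys'" by (cases ys) auto
  have "x = y"
  proof (rule ccontr)
    assume "x \<noteq> y"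
    then have "x \<in> set ys'" "y \<in> set xs" using Cons.prems(3) ys by auto
    then have "R y x" "R x y" using Cons.prems ys by auto
    then show False using assms by blast
  qed
  moreover have "x \<notin> set xs" "y \<notin> set ys'" using Cons.prems ys assms(1) by auto
  ultimately have "set xs = set ys'" using Cons.prems(3) ys by auto
  then show ?case using Cons.IH[of ys'] Cons.prems ys \<open>x = y\<close> by auto
qed simp

lemma split_row:
  assumes "sorted_wrt (row_rel r) a"
  obtains l xs where "a = map Inl l @ map Inr xs" "sorted_wrt (strictly_below r) l" "sorted xs"
proof -
  have "\<exists>l xs. a = map Inl l @ map Inr xs \<and> sorted_wrt (strictly_below r) l \<and> sorted xs"
    using assms
  proof (induction a)
    case (Cons x a)
    then obtain l xs where a: "a = map Inl l @ map Inr xs" "sorted_wrt (strictly_below r) l" "sorted xs"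
      by auto
    show ?case
    proof (cases x)
      case (Inl p)
      then show ?thesis using a Cons.prems by (intro exI[of _ "p # l"] exI[of _ xs]) (auto simp: ball_Un)
    next
      case (Inr m)
      then have "l = []" using a Cons.prems by (cases l) auto
      then show ?thesis using a Cons.prems Inr by (intro exI[of _ "[]"] exI[of _ "m # xs"]) auto
    qed
  qed simp
  then show ?thesis using that by blast
qed

lemma sorted_split_row:
  "sorted_wrt (row_rel r) (map Inl l @ map Inr xs) \<longleftrightarrow> sorted_wrt (strictly_below r) l \<and> sorted xs"
  by (auto simp: sorted_wrt_append sorted_wrt_map)

section \<open>Posets with claw-free incomparability graph\<close>

locale claw_free_poset =
  fixes P :: "'a set" and r :: "'a rel"
  assumes finite_P: "finite P" and po: "partial_order_on P r"
    and claw_free: "claw_free (with_proj (incomparability_graph P r))"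
begin

abbreviation below (infix "\<prec>" 50) where "p \<prec> q \<equiv> strictly_below r p q"

lemma below_trans: "p \<prec> q \<Longrightarrow> q \<prec> s \<Longrightarrow> p \<prec> s"
  using po by (auto simp: partial_order_on_def preorder_on_def dest: transD antisymD)

text \<open>An element incomparable to a whole 3-chain would be the centre of an induced claw with
  the chain as leaves.\<close>

lemma no_three_plus_one:
  assumes "a \<prec> b" "b \<prec> c" and in_P: "a \<in> P" "b \<in> P" "c \<in> P" "d \<in> P"
  shows "(\<exists>x\<in>{a, b, c}. (d, x) \<in> r \<or> (x, d) \<in> r)"
proof (rule ccontr)
  assume inc: "\<not> ?thesis"
  have refl: "(x, x) \<in> r" if "x \<in> P" for x
    using po that by (auto simp: partial_order_on_def preorder_on_def refl_on_def)
  have ac: "a \<prec> c" using below_trans assms(1,2) by blast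
  have ne: "d \<noteq> a" "d \<noteq> b" "d \<noteq> c" using inc refl[OF in_P(4)] by auto
  let ?G = "with_proj (incomparability_graph P r)"
  define h where "h x = (if x = d then 1 else if x = a then 2 else if x = b then 3 else (4::nat))" for x
  define H where "H = with_proj \<lparr>pverts = {d, a, b, c},
    parcs = {(d, a), (a, d), (d, b), (b, d), (d, c), (c, d)}\<rparr>"
  define f where "f = \<lparr>iso_verts = h, iso_arcs = map_prod h h, iso_head = snd, iso_tail = fst\<rparr>"
  have h: "h d = 1" "h a = 2" "h b = 3" "h c = 4"
    using ne assms(1,2) ac by (auto simp: h_def)
  have wf_G: "wf_digraph ?G"
    by unfold_locales (auto simp: incomparability_graph_def)
  have wf_H: "wf_digraph H"
    by unfold_locales (auto simp: H_def)
  have arcs_H: "arcs H = {e \<in> arcs ?G. tail ?G e \<in> verts H \<and> head ?G e \<in> verts H}"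
  proof -
    have "e \<in> arcs H \<longleftrightarrow> e \<in> arcs ?G \<and> tail ?G e \<in> verts H \<and> head ?G e \<in> verts H" for e
    proof (cases e)
      case (Pair x y)
      show ?thesis
      proof (cases "x \<in> {d, a, b, c} \<and> y \<in> {d, a, b, c}")
        case True
        then have "x = d \<or> x = a \<or> x = b \<or> x = c" "y = d \<or> y = a \<or> y = b \<or> y = c"
          by simp_all
        moreover have nr: "(d, a) \<notin> r" "(a, d) \<notin> r" "(d, b) \<notin> r" "(b, d) \<notin> r" "(d, c) \<notin> r" "(c, d) \<notin> r"
          using inc by simp_all
        ultimately show ?thesis
          unfolding Pair H_def incomparability_graph_def
          by (elim disjE) (simp_all add: nr in_P assms(1,2) ac ne ne[symmetric])
      next
        case False
        then show ?thesis unfolding Pair H_def incomparability_graph_def by simp blast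
      qed
    qed
    then show ?thesis by blast
  qed
  have "induced_subgraph H ?G"
    unfolding induced_subgraph_def subgraph_def compatible_def
    using wf_G wf_H arcs_H in_P by (auto simp: H_def incomparability_graph_def)
  moreover have "digraph_iso H (with_proj claw)"
    unfolding digraph_iso_def
  proof (intro exI conjI)
    have inj: "inj_on h {d, a, b, c}" using h by (auto simp: inj_on_def)
    moreover have "inj_on (map_prod h h) (arcs H)"
      by (rule inj_on_subset[OF map_prod_inj_on[OF inj inj]]) (auto simp: H_def)
    ultimately show "pre_digraph.digraph_isomorphism H f"
      using wf_H by (auto simp: pre_digraph.digraph_isomorphism_def f_def H_def)
    show "with_proj claw = app_iso f H"
      using h by (auto simp: app_iso_def f_def H_def claw_def with_proj_def)
  qed
  ultimately show False using claw_free by (auto simp: claw_free_def)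
qed

lemma row_rel_trans: "row_rel r x y \<Longrightarrow> row_rel r y z \<Longrightarrow> row_rel r x z"
  by (cases x; cases y; cases z; simp; metis below_trans)

text \<open>If \<open>y3\<close> comes from the poset, so do the other three, and (3+1)-freeness
  makes \<open>x\<close> comparable to the chain; as \<open>y1\<close> is not below
  \<open>x\<close>, this puts \<open>x\<close> below \<open>y3\<close>. If \<open>y3\<close> is an
  integer, the only case with content has all four integers, where
  \<open>x < y1 \<le> y3\<close>.\<close>

lemma row_rel_bridge:
  assumes E: "x \<in> P <+> {0<..}" "y1 \<in> P <+> {0<..}" "y2 \<in> P <+> {0<..}" "y3 \<in> P <+> {0<..}"
    and R: "row_rel r y1 y2" "row_rel r y2 y3" and not: "\<not> row_rel r y1 x"
  shows "row_rel r x y3"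
proof (cases y3)
  case (Inl c)
  then obtain a b d where eqs: "y1 = Inl a" "y2 = Inl b" "x = Inl d"
    using R not by (cases y1; cases y2; cases x) auto
  have lt: "a \<prec> b" "b \<prec> c" "\<not> a \<prec> d" using R not Inl eqs by simp_all
  moreover have "a \<in> P" "b \<in> P" "c \<in> P" "d \<in> P" using E Inl eqs by auto
  ultimately obtain e where e: "e \<in> {a, b, c}" "(d, e) \<in> r \<or> (e, d) \<in> r"
    using no_three_plus_one[of a b c d] by blast
  have "d \<prec> c"
    using e lt below_trans[of a b c] below_trans[of a b d] below_trans[of a c d] below_trans[of d a c] below_trans[of d b c]
    by auto
  then show ?thesis by (simp add: Inl eqs)
next
  case (Inr k)
  then show ?thesis using R not by (cases x; cases y1; cases y2) auto
qed

text \<open>\<open>F f\<close> bounds the integers by \<open>f\<close>, the size of the alphabet of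
  \<open>tails f\<close>; in row \<open>i\<close> of an array for the identity this is the bound
  \<open>n \<le> i\<close> of tableaux.\<close>

lemma tail_swapping:
  assumes "\<And>i j. i \<le> j \<Longrightarrow> \<mu> j \<le> \<mu> i"
  shows "tail_swapping (row_rel r) (P <+> {0<..}) (\<lambda>f. P <+> {0<..f}) \<mu>"
proof
  show "row_rel r x z" if "row_rel r x y" "row_rel r y z" for x y z
    using row_rel_trans that .
  show "row_rel r x y3"
    if "x \<in> P <+> {0<..}" "y1 \<in> P <+> {0<..}" "y2 \<in> P <+> {0<..}" "y3 \<in> P <+> {0<..}"
      "row_rel r y1 y2" "row_rel r y2 y3" "\<not> row_rel r y1 x" for x y1 y2 y3
    using row_rel_bridge that .
  show "y \<in> P <+> {0<..f}" if "x \<in> P <+> {0<..f}" "y \<in> P <+> {0<..}" "row_rel r y x" for x y f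
    using that by (cases x; cases y) auto
  show "x \<in> P <+> {0<..f}" if "y \<in> P <+> {0<..f}" "x \<in> P <+> {0<..}" "\<not> row_rel r y x" for x y f
    using that by (cases x; cases y) auto
qed (use assms finite_P in auto)

definition part_rows :: "nat \<Rightarrow> nat \<Rightarrow> nat \<Rightarrow> 'a set \<Rightarrow> ('a + nat) list set" where
  "part_rows j m f C = {a. sorted_wrt (row_rel r) a \<and> set a \<subseteq> P <+> {0<..f} \<and> length a + f = m + j
    \<and> Inl -` set a = C}"

lemma chain_list:
  assumes "C \<in> chains P r"
  obtains l where "sorted_wrt (\<lambda>p q. p \<prec> q) l" "set l = C" "length l = card C"
proof -
  have fin: "finite C" using assms finite_P by (auto simp: chains_def intro: finite_subset)
  have "\<exists>l. sorted_wrt (\<lambda>p q. p \<prec> q) l \<and> set l = C"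
    using fin assms
  proof (induction "card C" arbitrary: C)
    case (Suc k)
    have "asymp_on C below" "transp_on C below"
      using po by (auto simp: asymp_on_def transp_on_def partial_order_on_def preorder_on_def dest: transD antisymD)
    then obtain m where m: "m \<in> C" "\<forall>x\<in>C. x \<noteq> m \<longrightarrow> \<not> x \<prec> m"
      using Finite_Set.bex_min_element[of C below] Suc.prems(1) Suc.hyps(2) by force
    have "card (C - {m}) = k" "finite (C - {m})" using m Suc.hyps(2) Suc.prems(1) by simp_all
    moreover have "C - {m} \<in> chains P r" using Suc.prems(2) by (auto simp: chains_def)
    ultimately obtain l where l: "sorted_wrt (\<lambda>p q. p \<prec> q) l" "set l = C - {m}"
      using Suc.hyps(1) by blast
    have "m \<prec> x" if "x \<in> C - {m}" for x
      using m that Suc.prems(2) by (auto simp: chains_def)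
    then show ?case using l m(1) by (intro exI[of _ "m # l"]) auto
  qed simp
  then obtain l where l: "sorted_wrt (\<lambda>p q. p \<prec> q) l" "set l = C" by blast
  have "distinct l" using l(1) by (induction l) auto
  then have "length l = card C" using l(2) distinct_card by fastforce
  then show ?thesis by (rule that[OF l])
qed

text \<open>A chain has only one sorted listing, so a row with a given chain is determined by its
  tail.\<close>

lemma card_part_rows:
  assumes "C \<in> chains P r"
  shows "int (card (part_rows j m f C)) = num_tails f (int m + int j - int f - int (card C))"
proof -
  obtain l where l: "sorted_wrt (\<lambda>p q. p \<prec> q) l" "set l = C" "length l = card C"
    using chain_list[OF assms] .
  have C: "C \<subseteq> P" using assms by (simp add: chains_def)
  have "part_rows j m f C = (\<lambda>xs. map Inl l @ map Inr xs) ` tails f (int m + int j - int f - int (card C))"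
  proof (intro equalityI subsetI)
    fix a assume a: "a \<in> part_rows j m f C"
    then have "sorted_wrt (row_rel r) a" by (simp add: part_rows_def)
    then obtain l' xs where a': "a = map Inl l' @ map Inr xs" "sorted_wrt (strictly_below r) l'" "sorted xs"
      by (rule split_row)
    have set_l': "set l' = C" using a by (auto simp: part_rows_def a'(1))
    have "l' = l"
    proof (rule sorted_wrt_unique[where R = below])
      show "x \<prec> y \<Longrightarrow> y \<prec> z \<Longrightarrow> x \<prec> z" for x y z by (rule below_trans)
    qed (use a'(2) l set_l' in simp_all)
    then show "a \<in> (\<lambda>xs. map Inl l @ map Inr xs) ` tails f (int m + int j - int f - int (card C))"
      using a a' l by (intro image_eqI[of _ _ xs]) (auto simp: part_rows_def tails_def)
  next
    fix a assume "a \<in> (\<lambda>xs. map Inl l @ map Inr xs) ` tails f (int m + int j - int f - int (card C))"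
    then show "a \<in> part_rows j m f C"
      using l C by (auto simp: part_rows_def tails_def sorted_split_row subset_iff Suc_le_eq)
  qed
  moreover have "inj (\<lambda>xs. map Inl l @ map Inr xs :: ('a + nat) list)"
    by (auto simp: inj_on_def)
  ultimately show ?thesis by (simp add: num_tails_def card_image inj_on_subset)
qed

context
  fixes n :: nat and \<mu> :: "nat \<Rightarrow> nat"
  assumes \<mu>: "\<mu> \<in> shapes n"
begin

interpretation T: tail_swapping "row_rel r" "P <+> {0<..}" "\<lambda>f. P <+> {0<..f}" n \<mu> "\<lambda>M. Inl ` P \<subseteq> M"
  by (rule tail_swapping) (rule shapes_antimono[OF \<mu>])

text \<open>For the identity, row \<open>i\<close> has length \<open>\<mu> i\<close>, so an array
  fills the diagram. Being flawless is then the column condition, since \<mu> decreases weakly and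
  no entry sits below a missing one.\<close>

lemma card_flawless_arrays:
  assumes l: "is_partition l" "part_fun l = \<mu>"
  shows "card {A \<in> T.arrays id. \<forall>c r. \<not> T.flaw A c r} = card (grothendieck_P_tableaux P r l)"
proof -
  let ?D = "young_diagram l"
  let ?good = "{A \<in> T.arrays id. \<forall>c r. \<not> T.flaw A c r}"
  have D: "?D = diagram \<mu>" using l(2) by (simp add: young_diagram_eq)
  have D_lt: "i < n" if "(i, j) \<in> ?D" for i j
    using that shapes_eq_0[OF \<mu>, of i] by (cases "i < n") (auto simp: D diagram_def)
  have anti: "\<mu> (Suc i) \<le> \<mu> i" for i using \<mu> by (simp add: shapes_def)
  let ?f = "\<lambda>A. \<lambda>(i, j)\<in>?D. A i ! j"
  let ?g = "\<lambda>T i. if i < n then map (\<lambda>j. T (i, j)) [0..<\<mu> i] else []"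
  have "bij_betw ?f ?good (grothendieck_P_tableaux P r l)"
  proof (rule bij_betw_byWitness[where f' = ?g])
    show "\<forall>A\<in>?good. ?g (?f A) = A"
    proof
      fix A assume A: "A \<in> ?good"
      then have "length (A i) = \<mu> i" if "i < n" for i
        using that by (simp add: T.arrays_def T.valid_row_def)
      moreover have "A i = []" if "\<not> i < n" for i using A that by (simp add: T.arrays_def)
      ultimately show "?g (?f A) = A"
        by (auto simp: fun_eq_iff D diagram_def intro!: nth_equalityI)
    qed
    show "\<forall>T\<in>grothendieck_P_tableaux P r l. ?f (?g T) = T"
    proof
      fix T assume "T \<in> grothendieck_P_tableaux P r l"
      then have "T \<in> ?D \<rightarrow>\<^sub>E (P <+> {0<..})" by (simp add: grothendieck_P_tableaux_def Let_def)
      then have "T c = undefined" if "c \<notin> ?D" for c using that by (rule PiE_arb)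
      then show "?f (?g T) = T"
        using D_lt by (auto simp: fun_eq_iff D diagram_def)
    qed
    show "?f ` ?good \<subseteq> grothendieck_P_tableaux P r l"
    proof
      fix T assume "T \<in> ?f ` ?good"
      then obtain A where A: "A \<in> ?good" and T: "T = ?f A" by blast
      have T_eq: "T (i, j) = A i ! j" if "(i, j) \<in> ?D" for i j using that by (simp add: T)
      have row: "sorted_wrt (row_rel r) (A i)" "set (A i) \<subseteq> P <+> {0<..i}" "length (A i) = \<mu> i" if "i < n" for i
        using A that by (auto simp: T.arrays_def T.valid_row_def)
      have mem: "T (i, j) \<in> P <+> {0<..i}" if "(i, j) \<in> ?D" for i j
        using row[OF D_lt[OF that]] that by (auto simp: T_eq D diagram_def dest: nth_mem)
      have hor: "row_rel r (T (i, j)) (T (i, Suc j))" if "(i, Suc j) \<in> ?D" for i j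
      proof -
        have "(i, j) \<in> ?D" using that by (simp add: D diagram_def)
        then show ?thesis using row[OF D_lt[OF that]] that
          by (simp add: T_eq D diagram_def sorted_wrt_nth_less)
      qed
      have up: "(i, j) \<in> ?D" if "(Suc i, j) \<in> ?D" for i j
        using that anti[of i] by (simp add: D diagram_def)
      have ver: "\<not> row_rel r (T (Suc i, j)) (T (i, j))" if "(Suc i, j) \<in> ?D" for i j
      proof -
        have "\<not> T.flaw A j i" using A by simp
        then show ?thesis
          using that row(3)[OF D_lt[OF that]] row(3)[OF D_lt[OF up[OF that]]] D_lt[OF that] up[OF that]
          by (simp add: T.flaw_def T_eq) (simp add: D diagram_def)
      qed
      \<comment> \<open>The first column of row \<open>i\<close> without a poset element. The row
        condition puts only integers to its right, and the column condition makes
        \<open>\<kappa>\<close> decrease, so \<open>\<kappa>\<close> is the shape of the poset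
        part.\<close>
      define \<kappa> where "\<kappa> i = (LEAST j. (i, j) \<in> ?D \<longrightarrow> T (i, j) \<notin> Inl ` P)" for i
      have \<kappa>: "(i, j) \<in> ?D \<and> T (i, j) \<in> Inl ` P \<longleftrightarrow> j < \<kappa> i" for i j
      proof -
        let ?Q = "\<lambda>j. (i, j) \<in> ?D \<longrightarrow> T (i, j) \<notin> Inl ` P"
        have "?Q (\<mu> i)" by (simp add: D diagram_def)
        then have Q: "?Q (\<kappa> i)" unfolding \<kappa>_def by (rule LeastI)
        have step: "?Q (Suc j)" if "?Q j" for j
        proof (intro impI notI)
          assume *: "(i, Suc j) \<in> ?D" "T (i, Suc j) \<in> Inl ` P"
          then have "(i, j) \<in> ?D" by (simp add: D diagram_def)
          then show False using hor[OF *(1)] *(2) that mem[of i j] by (cases "T (i, j)") auto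
        qed
        have "?Q j" if "\<kappa> i \<le> j" using that by (induction rule: dec_induct) (rule Q, rule step)
        moreover have "\<not> ?Q j" if "j < \<kappa> i" using that unfolding \<kappa>_def by (rule not_less_Least)
        ultimately show ?thesis by (cases "j < \<kappa> i") auto
      qed
      have "\<kappa> \<in> shapes n"
      proof -
        have "\<kappa> (Suc i) \<le> \<kappa> i" for i
        proof (rule ccontr)
          assume "\<not> ?thesis"
          then have *: "(Suc i, \<kappa> i) \<in> ?D" "T (Suc i, \<kappa> i) \<in> Inl ` P" using \<kappa>[of "Suc i" "\<kappa> i"] by auto
          then have "T (i, \<kappa> i) \<notin> Inl ` P" using \<kappa>[of i "\<kappa> i"] up by simp
          then show False using ver[OF *(1)] *(2) mem[OF up[OF *(1)]] by (cases "T (i, \<kappa> i)") auto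
        qed
        moreover have "\<kappa> n = 0" using \<kappa>[of n 0] D_lt[of n 0] by auto
        ultimately show ?thesis by (simp add: shapes_def)
      qed
      then obtain k where k: "is_partition k" "part_fun k = \<kappa>" by (rule shapes_partition)
      have "young_diagram k = {c \<in> ?D. T c \<in> Inl ` P}"
        using \<kappa> by (auto simp: young_diagram_eq k(2) diagram_def[of \<kappa>])
      then have part: "\<exists>k. is_partition k \<and> young_diagram k \<subseteq> ?D \<and> {c \<in> ?D. T c \<in> Inl ` P} = young_diagram k"
        using k(1) by (intro exI[of _ k]) auto
      have cover: "\<exists>c\<in>?D. T c = Inl p" if "p \<in> P" for p
      proof -
        have "Inl p \<in> (\<Union>j<n. set (A j))" using A that by (auto simp: T.arrays_def)
        then obtain i j where "i < n" "j < length (A i)" "A i ! j = Inl p"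
          by (auto simp: in_set_conv_nth)
        then show ?thesis
          using row(3)[of i] T_eq[of i j] by (intro bexI[of _ "(i, j)"]) (auto simp: D diagram_def)
      qed
      have "T \<in> ?D \<rightarrow>\<^sub>E (P <+> {0<..})"
      proof (rule PiE_I)
        fix c assume "c \<in> ?D"
        then show "T c \<in> P <+> {0<..}" using mem[of "fst c" "snd c"] by auto
      qed (simp add: T)
      moreover have "\<forall>i j p. (i, j) \<in> ?D \<longrightarrow> T (i, j) = Inl p \<longrightarrow>
          (\<forall>q. (i, Suc j) \<in> ?D \<longrightarrow> T (i, Suc j) = Inl q \<longrightarrow> p \<prec> q) \<and>
          (\<forall>q. (Suc i, j) \<in> ?D \<longrightarrow> T (Suc i, j) = Inl q \<longrightarrow> \<not> q \<prec> p)"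
      proof (intro allI impI conjI)
        fix i j p q assume *: "(i, j) \<in> ?D" "T (i, j) = Inl p" "(i, Suc j) \<in> ?D" "T (i, Suc j) = Inl q"
        show "(p, q) \<in> r" "p \<noteq> q" using hor[OF *(3)] *(2,4) by simp_all
      next
        fix i j p q assume *: "(i, j) \<in> ?D" "T (i, j) = Inl p" "(Suc i, j) \<in> ?D" "T (Suc i, j) = Inl q"
        show "\<not> q \<prec> p" using ver[OF *(3)] *(2,4) by simp
      qed
      moreover have "\<forall>i j m. (i, j) \<in> ?D \<longrightarrow> T (i, j) = Inr m \<longrightarrow>
          (\<forall>m'. (i, Suc j) \<in> ?D \<longrightarrow> T (i, Suc j) = Inr m' \<longrightarrow> m \<le> m') \<and>
          (\<forall>m'. (Suc i, j) \<in> ?D \<longrightarrow> T (Suc i, j) = Inr m' \<longrightarrow> m < m') \<and> m \<le> i"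
      proof (intro allI impI conjI)
        fix i j m m' assume *: "(i, j) \<in> ?D" "T (i, j) = Inr m" "(i, Suc j) \<in> ?D" "T (i, Suc j) = Inr m'"
        show "m \<le> m'" using hor[OF *(3)] *(2,4) by simp
      next
        fix i j m m' assume *: "(i, j) \<in> ?D" "T (i, j) = Inr m" "(Suc i, j) \<in> ?D" "T (Suc i, j) = Inr m'"
        show "m < m'" using ver[OF *(3)] *(2,4) by simp
      next
        fix i j m assume "(i, j) \<in> ?D" "T (i, j) = Inr m"
        then show "m \<le> i" using mem[of i j] by auto
      qed
      ultimately show "T \<in> grothendieck_P_tableaux P r l"
        unfolding grothendieck_P_tableaux_def Let_def using part cover
        by (intro CollectI conjI ballI) assumption+
    qed
    show "?g ` grothendieck_P_tableaux P r l \<subseteq> ?good"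
    proof
      fix A assume "A \<in> ?g ` grothendieck_P_tableaux P r l"
      then obtain T where T: "T \<in> grothendieck_P_tableaux P r l" and A: "A = ?g T" by blast
      have T1: "T \<in> ?D \<rightarrow>\<^sub>E (P <+> {0<..})"
        and T2: "\<exists>k. is_partition k \<and> young_diagram k \<subseteq> ?D \<and> {c \<in> ?D. T c \<in> Inl ` P} = young_diagram k"
        and T3: "\<And>p. p \<in> P \<Longrightarrow> \<exists>c\<in>?D. T c = Inl p"
        and T4: "\<And>i j p q. (i, j) \<in> ?D \<Longrightarrow> T (i, j) = Inl p \<Longrightarrow> (i, Suc j) \<in> ?D \<Longrightarrow> T (i, Suc j) = Inl q \<Longrightarrow> p \<prec> q"
        and T5: "\<And>i j p q. (i, j) \<in> ?D \<Longrightarrow> T (i, j) = Inl p \<Longrightarrow> (Suc i, j) \<in> ?D \<Longrightarrow> T (Suc i, j) = Inl q \<Longrightarrow> \<not> q \<prec> p"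
        and T6: "\<And>i j m m'. (i, j) \<in> ?D \<Longrightarrow> T (i, j) = Inr m \<Longrightarrow> (i, Suc j) \<in> ?D \<Longrightarrow> T (i, Suc j) = Inr m' \<Longrightarrow> m \<le> m'"
        and T7: "\<And>i j m m'. (i, j) \<in> ?D \<Longrightarrow> T (i, j) = Inr m \<Longrightarrow> (Suc i, j) \<in> ?D \<Longrightarrow> T (Suc i, j) = Inr m' \<Longrightarrow> m < m'"
        and T8: "\<And>i j m. (i, j) \<in> ?D \<Longrightarrow> T (i, j) = Inr m \<Longrightarrow> m \<le> i"
        using T unfolding grothendieck_P_tableaux_def Let_def by blast+
      obtain k where k: "is_partition k" "{c \<in> ?D. T c \<in> Inl ` P} = young_diagram k" using T2 by blast
      have left: "(i, j) \<in> ?D" if "(i, Suc j) \<in> ?D" for i j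
        using that by (simp add: D diagram_def)
      have up: "(i, j) \<in> ?D" if "(Suc i, j) \<in> ?D" for i j
        using that anti[of i] by (simp add: D diagram_def)
      have T_mem: "T c \<in> P <+> {0<..}" if "c \<in> ?D" for c using T1 that by auto
      have k_mem: "T c \<in> Inl ` P \<longleftrightarrow> c \<in> diagram (part_fun k)" if "c \<in> ?D" for c
        using k(2) that by (auto simp: young_diagram_eq)
      \<comment> \<open>The requirement that the poset cells form a Young diagram enters through
        this fact and the next: left and upper neighbours of poset cells are poset cells.\<close>
      have left_P: "T (i, j) \<in> Inl ` P" if "(i, Suc j) \<in> ?D" "T (i, Suc j) \<in> Inl ` P" for i j
        using k_mem[OF that(1)] k_mem[OF left[OF that(1)]] that(2) by (simp add: diagram_def)
      have up_P: "T (i, j) \<in> Inl ` P" if "(Suc i, j) \<in> ?D" "T (Suc i, j) \<in> Inl ` P" for i j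
        using k_mem[OF that(1)] k_mem[OF up[OF that(1)]] that(2)
          shapes_antimono[OF part_fun_shapes[OF k(1) order_refl], of i "Suc i"] by (simp add: diagram_def)
      have in_D: "(i, j) \<in> ?D" if "j < \<mu> i" for i j using that by (simp add: D diagram_def)
      have hor: "row_rel r (T (i, j)) (T (i, Suc j))" if lt: "Suc j < \<mu> i" for i j
      proof (cases "T (i, Suc j)")
        case (Inl q)
        then have "T (i, Suc j) \<in> Inl ` P" using T_mem[OF in_D[OF lt]] by auto
        then obtain p where "T (i, j) = Inl p" using left_P[OF in_D[OF lt]] by auto
        then show ?thesis using T4[OF left[OF in_D[OF lt]] _ in_D[OF lt] Inl] Inl by simp
      next
        case (Inr m')
        then show ?thesis
          using T6[OF left[OF in_D[OF lt]] _ in_D[OF lt] Inr] by (cases "T (i, j)") auto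
      qed
      have ver: "\<not> row_rel r (T (Suc i, j)) (T (i, j))" if lt: "j < \<mu> (Suc i)" for i j
      proof (cases "T (Suc i, j)")
        case (Inl q)
        then have "T (Suc i, j) \<in> Inl ` P" using T_mem[OF in_D[OF lt]] by auto
        then obtain p where "T (i, j) = Inl p" using up_P[OF in_D[OF lt]] by auto
        then show ?thesis using T5[OF up[OF in_D[OF lt]] _ in_D[OF lt] Inl] Inl by simp
      next
        case (Inr m')
        then show ?thesis
          using T7[OF up[OF in_D[OF lt]] _ in_D[OF lt] Inr] by (cases "T (i, j)") (auto simp: not_le)
      qed
      have "transp (row_rel r)" using row_rel_trans by (rule transpI)
      then have "T.valid_row i i (A i)" if "i < n" for i
        using that hor in_D T_mem T8
        by (fastforce simp: T.valid_row_def A sorted_wrt_iff_nth_Suc_transp)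
      moreover have "Inl ` P \<subseteq> (\<Union>j<n. set (A j))"
      proof clarify
        fix p assume "p \<in> P"
        then obtain i j where "(i, j) \<in> ?D" "T (i, j) = Inl p" using T3 by fastforce
        then show "Inl p \<in> (\<Union>j<n. set (A j))"
          using D_lt[of i j] by (intro UN_I[of i]) (force simp: A D diagram_def)+
      qed
      moreover have "\<not> T.flaw A c i" for c i
        using ver[of c i] anti[of i] by (auto simp: T.flaw_def A)
      ultimately show "A \<in> ?good" by (simp add: T.arrays_def) (simp add: A)
    qed
  qed
  then show ?thesis by (rule bij_betw_same_card)
qed

text \<open>Sorting the arrays by the poset entries of each row gives the chain covers; for a fixed
  cover the rows are independent.\<close>

lemma card_arrays:
  "int (card (T.arrays p)) = (\<Sum>C\<in>chain_covers P r n. \<Prod>j<n.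
    num_tails (p j) (int (\<mu> (p j)) + int j - int (p j) - int (card (C j))))"
proof -
  let ?R = "\<lambda>C. \<Pi>\<^sub>E j\<in>{..<n}. part_rows j (\<mu> (p j)) (p j) (C j)"
  have fin: "finite (part_rows j m f C)" for j m f C
    by (rule finite_subset[OF _ finite_lists_length_le[of "P <+> {0<..f}" "m + j"]])
       (use finite_P in \<open>auto simp: part_rows_def\<close>)
  have "bij_betw (\<lambda>A. (\<lambda>j\<in>{..<n}. Inl -` set (A j), restrict A {..<n})) (T.arrays p)
      (SIGMA C:chain_covers P r n. ?R C)"
  proof (rule bij_betw_byWitness[where f' = "\<lambda>(C, A) j. if j < n then A j else []"])
    show "\<forall>A\<in>T.arrays p. (\<lambda>(C, A) j. if j < n then A j else [])
        (\<lambda>j\<in>{..<n}. Inl -` set (A j), restrict A {..<n}) = A"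
      by (auto simp: T.arrays_def fun_eq_iff)
    show "\<forall>B\<in>SIGMA C:chain_covers P r n. ?R C.
        (\<lambda>A. (\<lambda>j\<in>{..<n}. Inl -` set (A j), restrict A {..<n})) ((\<lambda>(C, A) j. if j < n then A j else []) B) = B"
      by (auto simp: chain_covers_def part_rows_def fun_eq_iff PiE_iff extensional_def)
    show "(\<lambda>A. (\<lambda>j\<in>{..<n}. Inl -` set (A j), restrict A {..<n})) ` T.arrays p \<subseteq> (SIGMA C:chain_covers P r n. ?R C)"
    proof clarify
      fix A assume A: "A \<in> T.arrays p"
      have rows: "sorted_wrt (row_rel r) (A j)" "set (A j) \<subseteq> P <+> {0<..p j}"
        "length (A j) + p j = \<mu> (p j) + j" if "j < n" for j
        using A that by (auto simp: T.arrays_def T.valid_row_def)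
      have "Inl -` set (A j) \<in> chains P r" if j: "j < n" for j
      proof -
        obtain l xs where l: "A j = map Inl l @ map Inr xs" "sorted_wrt (strictly_below r) l"
          using split_row[OF rows(1)[OF j]] .
        have "Inl -` set (A j) = set l" by (auto simp: l(1))
        moreover have "set l \<subseteq> P" using rows(2)[OF j] by (auto simp: l(1))
        moreover have "(a, b) \<in> r \<or> (b, a) \<in> r" if ab: "a \<in> set l" "b \<in> set l" for a b
        proof (cases "a = b")
          case True
          then show ?thesis using ab \<open>set l \<subseteq> P\<close> po
            by (auto simp: partial_order_on_def preorder_on_def refl_on_def)
        next
          case False
          then show ?thesis using ab l(2) by (induction l) auto
        qed
        ultimately show ?thesis by (simp add: chains_def)
      qed
      moreover have "(\<Union>j<n. Inl -` set (A j)) = P"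
        using A rows(2) by (fastforce simp: T.arrays_def)
      ultimately have "(\<lambda>j\<in>{..<n}. Inl -` set (A j)) \<in> chain_covers P r n"
        by (simp add: chain_covers_def)
      moreover have "restrict A {..<n} \<in> ?R (\<lambda>j\<in>{..<n}. Inl -` set (A j))"
        using rows by (simp add: part_rows_def PiE_iff)
      ultimately show "(\<lambda>j\<in>{..<n}. Inl -` set (A j)) \<in> chain_covers P r n \<and>
          restrict A {..<n} \<in> ?R (\<lambda>j\<in>{..<n}. Inl -` set (A j))" by blast
    qed
    show "(\<lambda>(C, A) j. if j < n then A j else []) ` (SIGMA C:chain_covers P r n. ?R C) \<subseteq> T.arrays p"
    proof clarify
      fix C A assume C: "C \<in> chain_covers P r n" and A: "A \<in> ?R C"
      have rows: "A j \<in> part_rows j (\<mu> (p j)) (p j) (C j)" if "j < n" for j using A that by auto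
      have "Inl ` P \<subseteq> (\<Union>j<n. set (A j))"
      proof clarify
        fix x assume "x \<in> P"
        then obtain j where "j < n" "x \<in> C j" using C by (auto simp: chain_covers_def)
        then show "Inl x \<in> (\<Union>j<n. set (A j))" using rows[of j] by (auto simp: part_rows_def)
      qed
      then show "(\<lambda>j. if j < n then A j else []) \<in> T.arrays p"
        using rows by (simp add: T.arrays_def T.valid_row_def part_rows_def)
    qed
  qed
  then have "card (T.arrays p) = card (SIGMA C:chain_covers P r n. ?R C)"
    by (rule bij_betw_same_card)
  also have "\<dots> = (\<Sum>C\<in>chain_covers P r n. card (?R C))"
    using finite_chain_covers[OF finite_P] fin by (intro card_SigmaI ballI) (auto intro!: finite_PiE)
  finally have "int (card (T.arrays p)) = (\<Sum>C\<in>chain_covers P r n. \<Prod>j<n.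
      int (card (part_rows j (\<mu> (p j)) (p j) (C j))))"
    by (simp add: card_PiE)
  also have "\<dots> = (\<Sum>C\<in>chain_covers P r n. \<Prod>j<n.
      num_tails (p j) (int (\<mu> (p j)) + int j - int (p j) - int (card (C j))))"
    by (intro sum.cong prod.cong refl card_part_rows) (auto simp: chain_covers_def)
  finally show ?thesis .
qed

text \<open>The term of \<open>p\<close> in \<open>dual\<close> counts, for each cover, the ways to
  append tails to its chains, so the functional becomes the signed count of arrays.\<close>

lemma sum_dual_chain_covers:
  "(\<Sum>C\<in>chain_covers P r n. dual n \<mu> (\<lambda>j. n - Suc j + card (C j))) =
    int (card {A \<in> T.arrays id. \<forall>c r. \<not> T.flaw A c r})"
proof -
  have "(\<Sum>C\<in>chain_covers P r n. dual n \<mu> (\<lambda>j. n - Suc j + card (C j))) =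
      (\<Sum>p | p permutes {..<n}. sign p * (\<Sum>C\<in>chain_covers P r n. \<Prod>j<n.
        num_tails (p j) (int (shifted n \<mu> (p j)) - int (n - Suc j + card (C j)))))"
    unfolding dual_def atLeast0LessThan by (subst sum.swap) (simp only: sum_distrib_left)
  also have "\<dots> = (\<Sum>p | p permutes {..<n}. sign p * int (card (T.arrays p)))"
  proof (intro sum.cong refl arg_cong2[of _ _ _ _ "(*)"])
    fix p assume "p \<in> {p. p permutes {..<n}}"
    then have p_lt: "p j < n" if "j < n" for j using permutes_in_image[of p "{..<n}" j] that by simp
    have eq: "int (shifted n \<mu> (p j)) - int (n - Suc j + card (C j)) =
        int (\<mu> (p j)) + int j - int (p j) - int (card (C j))" if "j < n" for j and C :: "nat \<Rightarrow> 'a set"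
      using that p_lt[OF that] unfolding shifted_def by linarith
    show "(\<Sum>C\<in>chain_covers P r n. \<Prod>j<n.
        num_tails (p j) (int (shifted n \<mu> (p j)) - int (n - Suc j + card (C j)))) = int (card (T.arrays p))"
      unfolding card_arrays by (intro sum.cong prod.cong refl) (simp only: lessThan_iff eq)
  qed
  finally show ?thesis by (simp only: T.signed_count_arrays)
qed

theorem sum_dual_P_tableaux:
  assumes "is_partition l" "part_fun l = \<mu>"
  shows "(\<Sum>C\<in>chain_covers P r n. dual n \<mu> (\<lambda>j. n - Suc j + card (C j))) =
    int (card (grothendieck_P_tableaux P r l))"
  using sum_dual_chain_covers card_flawless_arrays[OF assms] by simp

end

end

section \<open>Expansions in finitely many variables\<close>

abbreviation vars :: "nat \<Rightarrow> mpoly" where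
  "vars i \<equiv> Var (Suc i)"

lemma one_minus_Var_nz: "1 - Var i \<noteq> 0"
proof
  assume "1 - Var i = 0"
  then have "coeff (1 - Var i) 0 = 0" by simp
  then show False by (simp add: lookup_minus Var_def lookup_single)
qed

lemma vandermonde_vars_nz: "vandermonde n vars \<noteq> 0"
proof -
  have "Var (Suc i) - Var (Suc k) \<noteq> 0" if "i < k" for i k
    using that by (auto simp: Var_def dest!: arg_cong[where f = "\<lambda>f. coeff f {#Suc i#}"] simp: lookup_single)
  then show ?thesis by (auto simp: vandermonde_def)
qed

lemma vandermonde_alternant: "vandermonde n vars = alternant n (\<lambda>j. n - Suc j)"
  by (simp add: vandermonde_eq_det alternant_def)

text \<open>\<open>alternating_eq_0\<close> for the difference, written as one sum over the disjoint
  union of the index sets.\<close>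

lemma alternants_eqI:
  assumes fin: "finite S" "finite S'"
    and dual: "\<And>\<mu>. \<mu> \<in> shapes n \<Longrightarrow> (\<Sum>t\<in>S. w t * dual n \<mu> (e t)) = (\<Sum>t\<in>S'. w' t * dual n \<mu> (e' t))"
  shows "(\<Sum>t\<in>S. of_int (w t) * alternant n (e t)) = (\<Sum>t\<in>S'. of_int (w' t) * alternant n (e' t))"
proof -
  define W where "W = case_sum w (\<lambda>t. - w' t)"
  define e'' where "e'' = case_sum e e'"
  have "(\<Sum>t\<in>S. of_int (w t) * alternant n (e t)) - (\<Sum>t\<in>S'. of_int (w' t) * alternant n (e' t)) =
      (\<Sum>t\<in>S <+> S'. of_int (W t) * alternant n (e'' t))"
    using fin by (simp add: sum.Plus W_def e''_def comp_def sum_negf)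
  then have "(\<Sum>t\<in>S. of_int (w t) * alternant n (e t)) - (\<Sum>t\<in>S'. of_int (w' t) * alternant n (e' t)) = 0"
  proof (rule alternating_eq_0)
    fix \<mu> assume "\<mu> \<in> shapes n"
    then show "(\<Sum>t\<in>S <+> S'. W t * dual n \<mu> (e'' t)) = 0"
      using fin by (simp add: sum.Plus W_def e''_def comp_def sum_negf dual)
  qed
  then show ?thesis by simp
qed

text \<open>The Kromatic function with all variables after the \<open>n\<close>-th set to zero; see
  \<open>coeff_chain_poly\<close>.\<close>

definition chain_poly :: "'a set \<Rightarrow> 'a rel \<Rightarrow> nat \<Rightarrow> mpoly" where
  "chain_poly P r n = (\<Sum>C\<in>chain_covers P r n. \<Prod>i<n. vars i ^ card (C i))"

lemma chain_covers_permute: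
  assumes "C \<in> chain_covers P r n" and p: "p permutes {..<n}"
  shows "restrict (C \<circ> p) {..<n} \<in> chain_covers P r n"
proof -
  have "p ` {..<n} = {..<n}" using p by (rule permutes_image)
  then have "(\<Union>i<n. C (p i)) = (\<Union>i<n. C i)" by (metis image_image)
  then show ?thesis
    using assms permutes_in_image[OF p] by (auto simp: chain_covers_def PiE_iff)
qed

lemma chain_poly_permute:
  assumes p: "p permutes {..<n}"
  shows "chain_poly P r n = (\<Sum>C\<in>chain_covers P r n. \<Prod>j<n. vars (p j) ^ card (C j))"
  unfolding chain_poly_def
proof (rule sum.reindex_bij_witness[where j = "\<lambda>C. restrict (C \<circ> p) {..<n}"
      and i = "\<lambda>C. restrict (C \<circ> inv_into UNIV p) {..<n}"])
  note p' = permutes_inv[OF p]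
  fix C assume C: "C \<in> chain_covers P r n"
  then have ext: "C i = undefined" if "\<not> i < n" for i
    using that by (auto simp: chain_covers_def PiE_iff extensional_def)
  show "restrict (C \<circ> p) {..<n} \<in> chain_covers P r n" "restrict (C \<circ> inv_into UNIV p) {..<n} \<in> chain_covers P r n"
    using chain_covers_permute[OF C] p p' by blast+
  show "restrict (restrict (C \<circ> p) {..<n} \<circ> inv_into UNIV p) {..<n} = C"
    "restrict (restrict (C \<circ> inv_into UNIV p) {..<n} \<circ> p) {..<n} = C"
    using permutes_in_image[OF p] permutes_in_image[OF p'] permutes_inverses[OF p] ext
    by (auto simp: fun_eq_iff)
  show "(\<Prod>j<n. vars (p j) ^ card (restrict (C \<circ> p) {..<n} j)) = (\<Prod>i<n. vars i ^ card (C i))"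
    using prod.permute[OF p, of "\<lambda>i. vars i ^ card (C i)"] by (simp add: comp_def)
qed

text \<open>By symmetry the variables of the chain polynomial may be permuted along with each term
  of the Vandermonde determinant; then the exponents of \<delta> and of a cover add up inside a
  single alternant.\<close>

lemma vandermonde_chain_poly:
  "vandermonde n vars * chain_poly P r n =
    (\<Sum>C\<in>chain_covers P r n. of_int 1 * alternant n (\<lambda>j. n - Suc j + card (C j)))"
proof -
  have expand: "alternant n e = (\<Sum>p | p permutes {..<n}. of_int (sign p) * (\<Prod>j<n. vars (p j) ^ e j))" for e
  proof -
    have "p j < n" if "p permutes {..<n}" "j < n" for p j
      using permutes_in_image[OF that(1), of j] that(2) by simp
    then show ?thesis
      unfolding alternant_def by (subst det_col[where n = n]) (auto simp: atLeast0LessThan intro!: sum.cong prod.cong)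
  qed
  have "vandermonde n vars * chain_poly P r n = (\<Sum>p | p permutes {..<n}.
      of_int (sign p) * (\<Prod>j<n. vars (p j) ^ (n - Suc j)) * chain_poly P r n)"
    by (simp add: vandermonde_alternant expand sum_distrib_right)
  also have "\<dots> = (\<Sum>p | p permutes {..<n}. \<Sum>C\<in>chain_covers P r n.
      of_int (sign p) * (\<Prod>j<n. vars (p j) ^ (n - Suc j + card (C j))))"
  proof (intro sum.cong refl)
    fix p assume "p \<in> {p. p permutes {..<n}}"
    then have p: "p permutes {..<n}" by simp
    show "of_int (sign p) * (\<Prod>j<n. vars (p j) ^ (n - Suc j)) * chain_poly P r n =
        (\<Sum>C\<in>chain_covers P r n. of_int (sign p) * (\<Prod>j<n. vars (p j) ^ (n - Suc j + card (C j))))"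
      unfolding chain_poly_permute[OF p] power_add prod.distrib sum_distrib_left mult.assoc by (rule refl)
  qed
  also have "\<dots> = (\<Sum>C\<in>chain_covers P r n. of_int 1 * alternant n (\<lambda>j. n - Suc j + card (C j)))"
    by (subst sum.swap) (simp add: expand)
  finally show ?thesis .
qed

abbreviation offsets :: "nat \<Rightarrow> (nat \<Rightarrow> nat) set" where
  "offsets n \<equiv> \<Pi>\<^sub>E j\<in>{..<n}. {..j}"

context
  fixes n :: nat and L :: "nat list set" and d :: "nat list \<Rightarrow> int"
  assumes fin: "finite L" and L: "\<And>l. l \<in> L \<Longrightarrow> is_partition l \<and> length l \<le> n"
begin

lemma vandermonde_groth_sum:
  "vandermonde n vars * (\<Sum>l\<in>L. of_int (d l) * groth_poly n (part_fun l) Var) =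
    (\<Sum>(l, k)\<in>L \<times> offsets n. of_int (d l * binomial_weight n k) *
      alternant n (\<lambda>j. shifted n (part_fun l) j + k j))"
proof -
  have "vandermonde n vars * (\<Sum>l\<in>L. of_int (d l) * groth_poly n (part_fun l) Var) =
      (\<Sum>l\<in>L. of_int (d l) * (vandermonde n vars * groth_poly n (part_fun l) Var))"
    by (simp add: sum_distrib_left mult.left_commute)
  also have "\<dots> = (\<Sum>l\<in>L. \<Sum>k\<in>offsets n. of_int (d l * binomial_weight n k) *
      alternant n (\<lambda>j. shifted n (part_fun l) j + k j))"
  proof (intro sum.cong refl)
    fix l assume "l \<in> L"
    then have sh: "part_fun l \<in> shapes n" using L part_fun_shapes by blast
    show "of_int (d l) * (vandermonde n vars * groth_poly n (part_fun l) Var) =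
        (\<Sum>k\<in>offsets n. of_int (d l * binomial_weight n k) *
          alternant n (\<lambda>j. shifted n (part_fun l) j + k j))"
      unfolding vandermonde_groth_poly[where x = Var, OF one_minus_Var_nz sh]
      by (simp add: groth_det_alternants sum_distrib_left mult.assoc)
  qed
  finally show ?thesis by (simp add: sum.cartesian_product)
qed

text \<open>Duality reads the coefficient at shape \<open>l\<close> off the combination.\<close>

lemma dual_groth_sum:
  assumes l: "is_partition l" "length l \<le> n"
  shows "(\<Sum>(l', k)\<in>L \<times> offsets n. d l' * binomial_weight n k *
      dual n (part_fun l) (\<lambda>j. shifted n (part_fun l') j + k j)) = (if l \<in> L then d l else 0)"
proof -
  have "(\<Sum>(l', k)\<in>L \<times> offsets n. d l' * binomial_weight n k *
      dual n (part_fun l) (\<lambda>j. shifted n (part_fun l') j + k j)) =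
      (\<Sum>l'\<in>L. d l' * (\<Sum>k\<in>offsets n. binomial_weight n k *
        dual n (part_fun l) (\<lambda>j. shifted n (part_fun l') j + k j)))"
    by (simp add: sum.cartesian_product[symmetric] sum_distrib_left mult.assoc)
  also have "\<dots> = (\<Sum>l'\<in>L. if l' = l then d l else 0)"
  proof (intro sum.cong refl)
    fix l' assume "l' \<in> L"
    then have l': "is_partition l'" "part_fun l' \<in> shapes n" using L part_fun_shapes by blast+
    show "d l' * (\<Sum>k\<in>offsets n. binomial_weight n k *
        dual n (part_fun l) (\<lambda>j. shifted n (part_fun l') j + k j)) = (if l' = l then d l else 0)"
      using dual_groth_det[OF part_fun_shapes[OF l] l'(2)] part_fun_inj[OF l(1) l'(1)] by auto
  qed
  finally show ?thesis using fin by simp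
qed

end

section \<open>Coefficients of the polynomials as coefficients of the power series\<close>

lemma mset_set_eq_sum: "mset_set A = (\<Sum>i\<in>A. {#i#})"
  by (induction A rule: infinite_finite_induct) simp_all

lemma cell_weight_Var:
  assumes "finite S" "S \<noteq> {}"
  shows "cell_weight Var S = Poly_Mapping.single (mset_set S) ((-1) ^ (card S - 1))"
proof -
  have "(-1) ^ card S = - ((-1) ^ (card S - 1) :: int)"
    using assms by (cases "card S") auto
  moreover have "- Var i = Poly_Mapping.single {#i#} (-1)" for i
    by (simp add: Var_def single_uminus)
  then have "cell_weight Var S = - Poly_Mapping.single (mset_set S) ((-1) ^ card S)"
    by (simp only: cell_weight_def prod_single prod_constant flip: mset_set_eq_sum)
  ultimately show ?thesis by (simp add: single_uminus)
qed

lemma card_young_diagram: "card (young_diagram l) = sum_list l"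
proof -
  have "young_diagram l = (SIGMA i:{..<length l}. {..<l ! i})"
    by (auto simp: young_diagram_def)
  then show ?thesis by (simp add: sum_list_sum_nth atLeast0LessThan)
qed

lemma set_label_monomial:
  assumes "finite D" "c \<in> D" "finite (T c)"
  shows "T c \<subseteq> set_mset (label_monomial D T)"
proof -
  have "mset_set (T c) \<subseteq># label_monomial D T"
    using assms by (simp add: label_monomial_def sum.remove)
  then show ?thesis using assms(3) by (metis finite_set_mset_mset_set set_mset_mono)
qed

text \<open>A monomial in the first \<open>n\<close> variables leaves no room for labels above
  \<open>n\<close>, so both kinds of tableaux have the same fibre over it.\<close>

lemma svt_eq_set_valued_tableaux:
  assumes l: "is_partition l" and m: "set_mset m \<subseteq> {1..n}"
  shows "{T \<in> svt n (part_fun l). label_monomial (young_diagram l) T = m} =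
    {T \<in> set_valued_tableaux l. label_monomial (young_diagram l) T = m}"
proof -
  let ?D = "young_diagram l"
  have step: "(\<forall>a\<in>A. \<forall>b\<in>B. a \<le> b) \<longleftrightarrow> Max A \<le> Min B" "(\<forall>a\<in>A. \<forall>b\<in>B. a < b) \<longleftrightarrow> Max A < Min B"
    if "finite A" "A \<noteq> {}" "finite B" "B \<noteq> {}" for A B :: "nat set"
    using that by auto
  have "T \<in> svt n (part_fun l) \<longleftrightarrow> T \<in> set_valued_tableaux l" if lab: "label_monomial ?D T = m" for T
  proof -
    have pie: "T \<in> ?D \<rightarrow>\<^sub>E Pow {1..n} - {{}} \<longleftrightarrow> T \<in> ?D \<rightarrow>\<^sub>E label_sets"
    proof -
      have "T c \<in> Pow {1..n} - {{}} \<longleftrightarrow> T c \<in> label_sets" if c: "c \<in> ?D" for c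
      proof
        assume "T c \<in> label_sets"
        then show "T c \<in> Pow {1..n} - {{}}"
          using set_label_monomial[OF finite_young_diagram c, of T] m lab by (auto simp: label_sets_def)
      qed (use finite_subset[of "T c" "{1..n}"] in \<open>auto simp: label_sets_def\<close>)
      then show ?thesis by (simp only: PiE_iff) blast
    qed
    have left: "(i, j) \<in> ?D" if "(i, Suc j) \<in> ?D" for i j
      using that by (simp add: young_diagram_def)
    show ?thesis
    proof (cases "T \<in> ?D \<rightarrow>\<^sub>E label_sets")
      case True
      then have T: "finite (T c)" "T c \<noteq> {}" if "c \<in> ?D" for c using that by (auto simp: label_sets_def PiE_iff)
      have up: "(i, j) \<in> ?D" if "(Suc i, j) \<in> ?D" for i j
        using that shapes_antimono[OF part_fun_shapes[OF l order_refl], of i "Suc i"]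
        by (simp add: young_diagram_eq diagram_def)
      have row: "(\<forall>a\<in>T (i, j). \<forall>b\<in>T (i, Suc j). a \<le> b) \<longleftrightarrow> Max (T (i, j)) \<le> Min (T (i, Suc j))"
        if "(i, Suc j) \<in> ?D" for i j
        by (rule step(1)) (use T left[OF that] that in auto)
      have col: "(\<forall>a\<in>T (i, j). \<forall>b\<in>T (Suc i, j). a < b) \<longleftrightarrow> Max (T (i, j)) < Min (T (Suc i, j))"
        if "(Suc i, j) \<in> ?D" for i j
        by (rule step(2)) (use T up[OF that] that in auto)
      have rows: "(\<forall>i j. (i, Suc j) \<in> ?D \<longrightarrow> (\<forall>a\<in>T (i, j). \<forall>b\<in>T (i, Suc j). a \<le> b)) \<longleftrightarrow>
          (\<forall>i j. (i, j) \<in> ?D \<longrightarrow> (i, Suc j) \<in> ?D \<longrightarrow> Max (T (i, j)) \<le> Min (T (i, Suc j)))"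
        using row left by (metis (no_types, lifting))
      have cols: "(\<forall>i j. (Suc i, j) \<in> ?D \<longrightarrow> (\<forall>a\<in>T (i, j). \<forall>b\<in>T (Suc i, j). a < b)) \<longleftrightarrow>
          (\<forall>i j. (i, j) \<in> ?D \<longrightarrow> (Suc i, j) \<in> ?D \<longrightarrow> Max (T (i, j)) < Min (T (Suc i, j)))"
        using col up by (metis (no_types, lifting))
      show ?thesis
        unfolding svt_def set_valued_tableaux_def young_diagram_eq[symmetric] mem_Collect_eq pie rows cols
        by (rule refl)
    next
      case False
      then show ?thesis
        unfolding svt_def set_valued_tableaux_def young_diagram_eq[symmetric] mem_Collect_eq pie by simp
    qed
  qed
  then show ?thesis by blast
qed

lemma label_monomial_svt:
  assumes "T \<in> svt n (part_fun l)"
  shows "set_mset (label_monomial (young_diagram l) T) \<subseteq> {1..n}"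
proof -
  have "finite (T c)" "T c \<subseteq> {1..n}" if "c \<in> young_diagram l" for c
  proof -
    have "T c \<in> Pow {1..n} - {{}}" using assms that by (auto simp: svt_def young_diagram_eq)
    then show "finite (T c)" "T c \<subseteq> {1..n}" using finite_subset[of "T c" "{1..n}"] by auto
  qed
  then show ?thesis
    unfolding label_monomial_def set_mset_sum[OF finite_young_diagram] by (intro UN_least) simp
qed

lemma coeff_groth_poly:
  assumes l: "is_partition l"
  shows "coeff (groth_poly n (part_fun l) Var) m = (if set_mset m \<subseteq> {1..n} then grothendieck l m else 0)"
proof -
  let ?D = "young_diagram l"
  let ?sgn = "\<lambda>T :: nat \<times> nat \<Rightarrow> nat set. (-1) ^ ((\<Sum>c\<in>?D. card (T c)) - sum_list l) :: int"
  have weight: "(\<Prod>c\<in>?D. cell_weight Var (T c)) = Poly_Mapping.single (label_monomial ?D T) (?sgn T)"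
    if T: "T \<in> svt n (part_fun l)" for T
  proof -
    have fin: "finite (T c)" "T c \<noteq> {}" if "c \<in> ?D" for c
    proof -
      have "T c \<in> Pow {1..n} - {{}}" using T that by (auto simp: svt_def young_diagram_eq)
      then show "finite (T c)" "T c \<noteq> {}" using finite_subset[of "T c" "{1..n}"] by auto
    qed
    have pos: "1 \<le> card (T c)" if "c \<in> ?D" for c using fin[OF that] by (simp add: Suc_le_eq card_gt_0_iff)
    have "(\<Prod>c\<in>?D. cell_weight Var (T c)) =
        (\<Prod>c\<in>?D. Poly_Mapping.single (mset_set (T c)) ((-1) ^ (card (T c) - 1)))"
      by (intro prod.cong refl cell_weight_Var fin)
    also have "\<dots> = Poly_Mapping.single (label_monomial ?D T) ((-1) ^ (\<Sum>c\<in>?D. card (T c) - 1))"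
      unfolding prod_single label_monomial_def power_sum by (rule refl)
    also have "(\<Sum>c\<in>?D. card (T c) - 1) = (\<Sum>c\<in>?D. card (T c)) - sum_list l"
      using pos by (simp add: sum_subtractf_nat card_young_diagram)
    finally show ?thesis .
  qed
  have fin: "finite (svt n (part_fun l))"
    using finite_svt[OF part_fun_shapes[OF l order_refl]] .
  have "coeff (groth_poly n (part_fun l) Var) m =
      (\<Sum>T\<in>svt n (part_fun l). if label_monomial ?D T = m then ?sgn T else 0)"
    unfolding groth_poly_def young_diagram_eq[symmetric] lookup_sum
    by (intro sum.cong refl) (simp add: weight lookup_single when_def)
  also have "\<dots> = (\<Sum>T\<in>{T \<in> svt n (part_fun l). label_monomial ?D T = m}. ?sgn T)"
    using fin by (simp add: sum.inter_filter)
  also have "\<dots> = (if set_mset m \<subseteq> {1..n} then grothendieck l m else 0)"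
  proof (cases "set_mset m \<subseteq> {1..n}")
    case True
    then show ?thesis
      by (simp add: svt_eq_set_valued_tableaux[OF l True] grothendieck_def formal_sum_def)
  next
    case False
    then have "{T \<in> svt n (part_fun l). label_monomial ?D T = m} = {}"
      using label_monomial_svt by blast
    then show ?thesis using False by (simp only: sum.empty if_False)
  qed
  finally show ?thesis .
qed

lemma grothendieck_nonzero:
  assumes "grothendieck l m \<noteq> 0"
  obtains T where "T \<in> set_valued_tableaux l" "label_monomial (young_diagram l) T = m"
  using assms unfolding grothendieck_def formal_sum_def by (metis (mono_tags, lifting) empty_Collect_eq sum.empty)

lemma grothendieck_nonzero_sum_list:
  assumes "grothendieck l m \<noteq> 0"
  shows "sum_list l \<le> size m"
proof -
  obtain T where T: "T \<in> set_valued_tableaux l" and m: "label_monomial (young_diagram l) T = m"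
    using grothendieck_nonzero[OF assms] .
  have "sum_list l = (\<Sum>c\<in>young_diagram l. 1)" by (simp add: card_young_diagram)
  also have "\<dots> \<le> (\<Sum>c\<in>young_diagram l. card (T c))"
  proof (rule sum_mono)
    fix c assume "c \<in> young_diagram l"
    then have "T c \<in> label_sets" using T by (auto simp: set_valued_tableaux_def)
    then show "1 \<le> card (T c)" by (simp add: label_sets_def Suc_le_eq card_gt_0_iff)
  qed
  also have "\<dots> = size m" by (simp add: label_monomial_def size_multiset_sum flip: m)
  finally show ?thesis .
qed

text \<open>Columns increase strictly, so a further row would need entries above
  \<open>n\<close>.\<close>

lemma grothendieck_nonzero_length:
  assumes l: "is_partition l" and "grothendieck l m \<noteq> 0" and m: "set_mset m \<subseteq> {1..n}"
  shows "length l \<le> n"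
proof (rule ccontr)
  assume "\<not> ?thesis"
  then have c: "(n, 0) \<in> diagram (part_fun l)"
    using part_fun_eq_0_iff[OF l, of n] by (simp add: diagram_def)
  obtain T where "T \<in> set_valued_tableaux l" "label_monomial (young_diagram l) T = m"
    using grothendieck_nonzero[OF assms(2)] .
  then have "T \<in> {T \<in> svt n (part_fun l). label_monomial (young_diagram l) T = m}"
    unfolding svt_eq_set_valued_tableaux[OF l m] by simp
  then have T: "T \<in> svt n (part_fun l)" by simp
  obtain a where a: "a \<in> T (n, 0)" using svt_entry(2)[OF T c] by blast
  then have "n < a" by (rule svt_row_less[OF T part_fun_shapes[OF l order_refl] c])
  then show False using svt_entry(1)[OF T c] a by auto
qed

lemma count_label_monomial:
  assumes "finite D" "\<And>c. c \<in> D \<Longrightarrow> finite (T c)"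
  shows "count (label_monomial D T) x = card {c \<in> D. x \<in> T c}"
proof -
  have "count (label_monomial D T) x = (\<Sum>c\<in>D. if x \<in> T c then 1 else 0)"
    unfolding label_monomial_def count_sum using assms(2) by (intro sum.cong refl) auto
  also have "\<dots> = card {c \<in> D. x \<in> T c}"
    using assms(1) by (simp add: sum.If_cases Int_def)
  finally show ?thesis .
qed

lemma set_monomial: "set_mset (monomial n \<beta>) \<subseteq> {1..n}"
  unfolding monomial_def by (subst set_mset_sum) auto

lemma count_monomial_outside: "x \<notin> {1..n} \<Longrightarrow> count (monomial n \<beta>) x = 0"
  using set_monomial[of n \<beta>] by (meson not_in_iff subsetD)

lemma size_monomial: "size (monomial n \<beta>) = (\<Sum>i<n. \<beta> i)"
  by (simp add: monomial_def size_multiset_sum)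

context claw_free_poset
begin

abbreviation "inc_graph \<equiv> with_proj (incomparability_graph P r)"

text \<open>Colourings and chain covers are two readings of one incidence relation between vertices
  and colours: disjoint labels on incomparable vertices mean that colour classes are chains,
  nonempty labels mean that the chains cover.\<close>

lemma coeff_chain_poly:
  assumes m: "set_mset m \<subseteq> {1..n}"
  shows "coeff (chain_poly P r n) m = kromatic inc_graph m"
proof -
  let ?S = "{\<kappa> \<in> proper_set_colorings inc_graph. label_monomial P \<kappa> = m}"
  let ?S' = "{C \<in> chain_covers P r n. monomial n (\<lambda>i. card (C i)) = m}"
  let ?f = "\<lambda>\<kappa>. \<lambda>i\<in>{..<n}. {v \<in> P. Suc i \<in> \<kappa> v}"
  let ?g = "\<lambda>C. \<lambda>v\<in>P. Suc ` {i. i < n \<and> v \<in> C i}"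
  have proper: "\<kappa> \<in> proper_set_colorings inc_graph \<longleftrightarrow> \<kappa> \<in> P \<rightarrow>\<^sub>E label_sets \<and>
      (\<forall>u\<in>P. \<forall>v\<in>P. u \<noteq> v \<and> (u, v) \<notin> r \<and> (v, u) \<notin> r \<longrightarrow> \<kappa> u \<inter> \<kappa> v = {})" for \<kappa>
    by (auto simp: proper_set_colorings_def incomparability_graph_def)
  have refl: "(v, v) \<in> r" if "v \<in> P" for v
    using po that by (auto simp: partial_order_on_def preorder_on_def refl_on_def)
  have labels: "finite (\<kappa> v)" "\<kappa> v \<noteq> {}" "\<kappa> v \<subseteq> {1..n}" if "\<kappa> \<in> ?S" "v \<in> P" for \<kappa> v
  proof -
    have "\<kappa> v \<in> label_sets" using that by (auto simp: proper)
    then show fin: "finite (\<kappa> v)" and "\<kappa> v \<noteq> {}" by (auto simp: label_sets_def)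
    show "\<kappa> v \<subseteq> {1..n}"
      using set_label_monomial[where T = \<kappa>, OF finite_P that(2) fin] m that(1) by auto
  qed
  have mono_f: "monomial n (\<lambda>i. card (?f \<kappa> i)) = label_monomial P \<kappa>"
    if "\<And>v. v \<in> P \<Longrightarrow> finite (\<kappa> v) \<and> \<kappa> v \<subseteq> {1..n}" for \<kappa>
  proof (rule multiset_eqI)
    fix x
    have cnt: "count (label_monomial P \<kappa>) x = card {v \<in> P. x \<in> \<kappa> v}"
      using that by (intro count_label_monomial finite_P) auto
    show "count (monomial n (\<lambda>i. card (?f \<kappa> i))) x = count (label_monomial P \<kappa>) x"
    proof (cases "x \<in> {1..n}")
      case True
      then obtain i where "x = Suc i" "i < n" by (cases x) auto
      then show ?thesis using cnt count_monomial[of i n "\<lambda>i. card (?f \<kappa> i)"] by simp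
    next
      case False
      then have "{v \<in> P. x \<in> \<kappa> v} = {}" using that by blast
      then show ?thesis using cnt count_monomial_outside[OF False] by (simp only: card.empty)
    qed
  qed
  have f_mem: "?f \<kappa> \<in> ?S'" if \<kappa>: "\<kappa> \<in> ?S" for \<kappa>
  proof -
    have "{v \<in> P. Suc i \<in> \<kappa> v} \<in> chains P r" for i
    proof -
      have "(a, b) \<in> r \<or> (b, a) \<in> r" if ab: "a \<in> P" "Suc i \<in> \<kappa> a" "b \<in> P" "Suc i \<in> \<kappa> b" for a b
      proof (rule ccontr)
        assume inc: "\<not> ?thesis"
        then have "a \<noteq> b" using refl ab(1) by blast
        then have "\<kappa> a \<inter> \<kappa> b = {}" using \<kappa> ab inc by (simp add: proper)
        then show False using ab by blast
      qed
      then show ?thesis by (auto simp: chains_def)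
    qed
    moreover have "(\<Union>i<n. {v \<in> P. Suc i \<in> \<kappa> v}) = P"
    proof -
      have "\<exists>i<n. Suc i \<in> \<kappa> v" if v: "v \<in> P" for v
      proof -
        obtain x where "x \<in> \<kappa> v" "x \<in> {1..n}" using labels(2,3)[OF \<kappa> v] by blast
        then obtain i where "x = Suc i" "i < n" by (cases x) auto
        then show ?thesis using \<open>x \<in> \<kappa> v\<close> by blast
      qed
      then show ?thesis by auto
    qed
    moreover have "monomial n (\<lambda>i. card (?f \<kappa> i)) = m"
      using mono_f[of \<kappa>] labels[OF \<kappa>] \<kappa> by simp
    ultimately show ?thesis by (simp add: chain_covers_def)
  qed
  have gf: "?g (?f \<kappa>) = \<kappa>" if \<kappa>: "\<kappa> \<in> ?S" for \<kappa>
  proof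
    fix v
    show "?g (?f \<kappa>) v = \<kappa> v"
    proof (cases "v \<in> P")
      case True
      have "x \<in> Suc ` {i. i < n \<and> Suc i \<in> \<kappa> v}" if x: "x \<in> \<kappa> v" for x
      proof -
        obtain i where "x = Suc i" "i < n" using labels(3)[OF \<kappa> True] x by (cases x) auto
        then show ?thesis using x by blast
      qed
      then show ?thesis using True by auto
    next
      case False
      have "\<kappa> \<in> P \<rightarrow>\<^sub>E label_sets" using \<kappa> by (simp add: proper)
      then have "\<kappa> v = undefined" using False by (rule PiE_arb)
      then show ?thesis using False by simp
    qed
  qed
  have fg: "?f (?g C) = C" if C: "C \<in> ?S'" for C
  proof
    fix i
    have "C i \<subseteq> P" if "i < n" using C that by (auto simp: chain_covers_def chains_def)
    moreover have "C i = undefined" if "\<not> i < n" using C that by (auto simp: chain_covers_def PiE_iff extensional_def)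
    ultimately show "?f (?g C) i = C i" by auto
  qed
  have g_mem: "?g C \<in> ?S" if C: "C \<in> ?S'" for C
  proof -
    have cover: "(\<Union>i<n. C i) = P" and chain: "\<And>i. i < n \<Longrightarrow> C i \<in> chains P r"
      using C by (auto simp: chain_covers_def)
    have "?g C v \<in> label_sets" if v: "v \<in> P" for v
    proof -
      obtain i where "i < n" "v \<in> C i" using v cover by blast
      then show ?thesis using v by (auto simp: label_sets_def)
    qed
    moreover have "?g C u \<inter> ?g C v = {}" if "u \<in> P" "v \<in> P" "(u, v) \<notin> r" "(v, u) \<notin> r" for u v
      using chain that by (auto simp: chains_def)
    moreover have "label_monomial P (?g C) = m"
    proof -
      have "monomial n (\<lambda>i. card (?f (?g C) i)) = label_monomial P (?g C)"
        by (rule mono_f) auto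
      then show ?thesis using C unfolding fg[OF C] by simp
    qed
    ultimately show ?thesis by (auto simp: proper)
  qed
  have "bij_betw ?f ?S ?S'"
    using f_mem gf fg g_mem by (intro bij_betw_byWitness[where f' = ?g]) blast+
  then have "card ?S = card ?S'" by (rule bij_betw_same_card)
  moreover have "kromatic inc_graph m = int (card ?S)"
    by (simp add: kromatic_def formal_sum_def incomparability_graph_def)
  moreover have "coeff (chain_poly P r n) m = int (card ?S')"
  proof -
    have "(\<Prod>i<n. vars i ^ card (C i)) = Poly_Mapping.single (monomial n (\<lambda>i. card (C i))) 1" for C :: "nat \<Rightarrow> 'a set"
      by (simp add: Var_power prod_single monomial_def)
    then have "coeff (chain_poly P r n) m =
        (\<Sum>C\<in>chain_covers P r n. if monomial n (\<lambda>i. card (C i)) = m then 1 else 0)"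
      unfolding chain_poly_def lookup_sum by (intro sum.cong refl) auto
    then show ?thesis
      using finite_chain_covers[OF finite_P] by (simp add: sum.If_cases Int_def)
  qed
  ultimately show ?thesis by simp
qed

text \<open>Row 0 admits no positive integer, so it is a chain of the poset. This bounds all parts
  and leaves finitely many shapes in \<open>n\<close> variables.\<close>

lemma P_tableau_part_le:
  assumes l: "is_partition l" and T: "T \<in> grothendieck_P_tableaux P r l"
  shows "set l \<subseteq> {..card P}"
proof -
  have T1: "T \<in> young_diagram l \<rightarrow>\<^sub>E (P <+> {0<..})"
    and T2: "\<And>i j p q. (i, j) \<in> young_diagram l \<Longrightarrow> T (i, j) = Inl p \<Longrightarrow> (i, Suc j) \<in> young_diagram l
      \<Longrightarrow> T (i, Suc j) = Inl q \<Longrightarrow> p \<prec> q"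
    and T3: "\<And>i j m. (i, j) \<in> young_diagram l \<Longrightarrow> T (i, j) = Inr m \<Longrightarrow> m \<le> i"
    using T unfolding grothendieck_P_tableaux_def Let_def by blast+
  have "part_fun l 0 \<le> card P"
  proof -
    define f where "f j = projl (T (0, j))" for j
    have D: "(0, j) \<in> young_diagram l" if "j < part_fun l 0" for j
      using that by (simp add: young_diagram_eq diagram_def)
    have f: "T (0, j) = Inl (f j)" "f j \<in> P" if "j < part_fun l 0" for j
    proof -
      have "T (0, j) \<in> P <+> {0<..}" using T1 D[OF that] by auto
      moreover have "T (0, j) \<noteq> Inr m" if "0 < m" for m using T3[OF D[OF \<open>j < part_fun l 0\<close>], of m] that by auto
      ultimately show "T (0, j) = Inl (f j)" "f j \<in> P" by (auto simp: f_def)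
    qed
    have step: "f j \<prec> f (Suc j)" if "Suc j < part_fun l 0" for j
      using T2[of 0 j "f j" "f (Suc j)"] f[of j] f[of "Suc j"] D[of j] D[of "Suc j"] that by auto
    have "transp below" using below_trans by (blast intro: transpI)
    then have "sorted_wrt below (map f [0..<part_fun l 0])"
      using step by (subst sorted_wrt_iff_nth_Suc_transp) auto
    moreover have "sorted_wrt below xs \<Longrightarrow> distinct xs" for xs
      by (induction xs) auto
    ultimately have "distinct (map f [0..<part_fun l 0])" by blast
    then have "inj_on f {..<part_fun l 0}" by (simp add: distinct_map atLeast0LessThan)
    then have "card {..<part_fun l 0} \<le> card P"
      using f(2) finite_P by (intro card_inj_on_le[of f]) auto
    then show ?thesis by simp
  qed
  moreover have "l ! i \<le> part_fun l 0" if "i < length l" for i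
    using shapes_antimono[OF part_fun_shapes[OF l order_refl], of 0 i] that by (simp add: part_fun_def)
  ultimately show ?thesis by (force simp: in_set_conv_nth)
qed

definition small_partitions :: "nat \<Rightarrow> nat list set" where
  "small_partitions n = {l. is_partition l \<and> length l \<le> n \<and> set l \<subseteq> {..card P}}"

lemma finite_small_partitions: "finite (small_partitions n)"
  by (rule finite_subset[OF _ finite_lists_length_le[of "{..card P}" n]]) (auto simp: small_partitions_def)

abbreviation num_tableaux :: "nat list \<Rightarrow> int" where
  "num_tableaux l \<equiv> int (card (grothendieck_P_tableaux P r l))"

lemma num_tableaux_eq_0:
  assumes "is_partition l" "length l \<le> n" "l \<notin> small_partitions n"
  shows "num_tableaux l = 0"
proof -
  have "grothendieck_P_tableaux P r l = {}"
    using P_tableau_part_le[OF assms(1)] assms by (auto simp: small_partitions_def)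
  then show ?thesis by simp
qed

text \<open>Multiplied by the Vandermonde determinant, both sides are combinations of alternants on
  which the functionals agree, by \<open>sum_dual_P_tableaux\<close> on the left and by duality on
  the right. The nonzero factor then cancels.\<close>

theorem chain_poly_expansion:
  "chain_poly P r n = (\<Sum>l\<in>small_partitions n. of_int (num_tableaux l) * groth_poly n (part_fun l) Var)"
proof -
  have L: "is_partition l \<and> length l \<le> n" if "l \<in> small_partitions n" for l
    using that by (simp add: small_partitions_def)
  note fin = finite_small_partitions[of n]
  have "(\<Sum>C\<in>chain_covers P r n. of_int 1 * alternant n (\<lambda>j. n - Suc j + card (C j))) =
      (\<Sum>t\<in>small_partitions n \<times> offsets n. of_int (case t of (l, k) \<Rightarrow> num_tableaux l * binomial_weight n k) *
        alternant n (case t of (l, k) \<Rightarrow> \<lambda>j. shifted n (part_fun l) j + k j))"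
  proof (rule alternants_eqI)
    show "finite (chain_covers P r n)" by (rule finite_chain_covers[OF finite_P])
    show "finite (small_partitions n \<times> offsets n)" using fin by (simp add: finite_PiE)
    fix \<mu> assume "\<mu> \<in> shapes n"
    then obtain l where l: "is_partition l" "length l \<le> n" "part_fun l = \<mu>" by (rule shapes_partition)
    have "(\<Sum>C\<in>chain_covers P r n. 1 * dual n \<mu> (\<lambda>j. n - Suc j + card (C j))) = num_tableaux l"
      using sum_dual_P_tableaux[OF \<open>\<mu> \<in> shapes n\<close> l(1,3)] by simp
    also have "\<dots> = (if l \<in> small_partitions n then num_tableaux l else 0)"
      using num_tableaux_eq_0[OF l(1,2)] by simp
    also have "\<dots> = (\<Sum>(l', k)\<in>small_partitions n \<times> offsets n. num_tableaux l' * binomial_weight n k *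
        dual n (part_fun l) (\<lambda>j. shifted n (part_fun l') j + k j))"
      using dual_groth_sum[OF fin L l(1,2), of "\<lambda>l. num_tableaux l"] by simp
    finally show "(\<Sum>C\<in>chain_covers P r n. 1 * dual n \<mu> (\<lambda>j. n - Suc j + card (C j))) =
        (\<Sum>t\<in>small_partitions n \<times> offsets n. (case t of (l, k) \<Rightarrow> num_tableaux l * binomial_weight n k) *
          dual n \<mu> (case t of (l, k) \<Rightarrow> \<lambda>j. shifted n (part_fun l) j + k j))"
      by (simp add: case_prod_beta l(3))
  qed
  then have "vandermonde n vars * chain_poly P r n = vandermonde n vars *
      (\<Sum>l\<in>small_partitions n. of_int (num_tableaux l) * groth_poly n (part_fun l) Var)"
    using vandermonde_groth_sum[OF fin L, of num_tableaux]
    by (simp add: vandermonde_chain_poly case_prod_beta)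
  then show ?thesis using vandermonde_vars_nz by simp
qed

theorem kromatic_expansion:
  "grothendieck_expansion (kromatic inc_graph) (\<lambda>l. if is_partition l then num_tableaux l else 0)"
  (is "grothendieck_expansion _ ?c")
proof -
  have "finite {l. ?c l * grothendieck l m \<noteq> 0} \<and>
      kromatic inc_graph m = (\<Sum>l\<in>{l. ?c l * grothendieck l m \<noteq> 0}. ?c l * grothendieck l m)" for m
  proof (cases "0 \<in># m")
    \<comment> \<open>Labels avoid 0, so both sides vanish on monomials containing it.\<close>
    case True
    have "grothendieck l m = 0" for l
    proof (rule ccontr)
      assume "grothendieck l m \<noteq> 0"
      then obtain T where "T \<in> set_valued_tableaux l" "label_monomial (young_diagram l) T = m"
        by (rule grothendieck_nonzero)
      then show False
        using True by (auto simp: set_valued_tableaux_def label_monomial_def set_mset_sum finite_young_diagram label_sets_def PiE_iff)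
    qed
    moreover have "{\<kappa> \<in> proper_set_colorings inc_graph. label_monomial (verts inc_graph) \<kappa> = m} = {}"
      using True finite_P
      by (auto simp: proper_set_colorings_def label_monomial_def set_mset_sum label_sets_def PiE_iff incomparability_graph_def)
    then have "kromatic inc_graph m = 0" unfolding kromatic_def formal_sum_def by (simp only: sum.empty)
    ultimately show ?thesis by simp
  next
    case False
    \<comment> \<open>The number of variables depends on the monomial; joining 0 provides a maximum
      for the empty one.\<close>
    define n where "n = Max (set_mset m \<union> {0})"
    have m: "set_mset m \<subseteq> {1..n}"
    proof
      fix x assume x: "x \<in># m"
      then have "x \<noteq> 0" using False by metis
      moreover have "x \<le> n" unfolding n_def using x by (intro Max_ge) auto
      ultimately show "x \<in> {1..n}" by simp
    qed
    have sub: "{l. ?c l * grothendieck l m \<noteq> 0} \<subseteq> small_partitions n"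
    proof
      fix l assume "l \<in> {l. ?c l * grothendieck l m \<noteq> 0}"
      then have l: "is_partition l" "num_tableaux l \<noteq> 0" "grothendieck l m \<noteq> 0"
        by (auto split: if_splits)
      then show "l \<in> small_partitions n"
        using num_tableaux_eq_0[OF l(1) grothendieck_nonzero_length[OF l(1,3) m]] by blast
    qed
    have "kromatic inc_graph m = (\<Sum>l\<in>small_partitions n. num_tableaux l * coeff (groth_poly n (part_fun l) Var) m)"
      unfolding coeff_chain_poly[OF m, symmetric] chain_poly_expansion lookup_sum coeff_of_int_mult by (rule refl)
    also have "\<dots> = (\<Sum>l\<in>small_partitions n. ?c l * grothendieck l m)"
      using m by (intro sum.cong refl) (simp add: coeff_groth_poly small_partitions_def)
    also have "\<dots> = (\<Sum>l\<in>{l. ?c l * grothendieck l m \<noteq> 0}. ?c l * grothendieck l m)"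
      using sub finite_small_partitions by (intro sum.mono_neutral_right) auto
    finally show ?thesis using sub finite_small_partitions finite_subset by blast
  qed
  then show ?thesis by (simp add: grothendieck_expansion_def)
qed

end

section \<open>Uniqueness of the expansion\<close>

lemma length_le_sum_list: "is_partition l \<Longrightarrow> length l \<le> sum_list l"
proof (induction l)
  case (Cons a l)
  then have "is_partition l" "0 < a" by (auto simp: is_partition_def)
  then show ?case using Cons.IH by simp
qed simp

lemma sum_part_fun: "length l \<le> n \<Longrightarrow> (\<Sum>i<n. part_fun l i) = sum_list l"
proof -
  assume "length l \<le> n"
  then have "(\<Sum>i<n. part_fun l i) = (\<Sum>i<length l. part_fun l i)"
    by (intro sum.mono_neutral_right) (auto simp: part_fun_def)
  also have "\<dots> = sum_list l" by (simp add: part_fun_def sum_list_sum_nth atLeast0LessThan)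
  finally show ?thesis .
qed

text \<open>
  A nonzero difference of two expansions is detected by the functionals \<open>dual N\<close> on its part of
  shapes of size at most \<open>N\<close>: this is a polynomial without terms of degree up to \<open>N\<close>, and the
  functionals for these shapes only see such terms.
\<close>

theorem grothendieck_expansion_unique:
  assumes c: "grothendieck_expansion f c" and c': "grothendieck_expansion f c'"
  shows "c = c'"
proof
  fix l0
  show "c l0 = c' l0"
  proof (cases "is_partition l0")
    case False
    then show ?thesis using c c' by (simp add: grothendieck_expansion_def)
  next
    case True
    \<comment> \<open>\<open>N\<close> variables suffice for every shape of size at most
      \<open>N\<close>, since a partition has at most as many parts as its size.\<close>
    define N where "N = sum_list l0"
    define L where "L = {l. is_partition l \<and> sum_list l \<le> N}"
    define d where "d l = c l - c' l" for l
    define F where "F = (\<Sum>l\<in>L. of_int (d l) * groth_poly N (part_fun l) Var)"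
    have L: "is_partition l \<and> length l \<le> N" if "l \<in> L" for l
      using that length_le_sum_list[of l] by (auto simp: L_def)
    have "L \<subseteq> {l. set l \<subseteq> {..N} \<and> length l \<le> N}"
      using L member_le_sum_list by (fastforce simp: L_def)
    then have fin: "finite L" by (rule finite_subset) (simp add: finite_lists_length_le)
    \<comment> \<open>A Grothendieck function has no terms of degree below the size of its shape, so
      in degrees up to \<open>N\<close> the infinite sum reduces to \<open>L\<close>.\<close>
    have expand: "f m = (\<Sum>l\<in>L. e l * grothendieck l m)"
      if e: "grothendieck_expansion f e" and m: "size m \<le> N" for e m
    proof -
      have "l \<in> L" if "e l * grothendieck l m \<noteq> 0" for l
        using that e grothendieck_nonzero_sum_list[of l m] m
        by (auto simp: L_def grothendieck_expansion_def)
      then have "(\<Sum>l\<in>{l. e l * grothendieck l m \<noteq> 0}. e l * grothendieck l m) = (\<Sum>l\<in>L. e l * grothendieck l m)"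
        using fin by (intro sum.mono_neutral_left) auto
      then show ?thesis using e by (simp add: grothendieck_expansion_def)
    qed
    have F0: "coeff F m = 0" if m: "size m \<le> N" for m
    proof -
      have "(\<Sum>l\<in>L. d l * grothendieck l m) = 0"
        using expand[OF c m] expand[OF c' m] by (simp add: d_def left_diff_distrib sum_subtractf)
      moreover have "coeff F m = (\<Sum>l\<in>L. d l * (if set_mset m \<subseteq> {1..N} then grothendieck l m else 0))"
        unfolding F_def lookup_sum coeff_of_int_mult by (intro sum.cong refl) (simp add: coeff_groth_poly L)
      ultimately show ?thesis by (cases "set_mset m \<subseteq> {1..N}") simp_all
    qed
    have "(\<Sum>t\<in>L \<times> offsets N. (case t of (l, k) \<Rightarrow> d l * binomial_weight N k) *
        dual N (part_fun l0) (case t of (l, k) \<Rightarrow> \<lambda>j. shifted N (part_fun l) j + k j)) = 0"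
    proof (rule sum_dual_eq_0)
      show "vandermonde N vars * F = (\<Sum>t\<in>L \<times> offsets N. of_int (case t of (l, k) \<Rightarrow> d l * binomial_weight N k) *
          alternant N (case t of (l, k) \<Rightarrow> \<lambda>j. shifted N (part_fun l) j + k j))"
        using vandermonde_groth_sum[OF fin L, of d] by (simp add: F_def case_prod_beta)
      fix \<beta> assume \<beta>: "(\<Sum>i<N. \<beta> i) \<le> (\<Sum>i<N. shifted N (part_fun l0) i)"
      show "coeff (vandermonde N vars * F) (monomial N \<beta>) = 0"
      proof (rule ccontr)
        assume "coeff (vandermonde N vars * F) (monomial N \<beta>) \<noteq> 0"
        then obtain a b where ab: "monomial N \<beta> = a + b" "coeff (vandermonde N vars) a \<noteq> 0" "coeff F b \<noteq> 0"
          using keys_mult[of "vandermonde N vars" F] by (auto simp: in_keys_iff subset_iff)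
        \<comment> \<open>The Vandermonde determinant is homogeneous of degree
          \<open>|\<delta>|\<close>. A term of \<open>F\<close> has degree above \<open>N\<close>,
          so the product lies beyond the degree \<open>N + |\<delta>|\<close> that the functional at
          \<open>l0\<close> can see.\<close>
        have "size a = (\<Sum>j<N. N - Suc j)"
        proof (rule ccontr)
          assume ne: "size a \<noteq> (\<Sum>j<N. N - Suc j)"
          have "a \<noteq> (\<Sum>j<N. replicate_mset (N - Suc j) (Suc (p j)))" for p
            using ne by (auto simp: size_multiset_sum)
          then have "coeff (vandermonde N vars) a = 0"
            by (simp add: vandermonde_alternant alternant_expand lookup_sum coeff_of_int_mult lookup_single when_def)
          then show False using ab(2) by simp
        qed
        moreover have "N < size b" using F0[of b] ab(3) by (meson not_le)
        moreover have "(\<Sum>i<N. shifted N (part_fun l0) i) = N + (\<Sum>j<N. N - Suc j)"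
          using sum_part_fun[OF length_le_sum_list[OF True]] unfolding shifted_def sum.distrib N_def
          by (rule arg_cong)
        moreover have "(\<Sum>i<N. \<beta> i) = size a + size b"
          using arg_cong[OF ab(1), of size] by (simp add: size_monomial)
        ultimately show False using \<beta> by linarith
      qed
    qed
    then have "d l0 = 0"
      using dual_groth_sum[OF fin L True, of d] length_le_sum_list[OF True] True
      by (simp add: case_prod_beta L_def N_def)
    then show ?thesis by (simp add: d_def)
  qed
qed

theorem theorem3p9:
  fixes P :: "'a set" and r :: "'a rel"
  assumes "finite P" and "partial_order_on P r"
    and "claw_free (with_proj (incomparability_graph P r))"
  shows "let X = kromatic (with_proj (incomparability_graph P r)) in
    (\<exists>!c. grothendieck_expansion X c) \<and>
    (\<forall>l. is_partition l \<longrightarrow>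
      grothendieck_coeff l X \<ge> 0 \<and>
      grothendieck_coeff l X = int (card (grothendieck_P_tableaux P r l)))"
proof -
  interpret claw_free_poset P r
    using assms by unfold_locales
  let ?c = "\<lambda>l. if is_partition l then num_tableaux l else 0"
  have unique: "c = ?c" if "grothendieck_expansion (kromatic inc_graph) c" for c
    using grothendieck_expansion_unique[OF that kromatic_expansion] .
  have "(THE c. grothendieck_expansion (kromatic inc_graph) c) = ?c"
    using kromatic_expansion unique by (rule the_equality)
  moreover have "\<exists>!c. grothendieck_expansion (kromatic inc_graph) c"
    using kromatic_expansion unique by (rule ex1I)
  ultimately show ?thesis by (simp add: grothendieck_coeff_def)
qed

end
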